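(* The following decision problem is NP-complete: given two separated ordered matchings $M$ and $N$, decide whether $N$ is a subgraph of $M$. Likewise, the problem of deciding, for two given separated ordered matchings $M$ and $N$, whether $N$ is an induced subgraph of $M$ is NP-complete.
   Context: An ordered graph is a finite simple graph whose vertex set is equipped with a total (linear) order. An ordered matching is an ordered graph in which every vertex is incident to exactly one edge. An ordered graph $N$ is a subgraph of an ordered graph $M$ if there is an injective map $\varphi: V(N)\to V(M)$ with $u<v \Rightarrow \varphi(u)<\varphi(v)$ and $uv\in E(N)\Rightarrow \varphi(u)\varphi(v)\in E(M)$; it is an induced subgraph if moreover $uv\in E(N)\iff \varphi(u)\varphi(v)\in E(M)$. For an ordered graph $G$ with vertices $v_1<\dots<v_n$ and $i\in\{1,\dots,n-1\}$, the $i$-th cut is the partition $(S,T)$ with $S=\{v_1,\dots,v_i\}$, $T=\{v_{i+1},\dots,v_n\}$; an edge goes across this cut if it has one endpoint in $S$ and one in $T$. An ordered graph $G$ is separated if there is $i\in\{1,\dots,|V(G)|-1\}$ such that every edge of $G$ goes across the $i$-th cut. *)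

theory Defs
  imports Main "HOL-Computational_Algebra.Polynomial"
begin

text \<open>
  Deterministic multi-tape Turing machines. States are the numbers \<open>0, \<dots>, n_states M\<close>, where
  \<open>0\<close> is initial and \<open>n_states M\<close> is the halting state. Tape symbols are the numbers below
  \<open>n_symbols M\<close>; \<open>0\<close> is the blank and \<open>1\<close>, \<open>2\<close> represent the bits \<open>False\<close>, \<open>True\<close>.
  Tapes are infinite in both directions.
\<close>

datatype direction = MoveLeft | Stay | MoveRight

type_synonym tape = "(int \<Rightarrow> nat) \<times> int"

record turing_machine =
  n_tapes :: nat
  n_symbols :: nat
  n_states :: nat
  transition :: "nat \<Rightarrow> nat list \<Rightarrow> nat \<times> (nat \<times> direction) list"

definition wf_tm :: "turing_machine \<Rightarrow> bool" where
  "wf_tm M \<longleftrightarrow> 1 \<le> n_tapes M \<and> 3 \<le> n_symbols M \<and>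
     (\<forall>q < n_states M. \<forall>rs. length rs = n_tapes M \<and> (\<forall>r\<in>set rs. r < n_symbols M) \<longrightarrow>
        (case transition M q rs of (q', acts) \<Rightarrow>
           q' \<le> n_states M \<and> length acts = n_tapes M \<and> (\<forall>(s, d)\<in>set acts. s < n_symbols M)))"

fun displacement :: "direction \<Rightarrow> int" where
  "displacement MoveLeft = -1"
| "displacement Stay = 0"
| "displacement MoveRight = 1"

fun read_tape :: "tape \<Rightarrow> nat" where
  "read_tape (c, h) = c h"

fun update_tape :: "nat \<times> direction \<Rightarrow> tape \<Rightarrow> tape" where
  "update_tape (s, d) (c, h) = (c(h := s), h + displacement d)"

fun tm_step :: "turing_machine \<Rightarrow> nat \<times> tape list \<Rightarrow> nat \<times> tape list" where
  "tm_step M (q, tps) =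
     (if q < n_states M
      then case transition M q (map read_tape tps) of (q', acts) \<Rightarrow> (q', map2 update_tape acts tps)
      else (q, tps))"

definition bit_symbol :: "bool \<Rightarrow> nat" where
  "bit_symbol b = (if b then 2 else 1)"

definition word_tape :: "bool list \<Rightarrow> tape" where
  "word_tape w = (\<lambda>i. if 0 \<le> i \<and> i < int (length w) then bit_symbol (w ! nat i) else 0, 0)"

definition initial_config :: "turing_machine \<Rightarrow> bool list \<Rightarrow> nat \<times> tape list" where
  "initial_config M w = (0, word_tape w # replicate (n_tapes M - 1) (word_tape []))"

text \<open>
  The output is read off the last tape, from cell \<open>0\<close> up to the first blank. It is unique
  because bit symbols are not blank.
\<close>

definition output_on_tape :: "tape \<Rightarrow> bool list \<Rightarrow> bool" where
  "output_on_tape tp w \<longleftrightarrow>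
     (\<forall>i < length w. fst tp (int i) = bit_symbol (w ! i)) \<and> fst tp (int (length w)) = 0"

definition computes_within ::
    "turing_machine \<Rightarrow> (bool list \<Rightarrow> bool list) \<Rightarrow> (nat \<Rightarrow> nat) \<Rightarrow> bool" where
  "computes_within M f T \<longleftrightarrow>
     (\<forall>x. \<exists>t \<le> T (length x). \<exists>tps.
        (tm_step M ^^ t) (initial_config M x) = (n_states M, tps) \<and>
        output_on_tape (last tps) (f x))"

definition polytime :: "(bool list \<Rightarrow> bool list) \<Rightarrow> bool" where
  "polytime f \<longleftrightarrow> (\<exists>M (p :: nat poly). wf_tm M \<and> computes_within M f (poly p))"

type_synonym language = "bool list set"

definition class_P :: "language set" where
  "class_P = {L. polytime (\<lambda>x. [x \<in> L])}"

text \<open>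
  A self-delimiting pairing of words: every bit of the first word is preceded by \<open>True\<close>, and
  its end is marked by \<open>False\<close>.
\<close>

definition pair_word :: "bool list \<Rightarrow> bool list \<Rightarrow> bool list" where
  "pair_word x y = concat (map (\<lambda>b. [True, b]) x) @ [False] @ y"

lemma pair_word_inject: "pair_word x y = pair_word x' y' \<longleftrightarrow> x = x' \<and> y = y'"
proof (induction x arbitrary: x')
  case Nil
  then show ?case by (cases x') (auto simp: pair_word_def)
next
  case (Cons b x)
  then show ?case by (cases x') (auto simp: pair_word_def)
qed

definition class_NP :: "language set" where
  "class_NP = {L. \<exists>R \<in> class_P. \<exists>p :: nat poly. \<forall>x.
      x \<in> L \<longleftrightarrow> (\<exists>u. length u \<le> poly p (length x) \<and> pair_word x u \<in> R)}"

definition polytime_reducible :: "language \<Rightarrow> language \<Rightarrow> bool" where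
  "polytime_reducible L L' \<longleftrightarrow> (\<exists>f. polytime f \<and> (\<forall>x. x \<in> L \<longleftrightarrow> f x \<in> L'))"

definition NP_hard :: "language \<Rightarrow> bool" where
  "NP_hard L \<longleftrightarrow> (\<forall>L' \<in> class_NP. polytime_reducible L' L)"

definition NP_complete :: "language \<Rightarrow> bool" where
  "NP_complete L \<longleftrightarrow> L \<in> class_NP \<and> NP_hard L"

text \<open>The vertices are ordered by the linear order of their type.\<close>

record 'a ordered_graph =
  verts :: "'a set"
  edges :: "'a set set"

definition ordered_graph :: "'a::linorder ordered_graph \<Rightarrow> bool" where
  "ordered_graph G \<longleftrightarrow> finite (verts G) \<and> (\<forall>e \<in> edges G. e \<subseteq> verts G \<and> card e = 2)"

definition ordered_matching :: "'a::linorder ordered_graph \<Rightarrow> bool" where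
  "ordered_matching G \<longleftrightarrow> ordered_graph G \<and> (\<forall>v \<in> verts G. \<exists>!e. e \<in> edges G \<and> v \<in> e)"

definition ordered_subgraph ::
    "'a::linorder ordered_graph \<Rightarrow> 'b::linorder ordered_graph \<Rightarrow> bool" where
  "ordered_subgraph N M \<longleftrightarrow> (\<exists>\<phi>. \<phi> ` verts N \<subseteq> verts M \<and> inj_on \<phi> (verts N) \<and>
     (\<forall>u \<in> verts N. \<forall>v \<in> verts N. u < v \<longrightarrow> \<phi> u < \<phi> v) \<and>
     (\<forall>u \<in> verts N. \<forall>v \<in> verts N. {u, v} \<in> edges N \<longrightarrow> {\<phi> u, \<phi> v} \<in> edges M))"

definition ordered_induced_subgraph ::
    "'a::linorder ordered_graph \<Rightarrow> 'b::linorder ordered_graph \<Rightarrow> bool" where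
  "ordered_induced_subgraph N M \<longleftrightarrow> (\<exists>\<phi>. \<phi> ` verts N \<subseteq> verts M \<and> inj_on \<phi> (verts N) \<and>
     (\<forall>u \<in> verts N. \<forall>v \<in> verts N. u < v \<longrightarrow> \<phi> u < \<phi> v) \<and>
     (\<forall>u \<in> verts N. \<forall>v \<in> verts N. {u, v} \<in> edges N \<longleftrightarrow> {\<phi> u, \<phi> v} \<in> edges M))"

definition vertex_list :: "'a::linorder ordered_graph \<Rightarrow> 'a list" where
  "vertex_list G = sorted_list_of_set (verts G)"

definition cut :: "'a::linorder ordered_graph \<Rightarrow> nat \<Rightarrow> 'a set \<times> 'a set" where
  "cut G i = (set (take i (vertex_list G)), set (drop i (vertex_list G)))"

definition goes_across :: "'a set \<Rightarrow> 'a set \<times> 'a set \<Rightarrow> bool" where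
  "goes_across e C \<longleftrightarrow> (\<exists>u \<in> fst C. \<exists>v \<in> snd C. e = {u, v})"

definition separated :: "'a::linorder ordered_graph \<Rightarrow> bool" where
  "separated G \<longleftrightarrow> (\<exists>i \<in> {1..card (verts G) - 1}. \<forall>e \<in> edges G. goes_across e (cut G i))"

text \<open>
  An ordered graph is presented by its number of vertices in unary followed by its adjacency
  matrix, row by row, with rows and columns in the order of the vertices. The encoding depends
  only on the isomorphism type, and every finite ordered graph is isomorphic to one with
  natural numbers as vertices.
\<close>

definition encode_graph :: "'a::linorder ordered_graph \<Rightarrow> bool list" where
  "encode_graph G = replicate (card (verts G)) True @ [False] @
     [{u, v} \<in> edges G. u \<leftarrow> vertex_list G, v \<leftarrow> vertex_list G]"

definition separated_matching_subgraph :: language where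
  "separated_matching_subgraph =
     {pair_word (encode_graph M) (encode_graph N) | (M :: nat ordered_graph) (N :: nat ordered_graph).
        ordered_matching M \<and> separated M \<and> ordered_matching N \<and> separated N \<and>
        ordered_subgraph N M}"

definition separated_matching_induced_subgraph :: language where
  "separated_matching_induced_subgraph =
     {pair_word (encode_graph M) (encode_graph N) | (M :: nat ordered_graph) (N :: nat ordered_graph).
        ordered_matching M \<and> separated M \<and> ordered_matching N \<and> separated N \<and>
        ordered_induced_subgraph N M}"

end

theory Submission imports Defs "HOL-Library.Countable" begin

text \<open>
  In a matching, every edge-preserving map of vertices also reflects edges, so the two languages are
  equal. A separated ordered matching is a permutation, and the problem is to decide whether a
  permutation contains another one as a pattern.

  A polynomial-time verifier receives the characteristic word of the image of the embedding. For
  hardness, the computation table of a polynomial-time verifier is described by a tiling whose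
  colour conditions have the form \<open>f (t a) \<le> g (t b)\<close> for the unknown tiles \<open>t a\<close>, \<open>t b\<close> of two
  cells. In the plane, every cell \<open>a\<close> owns a vertical strip, in which the text has one copy of every
  point for every tile, sorted by tiles, and every condition owns a horizontal strip, in which the
  copies are sorted by the values of \<open>f\<close> and \<open>g\<close>. The order of the pattern points in a strip forces
  the inequalities. In one further horizontal strip per cell the copies are sorted by decreasing
  tiles, which forces all points of a vertical strip to choose the same tile. Anchor points separate the
  strips; they are fixed because a monotone sequence of points longer than the rest of the text
  must meet its own image.

  Polynomial time computability is proved once, for all functions built from sums with
  definable bounds, by compiling them into counter programs and these into Turing machines.
\<close>

section \<open>Counter programs and their compilation to Turing machines\<close>

text \<open>The pattern can express only order relations between pairs of points, so a computation
  has to become a family of inequalities between numbers attached to cells, and the tile of a cell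
  must be the same in several horizontal strips at once. The two synchronising points of a cell
  achieve this: among the copies for one tile they come first and last, two opposite sortings leave
  them only a common tile, and every other point of the cell is enclosed between them.

  A transition depends on symbols under heads in distant columns. Every tile therefore repeats the
  whole list of symbols read; this list is passed along the row, and the next row becomes a local
  matter.

  The machine and the polynomials are fixed for the reduction, only the input word varies. Hence the
  number of tiles is a constant and every function of tiles is a table of constants, while all that
  grows with the input (strips, coordinates, neighbours) is given by arithmetic with
  \<open>div\<close> and \<open>mod\<close>.\<close>

datatype cond = NonZero nat | AtInput | AtOne

datatype com = Skip | Inc nat | Dec nat | InR | InL | Emit bool
  | Seq com com | Cond cond com com | Loop cond com

type_synonym cstate = "nat \<times> (nat \<Rightarrow> nat) \<times> bool list"

fun holds :: "bool list \<Rightarrow> cond \<Rightarrow> cstate \<Rightarrow> bool" where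
  "holds x (NonZero r) (h, v, out) \<longleftrightarrow> v r \<noteq> 0"
| "holds x AtInput (h, v, out) \<longleftrightarrow> h < length x"
| "holds x AtOne (h, v, out) \<longleftrightarrow> h < length x \<and> x ! h"

text \<open>The time counts the steps of the compiled machine exactly, so the simulation needs no
  estimates: \<open>CondT\<close> pays for the test and for the jump over the other branch,
  \<open>LoopT\<close> for the test and for the jump back. Decrementing a zero counter and moving
  left of the first input cell have no rule, since the machine would leave its intended tape
  layout.\<close>

inductive exec :: "bool list \<Rightarrow> com \<Rightarrow> cstate \<Rightarrow> nat \<Rightarrow> cstate \<Rightarrow> bool" for x where
  Skip: "exec x Skip s 0 s"
| Inc: "exec x (Inc r) (h, v, out) 1 (h, v(r := Suc (v r)), out)"
| Dec: "v r = Suc n \<Longrightarrow> exec x (Dec r) (h, v, out) 1 (h, v(r := n), out)"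
| InR: "exec x InR (h, v, out) 1 (Suc h, v, out)"
| InL: "exec x InL (Suc h, v, out) 1 (h, v, out)"
| Emit: "exec x (Emit b) (h, v, out) 1 (h, v, out @ [b])"
| Seq: "exec x c s t s' \<Longrightarrow> exec x c' s' t' s'' \<Longrightarrow> exec x (Seq c c') s (t + t') s''"
| CondT: "holds x b s \<Longrightarrow> exec x c s t s' \<Longrightarrow> exec x (Cond b c c') s (t + 2) s'"
| CondF: "\<not> holds x b s \<Longrightarrow> exec x c' s t s' \<Longrightarrow> exec x (Cond b c c') s (t + 1) s'"
| LoopF: "\<not> holds x b s \<Longrightarrow> exec x (Loop b c) s 1 s"
| LoopT: "holds x b s \<Longrightarrow> exec x c s t s' \<Longrightarrow> exec x (Loop b c) s' t' s'' \<Longrightarrow>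
    exec x (Loop b c) s (t + t' + 2) s''"

datatype instr = IInit | IInc nat | IDec nat | IInR | IInL | IEmit bool | IBranch cond nat nat

fun csize :: "com \<Rightarrow> nat" where
  "csize Skip = 0"
| "csize (Seq c c') = csize c + csize c'"
| "csize (Cond b c c') = csize c + csize c' + 2"
| "csize (Loop b c) = csize c + 2"
| "csize _ = 1"

text \<open>The argument \<open>q\<close> is the address of the first instruction, because jump
  targets are absolute. A branch with two equal targets serves as an unconditional jump.\<close>

fun compile :: "nat \<Rightarrow> com \<Rightarrow> instr list" where
  "compile q Skip = []"
| "compile q (Inc r) = [IInc r]"
| "compile q (Dec r) = [IDec r]"
| "compile q InR = [IInR]"
| "compile q InL = [IInL]"
| "compile q (Emit b) = [IEmit b]"
| "compile q (Seq c c') = compile q c @ compile (q + csize c) c'"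
| "compile q (Cond b c c') =
     IBranch b (q + 1) (q + 2 + csize c) # compile (q + 1) c @
     IBranch b (q + 2 + csize c + csize c') (q + 2 + csize c + csize c') #
     compile (q + 2 + csize c) c'"
| "compile q (Loop b c) =
     IBranch b (q + 1) (q + 2 + csize c) # compile (q + 1) c @ [IBranch b q q]"

lemma length_compile [simp]: "length (compile q c) = csize c"
  by (induction c arbitrary: q) auto

fun counters_below :: "nat \<Rightarrow> com \<Rightarrow> bool" where
  "counters_below k (Inc r) \<longleftrightarrow> r < k"
| "counters_below k (Dec r) \<longleftrightarrow> r < k"
| "counters_below k (Seq c c') \<longleftrightarrow> counters_below k c \<and> counters_below k c'"
| "counters_below k (Cond b c c') \<longleftrightarrow>
     (case b of NonZero r \<Rightarrow> r < k | _ \<Rightarrow> True) \<and> counters_below k c \<and> counters_below k c'"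
| "counters_below k (Loop b c) \<longleftrightarrow> (case b of NonZero r \<Rightarrow> r < k | _ \<Rightarrow> True) \<and> counters_below k c"
| "counters_below k _ \<longleftrightarrow> True"

lemma counters_below_mono: "counters_below k c \<Longrightarrow> k \<le> k' \<Longrightarrow> counters_below k' c"
  by (induction c) (auto split: cond.splits)

lemma ex_counters_below: "\<exists>k. counters_below k c"
proof (induction c)
  case (Seq c c')
  then obtain k k' where "counters_below k c" "counters_below k' c'" by auto
  then have "counters_below (max k k') (Seq c c')" by (auto intro: counters_below_mono)
  then show ?case by blast
next
  case (Cond b c c')
  then obtain k k' where "counters_below k c" "counters_below k' c'" by auto
  then have "counters_below (max (case b of NonZero r \<Rightarrow> Suc r | _ \<Rightarrow> 0) (max k k')) (Cond b c c')"
    by (auto intro: counters_below_mono split: cond.splits)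
  then show ?case by blast
next
  case (Loop b c)
  then obtain k where "counters_below k c" by auto
  then have "counters_below (max (case b of NonZero r \<Rightarrow> Suc r | _ \<Rightarrow> 0) k) (Loop b c)"
    by (auto intro: counters_below_mono split: cond.splits)
  then show ?case by blast
qed (auto intro: exI[of _ "Suc _"])

text \<open>Tape 0 is the input, tape \<open>Suc r\<close> is counter \<open>r\<close>, the last
  tape is the output. A counter is zero when its head is on the marked cell, and a nonblank input
  cell means that the head is inside the word.\<close>

fun sees :: "cond \<Rightarrow> nat list \<Rightarrow> bool" where
  "sees (NonZero r) rs \<longleftrightarrow> rs ! Suc r \<noteq> 1"
| "sees AtInput rs \<longleftrightarrow> rs ! 0 \<noteq> 0"
| "sees AtOne rs \<longleftrightarrow> rs ! 0 = 2"

fun next_state :: "instr \<Rightarrow> nat \<Rightarrow> nat list \<Rightarrow> nat" where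
  "next_state (IBranch b q1 q2) q rs = (if sees b rs then q1 else q2)"
| "next_state _ q rs = Suc q"

fun tape_action :: "nat \<Rightarrow> instr \<Rightarrow> nat \<Rightarrow> nat \<Rightarrow> nat \<times> direction" where
  "tape_action k IInit i r = (if 1 \<le> i \<and> i \<le> k then 1 else r, Stay)"
| "tape_action k (IInc c) i r = (r, if i = Suc c then MoveRight else Stay)"
| "tape_action k (IDec c) i r = (r, if i = Suc c then MoveLeft else Stay)"
| "tape_action k IInR i r = (r, if i = 0 then MoveRight else Stay)"
| "tape_action k IInL i r = (r, if i = 0 then MoveLeft else Stay)"
| "tape_action k (IEmit b) i r = (if i = Suc k then (bit_symbol b, MoveRight) else (r, Stay))"
| "tape_action k (IBranch b q1 q2) i r = (r, Stay)"

text \<open>The \<open>min\<close> makes every instruction list a well-formed machine, even one with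
  jump targets beyond its end. The halting state is the address just after the last
  instruction.\<close>

definition machine :: "nat \<Rightarrow> instr list \<Rightarrow> turing_machine" where
  "machine k code =
     \<lparr>n_tapes = k + 2, n_symbols = 3, n_states = length code,
      transition = (\<lambda>q rs. (min (next_state (code ! q) q rs) (length code),
        map (\<lambda>i. tape_action k (code ! q) i (rs ! i)) [0..<k + 2]))\<rparr>"

lemma tape_action_symbol: "r < 3 \<Longrightarrow> fst (tape_action k ins i r) < 3"
  by (cases ins) (auto simp: bit_symbol_def)

lemma wf_machine: "wf_tm (machine k code)"
proof -
  have "fst (tape_action k (code ! q) i (rs ! i)) < 3"
    if "length rs = k + 2" "\<forall>r\<in>set rs. r < 3" "i < k + 2" for q rs i
    using that by (intro tape_action_symbol) auto
  then show ?thesis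
    unfolding wf_tm_def machine_def by (auto simp: case_prod_beta)
qed

text \<open>A counter is the position of a head on a tape whose only nonblank cell, number 0, is marked.\<close>

fun cell_of :: "nat \<Rightarrow> bool list \<Rightarrow> cstate \<Rightarrow> nat \<Rightarrow> tape" where
  "cell_of k x (h, v, out) i =
     (if i = 0 then (fst (word_tape x), int h)
      else if i \<le> k then (\<lambda>j. if j = 0 then 1 else 0, int (v (i - 1)))
      else (fst (word_tape out), int (length out)))"

definition tapes_of :: "nat \<Rightarrow> bool list \<Rightarrow> cstate \<Rightarrow> tape list" where
  "tapes_of k x s = map (cell_of k x s) [0..<k + 2]"

lemma tm_step_machine:
  assumes "q < length code"
  shows "tm_step (machine k code) (q, map f [0..<k + 2]) =
    (min (next_state (code ! q) q (map (read_tape \<circ> f) [0..<k + 2])) (length code),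
     map (\<lambda>i. update_tape (tape_action k (code ! q) i (read_tape (f i))) (f i)) [0..<k + 2])"
  using assms
  by (auto simp: machine_def comp_def nth_append less_Suc_eq zip_map_map zip_same_conv_map
      simp del: upt_Suc intro!: map_cong)

lemma word_tape_snoc:
  "(fst (word_tape w))(int (length w) := bit_symbol b) = fst (word_tape (w @ [b]))"
  by (rule ext) (auto simp: word_tape_def nth_append)

lemma sees_tapes:
  assumes "case b of NonZero r \<Rightarrow> r < k | _ \<Rightarrow> True"
  shows "sees b (map (read_tape \<circ> cell_of k x s) [0..<k + 2]) \<longleftrightarrow> holds x b s"
proof (cases s)
  case (fields h v out)
  show ?thesis
    using assms unfolding fields
    by (cases b) (auto simp: nth_append word_tape_def bit_symbol_def simp del: upt_Suc)
qed

abbreviation runs :: "turing_machine \<Rightarrow> nat \<Rightarrow> nat \<times> tape list \<Rightarrow> nat \<times> tape list \<Rightarrow> bool" where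
  "runs M t a b \<equiv> (tm_step M ^^ t) a = b"

lemma runs_trans: "runs M t a b \<Longrightarrow> runs M t' b c \<Longrightarrow> runs M (t + t') a c"
  by (subst add.commute) (simp add: funpow_add)

lemma runs_single:
  assumes "q < length code" "code ! q = ins"
    and "case ins of IBranch _ q1 q2 \<Rightarrow> False | _ \<Rightarrow> True"
    and "\<And>i. i < k + 2 \<Longrightarrow>
      update_tape (tape_action k ins i (read_tape (cell_of k x s i))) (cell_of k x s i) = cell_of k x s' i"
  shows "runs (machine k code) 1 (q, tapes_of k x s) (Suc q, tapes_of k x s')"
proof -
  have "next_state ins q rs = Suc q" for rs
    using assms(3) by (cases ins) auto
  then have "tm_step (machine k code) (q, tapes_of k x s) = (Suc q, tapes_of k x s')"
    using assms(1,4) unfolding tapes_of_def tm_step_machine[OF assms(1)] assms(2)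
    by (auto simp del: upt_Suc intro!: map_cong)
  then show ?thesis by simp
qed

lemma runs_branch:
  assumes "q < length code" "code ! q = IBranch b q1 q2" "q1 \<le> length code" "q2 \<le> length code"
    and "case b of NonZero r \<Rightarrow> r < k | _ \<Rightarrow> True"
  shows "runs (machine k code) 1 (q, tapes_of k x s) (if holds x b s then q1 else q2, tapes_of k x s)"
proof -
  have "update_tape (read_tape tp, Stay) tp = tp" for tp
    by (cases tp) simp
  then have "tm_step (machine k code) (q, tapes_of k x s) =
      (if holds x b s then q1 else q2, tapes_of k x s)"
    using assms(3,4) sees_tapes[OF assms(5), of x s]
    unfolding tapes_of_def tm_step_machine[OF assms(1)] assms(2)
    by (auto simp del: upt_Suc cell_of.simps)
  then show ?thesis by simp
qed

text \<open>Allowing arbitrary code before and after the compiled block makes the induction work: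
  for a subprogram, the rest of the enclosing block joins \<open>pre\<close> and
  \<open>post\<close>.\<close>

lemma runs_compile:
  assumes "exec x c s t s'"
    and "code = pre @ compile (length pre) c @ post" "counters_below k c"
  shows "runs (machine k code) t (length pre, tapes_of k x s) (length pre + csize c, tapes_of k x s')"
  using assms
proof (induction arbitrary: pre post rule: exec.induct)
  case (Skip s)
  then show ?case by simp
next
  case (Inc r h v out)
  have "runs (machine k code) 1 (length pre, tapes_of k x (h, v, out))
    (Suc (length pre), tapes_of k x (h, v(r := Suc (v r)), out))"
    by (rule runs_single[where ins = "IInc r"]) (use Inc.prems in auto)
  then show ?case by simp
next
  case (Dec v r n h out)
  have "runs (machine k code) 1 (length pre, tapes_of k x (h, v, out))
    (Suc (length pre), tapes_of k x (h, v(r := n), out))"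
    by (rule runs_single[where ins = "IDec r"]) (use Dec in auto)
  then show ?case by simp
next
  case (InR h v out)
  have "runs (machine k code) 1 (length pre, tapes_of k x (h, v, out))
    (Suc (length pre), tapes_of k x (Suc h, v, out))"
    by (rule runs_single[where ins = IInR]) (use InR.prems in auto)
  then show ?case by simp
next
  case (InL h v out)
  have "runs (machine k code) 1 (length pre, tapes_of k x (Suc h, v, out))
    (Suc (length pre), tapes_of k x (h, v, out))"
    by (rule runs_single[where ins = IInL]) (use InL.prems in auto)
  then show ?case by simp
next
  case (Emit b h v out)
  have "runs (machine k code) 1 (length pre, tapes_of k x (h, v, out))
    (Suc (length pre), tapes_of k x (h, v, out @ [b]))"
    by (rule runs_single[where ins = "IEmit b"]) (use Emit.prems in \<open>auto simp: word_tape_snoc\<close>)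
  then show ?case by simp
next
  case (Seq c s t s' c' t' s'')
  have 1: "runs (machine k code) t (length pre, tapes_of k x s) (length pre + csize c, tapes_of k x s')"
    by (rule Seq.IH(1)) (use Seq.prems in auto)
  have 2: "runs (machine k code) t' (length (pre @ compile (length pre) c), tapes_of k x s')
    (length (pre @ compile (length pre) c) + csize c', tapes_of k x s'')"
    by (rule Seq.IH(2)) (use Seq.prems in auto)
  show ?case using runs_trans[OF 1] 2 by (simp add: add.assoc)
next
  case (CondT b s c t s' c')
  let ?q = "length pre" let ?e = "length pre + 2 + csize c + csize c'"
  have 1: "runs (machine k code) 1 (?q, tapes_of k x s) (?q + 1, tapes_of k x s)"
    using runs_branch[of ?q code b "?q + 1" "?q + 2 + csize c" k x s] CondT.prems CondT.hyps by simp
  have 2: "runs (machine k code) t (?q + 1, tapes_of k x s) (?q + 1 + csize c, tapes_of k x s')"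
    using CondT.IH[of "pre @ [IBranch b (?q + 1) (?q + 2 + csize c)]"] CondT.prems by simp
  have 3: "runs (machine k code) 1 (?q + 1 + csize c, tapes_of k x s') (?e, tapes_of k x s')"
    using runs_branch[of "?q + 1 + csize c" code b ?e ?e k x s'] CondT.prems by (simp add: nth_append)
  show ?case using runs_trans[OF runs_trans[OF 1 2] 3] by (simp add: add_ac)
next
  case (CondF b s c' t s' c)
  let ?q = "length pre" let ?e = "length pre + 2 + csize c + csize c'"
  have 1: "runs (machine k code) 1 (?q, tapes_of k x s) (?q + 2 + csize c, tapes_of k x s)"
    using runs_branch[of ?q code b "?q + 1" "?q + 2 + csize c" k x s] CondF.prems CondF.hyps by simp
  have 2: "runs (machine k code) t (?q + 2 + csize c, tapes_of k x s) (?e, tapes_of k x s')"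
    using CondF.IH[of "pre @ [IBranch b (?q + 1) (?q + 2 + csize c)] @ compile (?q + 1) c @ [IBranch b ?e ?e]"]
      CondF.prems by simp
  show ?case using runs_trans[OF 1 2] by (simp add: add_ac)
next
  case (LoopF b s c)
  let ?q = "length pre"
  have "runs (machine k code) 1 (?q, tapes_of k x s) (?q + 2 + csize c, tapes_of k x s)"
    using runs_branch[of ?q code b "?q + 1" "?q + 2 + csize c" k x s] LoopF.prems LoopF.hyps by simp
  then show ?case by (simp add: add_ac)
next
  case (LoopT b s c t s' t' s'')
  let ?q = "length pre"
  have 1: "runs (machine k code) 1 (?q, tapes_of k x s) (?q + 1, tapes_of k x s)"
    using runs_branch[of ?q code b "?q + 1" "?q + 2 + csize c" k x s] LoopT.prems LoopT.hyps by simp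
  have 2: "runs (machine k code) t (?q + 1, tapes_of k x s) (?q + 1 + csize c, tapes_of k x s')"
    using LoopT.IH(1)[of "pre @ [IBranch b (?q + 1) (?q + 2 + csize c)]"] LoopT.prems by simp
  have 3: "runs (machine k code) 1 (?q + 1 + csize c, tapes_of k x s') (?q, tapes_of k x s')"
    using runs_branch[of "?q + 1 + csize c" code b ?q ?q k x s'] LoopT.prems by (simp add: nth_append)
  \<comment> \<open>The remaining rounds execute the same code again, so this induction hypothesis
    is used with unchanged \<open>pre\<close> and \<open>post\<close>.\<close>
  have 4: "runs (machine k code) t' (?q, tapes_of k x s') (?q + csize (Loop b c), tapes_of k x s'')"
    by (rule LoopT.IH(2)) (use LoopT.prems in auto)
  show ?case using runs_trans[OF runs_trans[OF runs_trans[OF 1 2] 3] 4] by (simp add: add_ac)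
qed

lemma polytime_exec:
  fixes p :: "nat poly"
  assumes "\<And>x. \<exists>t \<le> poly p (length x). \<exists>h v. exec x c (0, \<lambda>_. 0, []) t (h, v, f x)"
  shows "polytime f"
proof -
  obtain k where k: "counters_below k c" using ex_counters_below by blast
  \<comment> \<open>The counter tapes start blank; \<open>IInit\<close> marks their cells 0 and so
    sets all counters to zero. This is the extra step in \<open>p + 1\<close>.\<close>
  define code where "code = [IInit] @ compile 1 c @ []"
  define M where "M = machine k code"
  have init: "runs M 1 (initial_config M x) (1, tapes_of k x (0, \<lambda>_. 0, []))" for x
  proof -
    let ?g = "\<lambda>i. if i = 0 then word_tape x else word_tape []"
    have "word_tape x # replicate (k + 1) (word_tape []) = map ?g [0..<k + 2]"
      by (rule nth_equalityI) (auto simp: nth_Cons' simp del: upt_Suc)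
    then have 1: "initial_config M x = (0, map ?g [0..<k + 2])"
      by (simp add: initial_config_def M_def machine_def del: upt_Suc)
    have 2: "0 < length code" "code ! 0 = IInit" by (simp_all add: code_def)
    have "tm_step M (initial_config M x) = (1, tapes_of k x (0, \<lambda>_. 0, []))"
      unfolding 1 unfolding M_def tapes_of_def tm_step_machine[OF 2(1)] 2(2)
      using 2(1) by (auto simp: word_tape_def fun_eq_iff min_def Suc_le_eq simp del: upt_Suc)
    then show ?thesis by simp
  qed
  have "\<exists>t \<le> poly (p + 1) (length x). \<exists>tps. (tm_step M ^^ t) (initial_config M x) = (n_states M, tps) \<and>
      output_on_tape (last tps) (f x)" for x
  proof -
    obtain t h v where t: "t \<le> poly p (length x)" "exec x c (0, \<lambda>_. 0, []) t (h, v, f x)"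
      using assms by blast
    have "runs M t (1, tapes_of k x (0, \<lambda>_. 0, [])) (1 + csize c, tapes_of k x (h, v, f x))"
      using runs_compile[OF t(2) _ k, of code "[IInit]" "[]"] by (auto simp: code_def M_def)
    from runs_trans[OF init this]
    have "runs M (1 + t) (initial_config M x) (n_states M, tapes_of k x (h, v, f x))"
      by (simp add: M_def machine_def code_def)
    moreover have "output_on_tape (last (tapes_of k x (h, v, f x))) (f x)"
      by (simp add: tapes_of_def output_on_tape_def word_tape_def)
    ultimately show ?thesis using t(1) by (intro exI[of _ "1 + t"]) auto
  qed
  then show ?thesis
    unfolding polytime_def computes_within_def
    by (intro exI[of _ M] exI[of _ "p + 1"]) (auto simp: M_def wf_machine)
qed

section \<open>Functions definable by bounded summation are computable in polynomial time\<close>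

type_synonym env = "nat \<Rightarrow> nat"

text \<open>Domination by a polynomial in the length and finitely many variables. The summand 2
  keeps the base at least 2, so that constants, sums and products are absorbed by a larger
  exponent.\<close>

definition pbound :: "(bool list \<Rightarrow> env \<Rightarrow> nat) \<Rightarrow> bool" where
  "pbound T \<longleftrightarrow> (\<exists>w k. \<forall>x \<sigma>. T x \<sigma> \<le> (length x + (\<Sum>i<w. \<sigma> i) + 2) ^ k)"

lemma pbound_mono: "pbound T \<Longrightarrow> (\<And>x \<sigma>. T' x \<sigma> \<le> T x \<sigma>) \<Longrightarrow> pbound T'"
  unfolding pbound_def by (meson le_trans)

lemma pbound_const: "pbound (\<lambda>x \<sigma>. c)"
proof -
  have "c \<le> (length x + (\<Sum>i<0. \<sigma> i) + 2) ^ c" for x :: "bool list" and \<sigma> :: env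
    using less_exp[of c] power_mono[of 2 "length x + 2" c] by simp
  then show ?thesis unfolding pbound_def by blast
qed

lemma pbound_var: "pbound (\<lambda>x \<sigma>. \<sigma> i)"
  unfolding pbound_def by (intro exI[of _ "Suc i"] exI[of _ 1]) simp

lemma pbound_length: "pbound (\<lambda>x \<sigma>. length x)"
  unfolding pbound_def by (intro exI[of _ 0] exI[of _ 1]) simp

lemma pbound_common:
  assumes "pbound A" "pbound B"
  obtains w k where "\<And>x \<sigma>. A x \<sigma> \<le> (length x + (\<Sum>i<w. \<sigma> i) + 2) ^ k"
    "\<And>x \<sigma>. B x \<sigma> \<le> (length x + (\<Sum>i<w. \<sigma> i) + 2) ^ k"
proof -
  obtain w k w' k' where A: "\<And>x \<sigma>. A x \<sigma> \<le> (length x + (\<Sum>i<w. \<sigma> i) + 2) ^ k"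
    and B: "\<And>x \<sigma>. B x \<sigma> \<le> (length x + (\<Sum>i<w'. \<sigma> i) + 2) ^ k'"
    using assms unfolding pbound_def by blast
  have up: "(length x + (\<Sum>i<w. \<sigma> i) + 2) ^ k \<le> (length x + (\<Sum>i<max w w'. \<sigma> i) + 2) ^ max k k'"
    (is "?a ^ k \<le> ?b ^ _") for w w' k k' and x :: "bool list" and \<sigma> :: env
  proof -
    have "?a ^ k \<le> ?b ^ k" by (intro power_mono add_mono sum_mono2) auto
    also have "\<dots> \<le> ?b ^ max k k'" by (intro power_increasing) auto
    finally show ?thesis .
  qed
  have "A x \<sigma> \<le> (length x + (\<Sum>i<max w w'. \<sigma> i) + 2) ^ max k k'" for x \<sigma>
    using A up by (rule le_trans)
  moreover have "B x \<sigma> \<le> (length x + (\<Sum>i<max w w'. \<sigma> i) + 2) ^ max k k'" for x \<sigma>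
    unfolding max.commute[of w w'] max.commute[of k k'] using B up by (rule le_trans)
  ultimately show ?thesis by (rule that)
qed

lemma pbound_add: assumes "pbound A" "pbound B" shows "pbound (\<lambda>x \<sigma>. A x \<sigma> + B x \<sigma>)"
proof -
  obtain w k where k: "\<And>x \<sigma>. A x \<sigma> \<le> (length x + (\<Sum>i<w. \<sigma> i) + 2) ^ k"
    "\<And>x \<sigma>. B x \<sigma> \<le> (length x + (\<Sum>i<w. \<sigma> i) + 2) ^ k"
    using pbound_common[OF assms] by blast
  have "A x \<sigma> + B x \<sigma> \<le> (length x + (\<Sum>i<w. \<sigma> i) + 2) ^ Suc k" (is "_ \<le> ?S ^ _") for x \<sigma>
  proof -
    have "A x \<sigma> + B x \<sigma> \<le> 2 * ?S ^ k" using k[of x \<sigma>] by simp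
    also have "\<dots> \<le> ?S * ?S ^ k" by (intro mult_right_mono) auto
    finally show ?thesis by simp
  qed
  then show ?thesis unfolding pbound_def by blast
qed

lemma pbound_mult: assumes "pbound A" "pbound B" shows "pbound (\<lambda>x \<sigma>. A x \<sigma> * B x \<sigma>)"
proof -
  obtain w k where k: "\<And>x \<sigma>. A x \<sigma> \<le> (length x + (\<Sum>i<w. \<sigma> i) + 2) ^ k"
    "\<And>x \<sigma>. B x \<sigma> \<le> (length x + (\<Sum>i<w. \<sigma> i) + 2) ^ k"
    using pbound_common[OF assms] by blast
  have "A x \<sigma> * B x \<sigma> \<le> (length x + (\<Sum>i<w. \<sigma> i) + 2) ^ (k + k)" for x \<sigma>
    unfolding power_add by (intro mult_mono k) auto
  then show ?thesis unfolding pbound_def by blast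
qed

text \<open>With \<open>S\<close> the base, the bound variable is below \<open>S ^ k\<close>. The
  base of the inner bound is then at most \<open>S ^ k + S\<close>, which is again below a power of
  \<open>S\<close>.\<close>

lemma pbound_sum:
  assumes "pbound A" "pbound B"
  shows "pbound (\<lambda>x \<sigma>. \<Sum>i<A x \<sigma>. B x (case_nat i \<sigma>))"
proof -
  obtain w k where k: "\<And>x \<sigma>. A x \<sigma> \<le> (length x + (\<Sum>i<w. \<sigma> i) + 2) ^ k"
    "\<And>x \<sigma>. B x \<sigma> \<le> (length x + (\<Sum>i<w. \<sigma> i) + 2) ^ k"
    using pbound_common[OF assms] by blast
  have "(\<Sum>i<A x \<sigma>. B x (case_nat i \<sigma>)) \<le> (length x + (\<Sum>i<w. \<sigma> i) + 2) ^ (k + (k + 2) * k)"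
    (is "_ \<le> ?S ^ _") for x \<sigma>
  proof -
    have "B x (case_nat i \<sigma>) \<le> ?S ^ ((k + 2) * k)" if "i < A x \<sigma>" for i
    proof -
      have "(\<Sum>j<Suc w. case_nat i \<sigma> j) = i + (\<Sum>j<w. \<sigma> j)" for w
        by (simp add: sum.lessThan_Suc_shift del: sum.lessThan_Suc)
      from this[of "w - 1"] have "(\<Sum>j<w. case_nat i \<sigma> j) \<le> i + (\<Sum>j<w. \<sigma> j)"
        by (cases w) auto
      then have "length x + (\<Sum>j<w. case_nat i \<sigma> j) + 2 \<le> i + ?S" by simp
      also have "\<dots> \<le> ?S ^ k + ?S" using that k(1)[of x \<sigma>] by simp
      also have "\<dots> \<le> ?S ^ (k + 1) + ?S ^ (k + 1)"
        using power_increasing[of k "k + 1" ?S] power_increasing[of 1 "k + 1" ?S] by simp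
      also have "\<dots> \<le> ?S * ?S ^ (k + 1)"
        using mult_right_mono[of 2 ?S "?S ^ (k + 1)"] by simp
      also have "\<dots> = ?S ^ (k + 2)" by simp
      finally have "(length x + (\<Sum>j<w. case_nat i \<sigma> j) + 2) ^ k \<le> (?S ^ (k + 2)) ^ k"
        by (intro power_mono) auto
      from le_trans[OF k(2) this] show ?thesis by (simp only: power_mult)
    qed
    then have "(\<Sum>i<A x \<sigma>. B x (case_nat i \<sigma>)) \<le> A x \<sigma> * ?S ^ ((k + 2) * k)"
      using sum_bounded_above[of "{..<A x \<sigma>}" "\<lambda>i. B x (case_nat i \<sigma>)"] by (simp only: lessThan_iff card_lessThan of_nat_id)
    also have "\<dots> \<le> ?S ^ k * ?S ^ ((k + 2) * k)" by (intro mult_right_mono k) auto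
    finally show ?thesis by (simp add: power_add)
  qed
  then show ?thesis unfolding pbound_def by blast
qed

lemmas pbound_intros = pbound_const pbound_var pbound_length pbound_add pbound_mult pbound_sum

section \<open>Counter programs with time bounds\<close>

definition exec_within :: "bool list \<Rightarrow> com \<Rightarrow> cstate \<Rightarrow> nat \<Rightarrow> cstate \<Rightarrow> bool" where
  "exec_within x c s T s' \<longleftrightarrow> (\<exists>t \<le> T. exec x c s t s')"

lemma exec_within_mono: "exec_within x c s T s' \<Longrightarrow> T \<le> T' \<Longrightarrow> exec_within x c s T' s'"
  unfolding exec_within_def using le_trans by blast

lemma exec_within_skip: "exec_within x Skip s 0 s"
  unfolding exec_within_def using exec.Skip by blast

lemma exec_within_eq:
  "exec_within x c s T s' \<Longrightarrow> s' = s'' \<Longrightarrow> T \<le> T' \<Longrightarrow> exec_within x c s T' s''"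
  using exec_within_mono by blast

lemma exec_inc: "exec_within x (Inc r) (h, v, out) 1 (h, v(r := Suc (v r)), out)"
  unfolding exec_within_def using exec.Inc by blast

lemma exec_dec: "0 < v r \<Longrightarrow> exec_within x (Dec r) (h, v, out) 1 (h, v(r := v r - 1), out)"
  unfolding exec_within_def using exec.Dec[of v r "v r - 1"] by (intro exI[of _ 1]) auto

lemma exec_within_inc: "v' = v(r := Suc (v r)) \<Longrightarrow> exec_within x (Inc r) (h, v, out) 1 (h, v', out)"
  using exec_inc by simp

lemma exec_within_dec:
  "0 < v r \<Longrightarrow> v' = v(r := v r - 1) \<Longrightarrow> exec_within x (Dec r) (h, v, out) 1 (h, v', out)"
  using exec_dec by simp

lemma exec_within_inr: "exec_within x InR (h, v, out) 1 (Suc h, v, out)"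
  unfolding exec_within_def using exec.InR by blast

lemma exec_within_inl: "exec_within x InL (Suc h, v, out) 1 (h, v, out)"
  unfolding exec_within_def using exec.InL by blast

lemma exec_within_emit: "exec_within x (Emit b) (h, v, out) 1 (h, v, out @ [b])"
  unfolding exec_within_def using exec.Emit by blast

lemma exec_within_seq:
  "exec_within x c s T s' \<Longrightarrow> exec_within x c' s' T' s'' \<Longrightarrow> exec_within x (Seq c c') s (T + T') s''"
  unfolding exec_within_def using exec.Seq add_mono by metis

lemma exec_within_cond:
  assumes "holds x b s \<Longrightarrow> exec_within x c s T s'" "\<not> holds x b s \<Longrightarrow> exec_within x c' s T s'"
  shows "exec_within x (Cond b c c') s (T + 2) s'"
proof (cases "holds x b s")
  case True
  then obtain t where "t \<le> T" "exec x c s t s'" using assms(1) unfolding exec_within_def by blast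
  then show ?thesis unfolding exec_within_def using exec.CondT[OF True] by (intro exI[of _ "t + 2"]) auto
next
  case False
  then obtain t where "t \<le> T" "exec x c' s t s'" using assms(2) unfolding exec_within_def by blast
  then show ?thesis unfolding exec_within_def using exec.CondF[OF False] by (intro exI[of _ "t + 1"]) auto
qed

text \<open>For loops whose state \<open>s i\<close> after \<open>i\<close> rounds is known in
  closed form: a round costs its body plus the test and the jump back, and the last test costs one
  step.\<close>

lemma exec_within_loop:
  assumes "\<And>i. i < n \<Longrightarrow> holds x b (s i)" "\<not> holds x b (s n)"
    and "\<And>i. i < n \<Longrightarrow> exec_within x c (s i) (T i) (s (Suc i))"
    and "s 0 = s0" "s n = s1"
  shows "exec_within x (Loop b c) s0 ((\<Sum>i<n. T i + 2) + 1) s1"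
  using assms
proof (induction n arbitrary: s T s0)
  case 0
  then have "exec x (Loop b c) s0 1 s1" by (auto intro: exec.LoopF simp del: One_nat_def)
  then show ?case unfolding exec_within_def by (intro exI[of _ 1]) auto
next
  case (Suc n)
  have 1: "exec_within x (Loop b c) (s 1) ((\<Sum>i<n. T (Suc i) + 2) + 1) s1"
    by (rule Suc.IH[of "\<lambda>i. s (Suc i)" "\<lambda>i. T (Suc i)"]) (use Suc.prems in auto)
  have 2: "exec_within x c (s 0) (T 0) (s 1)" using Suc.prems by auto
  obtain t t' where t: "t \<le> T 0" "exec x c (s 0) t (s 1)"
    "t' \<le> (\<Sum>i<n. T (Suc i) + 2) + 1" "exec x (Loop b c) (s 1) t' s1"
    using 1 2 unfolding exec_within_def by blast
  have "exec x (Loop b c) s0 (t + t' + 2) s1"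
    using exec.LoopT[OF _ t(2,4)] Suc.prems(1)[of 0] Suc.prems(4) by auto
  moreover have "(\<Sum>i<Suc n. T i + 2) = T 0 + 2 + (\<Sum>i<n. T (Suc i) + 2)"
    by (rule sum.lessThan_Suc_shift)
  ultimately show ?case
    unfolding exec_within_def using t(1,3) by (intro exI[of _ "t + t' + 2"]) linarith
qed

definition clear :: "nat \<Rightarrow> com" where
  "clear a = Loop (NonZero a) (Dec a)"

definition move :: "nat \<Rightarrow> nat \<Rightarrow> com" where
  "move a b = Loop (NonZero a) (Seq (Dec a) (Inc b))"

definition move2 :: "nat \<Rightarrow> nat \<Rightarrow> nat \<Rightarrow> com" where
  "move2 a b c = Loop (NonZero a) (Seq (Dec a) (Seq (Inc b) (Inc c)))"

lemma exec_clear: "exec_within x (clear a) (h, v, out) (3 * v a + 1) (h, v(a := 0), out)"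
proof -
  have "exec_within x (clear a) (h, v, out) ((\<Sum>i<v a. 1 + 2) + 1) (h, v(a := 0), out)"
    unfolding clear_def
    by (rule exec_within_loop[where s = "\<lambda>i. (h, v(a := v a - i), out)"])
      (auto intro!: exec_within_dec[simplified] simp: fun_eq_iff)
  then show ?thesis by (rule exec_within_mono) simp
qed

lemma exec_move:
  assumes "a \<noteq> b"
  shows "exec_within x (move a b) (h, v, out) (4 * v a + 1) (h, v(a := 0, b := v b + v a), out)"
proof -
  have "exec_within x (move a b) (h, v, out) ((\<Sum>i<v a. (1 + 1) + 2) + 1) (h, v(a := 0, b := v b + v a), out)"
    unfolding move_def
  proof (rule exec_within_loop[where s = "\<lambda>i. (h, v(a := v a - i, b := v b + i), out)"])
    fix i assume "i < v a"
    then show "exec_within x (Seq (Dec a) (Inc b)) (h, v(a := v a - i, b := v b + i), out) (1 + 1)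
        (h, v(a := v a - Suc i, b := v b + Suc i), out)"
      by (intro exec_within_eq[OF exec_within_seq[OF exec_dec exec_inc]]) (use assms in \<open>auto simp: fun_eq_iff\<close>)
  qed (use assms in \<open>auto simp: fun_eq_iff\<close>)
  then show ?thesis by (rule exec_within_mono) simp
qed

lemma exec_move2:
  assumes "a \<noteq> b" "a \<noteq> c" "b \<noteq> c"
  shows "exec_within x (move2 a b c) (h, v, out) (5 * v a + 1)
    (h, v(a := 0, b := v b + v a, c := v c + v a), out)"
proof -
  have "exec_within x (move2 a b c) (h, v, out) ((\<Sum>i<v a. (1 + (1 + 1)) + 2) + 1)
    (h, v(a := 0, b := v b + v a, c := v c + v a), out)"
    unfolding move2_def
  proof (rule exec_within_loop[where s = "\<lambda>i. (h, v(a := v a - i, b := v b + i, c := v c + i), out)"])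
    fix i assume i: "i < v a"
    show "exec_within x (Seq (Dec a) (Seq (Inc b) (Inc c)))
        (h, v(a := v a - i, b := v b + i, c := v c + i), out) (1 + (1 + 1))
        (h, v(a := v a - Suc i, b := v b + Suc i, c := v c + Suc i), out)"
    proof (intro exec_within_seq)
      show "exec_within x (Dec a) (h, v(a := v a - i, b := v b + i, c := v c + i), out) 1
          (h, v(a := v a - Suc i, b := v b + i, c := v c + i), out)"
        by (rule exec_within_dec) (use assms i in \<open>auto simp: fun_eq_iff\<close>)
      show "exec_within x (Inc b) (h, v(a := v a - Suc i, b := v b + i, c := v c + i), out) 1
          (h, v(a := v a - Suc i, b := v b + Suc i, c := v c + i), out)"
        by (rule exec_within_inc) (use assms in \<open>auto simp: fun_eq_iff\<close>)
      show "exec_within x (Inc c) (h, v(a := v a - Suc i, b := v b + Suc i, c := v c + i), out) 1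
          (h, v(a := v a - Suc i, b := v b + Suc i, c := v c + Suc i), out)"
        by (rule exec_within_inc) (use assms in \<open>auto simp: fun_eq_iff\<close>)
    qed
  qed (use assms in \<open>auto simp: fun_eq_iff\<close>)
  then show ?thesis by (rule exec_within_mono) simp
qed

text \<open>
  An environment \<open>\<sigma>\<close> lists the values of the variables, the innermost one first; \<open>case_nat i \<sigma>\<close>
  binds one more variable.
\<close>

inductive DEF :: "(bool list \<Rightarrow> env \<Rightarrow> nat) \<Rightarrow> bool" where
  zero: "DEF (\<lambda>x \<sigma>. 0)"
| one: "DEF (\<lambda>x \<sigma>. 1)"
| var: "DEF (\<lambda>x \<sigma>. \<sigma> i)"
| length: "DEF (\<lambda>x \<sigma>. length x)"
| add: "DEF A \<Longrightarrow> DEF B \<Longrightarrow> DEF (\<lambda>x \<sigma>. A x \<sigma> + B x \<sigma>)"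
| diff: "DEF A \<Longrightarrow> DEF B \<Longrightarrow> DEF (\<lambda>x \<sigma>. A x \<sigma> - B x \<sigma>)"
| bit: "DEF A \<Longrightarrow> DEF (\<lambda>x \<sigma>. of_bool (A x \<sigma> < length x \<and> x ! A x \<sigma>))"
| sum: "DEF A \<Longrightarrow> DEF B \<Longrightarrow> DEF (\<lambda>x \<sigma>. \<Sum>i<A x \<sigma>. B x (case_nat i \<sigma>))"

lemma pbound_DEF: "DEF A \<Longrightarrow> pbound A"
proof (induction rule: DEF.induct)
  case zero show ?case by (rule pbound_const)
next
  case one show ?case by (rule pbound_const)
next
  case (var i) show ?case by (rule pbound_var)
next
  case length show ?case by (rule pbound_length)
next
  case (add A B) show ?case by (rule pbound_add[OF add.IH])
next
  case (diff A B) show ?case by (rule pbound_mono[OF diff.IH(1)]) simp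
next
  case (bit A) show ?case by (rule pbound_mono[OF pbound_const[of 1]]) simp
next
  case (sum A B) show ?case by (rule pbound_sum[OF sum.IH])
qed

text \<open>
  The program keeps its variables in the counters below \<open>d\<close>, variable \<open>i\<close> in counter \<open>\<rho> i\<close>; the
  variables with \<open>\<rho> i \<ge> d\<close> have the value 0.
\<close>

definition implemented :: "(bool list \<Rightarrow> env \<Rightarrow> nat) \<Rightarrow> bool" where
  "implemented F \<longleftrightarrow> (\<forall>d \<rho>. \<exists>c T. pbound T \<and> (\<forall>x v out. (\<forall>l\<ge>d. v l = 0) \<longrightarrow>
     exec_within x c (0, v, out) (T x (v \<circ> \<rho>)) (0, v(d := F x (v \<circ> \<rho>)), out)))"

lemma implementedI:
  assumes "\<And>d \<rho>. \<exists>c T. pbound T \<and> (\<forall>x v out. (\<forall>l\<ge>d. v l = 0) \<longrightarrow>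
     exec_within x c (0, v, out) (T x (v \<circ> \<rho>)) (0, v(d := F x (v \<circ> \<rho>)), out))"
  shows "implemented F"
  using assms unfolding implemented_def by blast

lemma implemented_witness:
  assumes "pbound T" "\<And>x v out. \<forall>l\<ge>d. v l = 0 \<Longrightarrow>
     exec_within x c (0, v, out) (T x (v \<circ> \<rho>)) (0, v(d := F x (v \<circ> \<rho>)), out)"
  shows "\<exists>c T. pbound T \<and> (\<forall>x v out. (\<forall>l\<ge>d. v l = 0) \<longrightarrow>
     exec_within x c (0, v, out) (T x (v \<circ> \<rho>)) (0, v(d := F x (v \<circ> \<rho>)), out))"
  using assms by blast

text \<open>With the environment as a separate variable, the program of a subexpression can be run
  after other counters have changed, as long as the variables have kept their values.\<close>

lemma implementedD:
  assumes "implemented F"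
  shows "\<exists>c T. pbound T \<and> (\<forall>x v out \<sigma>. (\<forall>l\<ge>d. v l = 0) \<longrightarrow> v \<circ> \<rho> = \<sigma> \<longrightarrow>
     exec_within x c (0, v, out) (T x \<sigma>) (0, v(d := F x \<sigma>), out))"
  using assms[unfolded implemented_def, THEN spec, THEN spec, of d \<rho>] by auto

section \<open>Programs for the clauses of definability\<close>

lemma implemented_var: "implemented (\<lambda>x \<sigma>. \<sigma> i)"
proof (rule implementedI)
  fix d and \<rho> :: "nat \<Rightarrow> nat"
  show "\<exists>c T. pbound T \<and> (\<forall>x v out. (\<forall>l\<ge>d. v l = 0) \<longrightarrow>
     exec_within x c (0, v, out) (T x (v \<circ> \<rho>)) (0, v(d := (v \<circ> \<rho>) i), out))"
  proof (cases "\<rho> i < d")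
    case True
    \<comment> \<open>Moving destroys the source. The value is therefore moved to two counters at
      once, and the second copy restores the variable.\<close>
    define c where "c = Seq (move2 (\<rho> i) d (d + 1)) (move (d + 1) (\<rho> i))"
    have E: "exec_within x c (0, v, out) ((5 * (v \<circ> \<rho>) i + 1) + (4 * (v \<circ> \<rho>) i + 1)) (0, v(d := (v \<circ> \<rho>) i), out)"
      if "\<forall>l\<ge>d. v l = 0" for x v out
    proof -
      let ?v1 = "v(\<rho> i := 0, d := v d + v (\<rho> i), d + 1 := v (d + 1) + v (\<rho> i))"
      let ?v2 = "?v1(d + 1 := 0, \<rho> i := ?v1 (\<rho> i) + ?v1 (d + 1))"
      have 1: "exec_within x (move2 (\<rho> i) d (d + 1)) (0, v, out) (5 * v (\<rho> i) + 1) (0, ?v1, out)"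
        by (rule exec_move2) (use True in auto)
      have 2: "exec_within x (move (d + 1) (\<rho> i)) (0, ?v1, out) (4 * ?v1 (d + 1) + 1) (0, ?v2, out)"
        by (rule exec_move) (use True in auto)
      have "v d = 0" "v (d + 1) = 0" using that by simp_all
      then have e2: "?v2 = v(d := v (\<rho> i))" using True by (auto simp: fun_eq_iff)
      have e1: "?v1 (d + 1) = v (\<rho> i)" using \<open>v (d + 1) = 0\<close> by simp
      have "exec_within x c (0, v, out) ((5 * v (\<rho> i) + 1) + (4 * ?v1 (d + 1) + 1)) (0, ?v2, out)"
        unfolding c_def by (rule exec_within_seq[OF 1 2])
      then show ?thesis
        by (rule exec_within_eq) (simp only: e2 comp_apply, simp only: e1 comp_apply order_refl)
    qed
    have P: "pbound (\<lambda>x \<sigma>. (5 * \<sigma> i + 1) + (4 * \<sigma> i + 1))" by (rule pbound_intros)+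
    show ?thesis by (rule implemented_witness[OF P E])
  next
    case False
    \<comment> \<open>Here the variable has no counter below \<open>d\<close>, so its value is 0,
      which counter \<open>d\<close> already holds.\<close>
    have E: "exec_within x Skip (0, v, out) 0 (0, v(d := (v \<circ> \<rho>) i), out)"
      if "\<forall>l\<ge>d. v l = 0" for x v out
    proof -
      have "v(d := (v \<circ> \<rho>) i) = v" using that False by (auto simp: fun_eq_iff)
      then show ?thesis by (simp only: exec_within_skip)
    qed
    show ?thesis by (rule implemented_witness[OF pbound_const E])
  qed
qed

lemma implemented_length: "implemented (\<lambda>x \<sigma>. length x)"
proof (rule implementedI)
  fix d and \<rho> :: "nat \<Rightarrow> nat"
  \<comment> \<open>Counter \<open>d\<close> keeps the length; counter \<open>d + 1\<close> tells
    \<open>c2\<close> how far the head has to go back.\<close>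
  define c1 where "c1 = Loop AtInput (Seq InR (Seq (Inc d) (Inc (d + 1))))"
  define c2 where "c2 = Loop (NonZero (d + 1)) (Seq (Dec (d + 1)) InL)"
  have E: "exec_within x (Seq c1 c2) (0, v, out) ((5 * length x + 1) + (4 * length x + 1))
      (0, v(d := length x), out)"
    if "\<forall>l\<ge>d. v l = 0" for x v out
  proof (rule exec_within_seq)
    have "exec_within x c1 (0, v, out) ((\<Sum>i<length x. (1 + (1 + 1)) + 2) + 1)
        (length x, v(d := length x, d + 1 := length x), out)"
      unfolding c1_def
    proof (rule exec_within_loop[where s = "\<lambda>i. (i, v(d := i, d + 1 := i), out)"])
      fix i
      show "exec_within x (Seq InR (Seq (Inc d) (Inc (d + 1)))) (i, v(d := i, d + 1 := i), out)
          (1 + (1 + 1)) (Suc i, v(d := Suc i, d + 1 := Suc i), out)"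
        by (intro exec_within_eq[OF exec_within_seq[OF exec_within_inr exec_within_seq[OF exec_inc exec_inc]]])
          (auto simp: fun_eq_iff)
    qed (use that in \<open>auto simp: fun_eq_iff\<close>)
    then show "exec_within x c1 (0, v, out) (5 * length x + 1)
        (length x, v(d := length x, d + 1 := length x), out)"
      by (rule exec_within_mono) simp
    have "exec_within x c2 (length x, v(d := length x, d + 1 := length x), out)
        ((\<Sum>i<length x. (1 + 1) + 2) + 1) (0, v(d := length x), out)"
      unfolding c2_def
    proof (rule exec_within_loop[where s = "\<lambda>i. (length x - i, v(d := length x, d + 1 := length x - i), out)"])
      fix i assume "i < length x"
      then have *: "length x - i = Suc (length x - Suc i)" by simp
      show "exec_within x (Seq (Dec (d + 1)) InL) (length x - i, v(d := length x, d + 1 := length x - i), out)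
          (1 + 1) (length x - Suc i, v(d := length x, d + 1 := length x - Suc i), out)"
        unfolding * by (rule exec_within_seq[OF exec_within_dec exec_within_inl]) auto
    qed (use that in \<open>auto simp: fun_eq_iff\<close>)
    then show "exec_within x c2 (length x, v(d := length x, d + 1 := length x), out)
        (4 * length x + 1) (0, v(d := length x), out)"
      by (rule exec_within_mono) simp
  qed
  have P: "pbound (\<lambda>x \<sigma>. (5 * length x + 1) + (4 * length x + 1))" by (rule pbound_intros)+
  show "\<exists>c T. pbound T \<and> (\<forall>x v out. (\<forall>l\<ge>d. v l = 0) \<longrightarrow>
     exec_within x c (0, v, out) (T x (v \<circ> \<rho>)) (0, v(d := length x), out))"
    by (rule implemented_witness[OF P E])
qed

text \<open>Keeps the variables without a counter away from the counters in use.\<close>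

definition shift_map :: "nat \<Rightarrow> nat \<Rightarrow> (nat \<Rightarrow> nat) \<Rightarrow> nat \<Rightarrow> nat" where
  "shift_map d d' \<rho> i = (if \<rho> i < d then \<rho> i else d')"

lemma comp_shift_map:
  assumes "\<And>l. d \<le> l \<Longrightarrow> v l = 0" "\<And>l. l < d \<Longrightarrow> v' l = v l" "v' d' = 0"
  shows "v' \<circ> shift_map d d' \<rho> = v \<circ> \<rho>"
  using assms by (auto simp: shift_map_def fun_eq_iff)

lemma implemented_add:
  assumes "DEF A" "DEF B" "implemented A" "implemented B"
  shows "implemented (\<lambda>x \<sigma>. A x \<sigma> + B x \<sigma>)"
proof (rule implementedI)
  fix d and \<rho> :: "nat \<Rightarrow> nat"
  obtain cA TA where A: "pbound TA" "\<forall>x v out \<sigma>. (\<forall>l\<ge>d. v l = 0) \<longrightarrow> v \<circ> \<rho> = \<sigma> \<longrightarrow>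
     exec_within x cA (0, v, out) (TA x \<sigma>) (0, v(d := A x \<sigma>), out)"
    using implementedD[OF assms(3), where d = "d" and \<rho> = "\<rho>"] by blast
  obtain cB TB where B: "pbound TB" "\<forall>x v out \<sigma>. (\<forall>l\<ge>d + 1. v l = 0) \<longrightarrow> v \<circ> shift_map d (d + 1) \<rho> = \<sigma> \<longrightarrow>
     exec_within x cB (0, v, out) (TB x \<sigma>) (0, v(d + 1 := B x \<sigma>), out)"
    using implementedD[OF assms(4), where d = "d + 1" and \<rho> = "shift_map d (d + 1) \<rho>"] by blast
  have E: "exec_within x (Seq cA (Seq cB (move (d + 1) d))) (0, v, out)
      (TA x (v \<circ> \<rho>) + (TB x (v \<circ> \<rho>) + (4 * B x (v \<circ> \<rho>) + 1)))
      (0, v(d := A x (v \<circ> \<rho>) + B x (v \<circ> \<rho>)), out)"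
    if v: "\<forall>l\<ge>d. v l = 0" for x v out
  proof (intro exec_within_seq)
    let ?\<sigma> = "v \<circ> \<rho>"
    show "exec_within x cA (0, v, out) (TA x ?\<sigma>) (0, v(d := A x ?\<sigma>), out)" using A v by blast
    show "exec_within x cB (0, v(d := A x ?\<sigma>), out) (TB x ?\<sigma>) (0, v(d := A x ?\<sigma>, d + 1 := B x ?\<sigma>), out)"
      by (rule B(2)[rule_format]) (use v in \<open>auto intro!: comp_shift_map\<close>)
    let ?v = "v(d := A x ?\<sigma>, d + 1 := B x ?\<sigma>)"
    have "exec_within x (move (d + 1) d) (0, ?v, out) (4 * ?v (d + 1) + 1)
      (0, ?v(d + 1 := 0, d := ?v d + ?v (d + 1)), out)"
      by (rule exec_move) simp
    moreover have "?v(d + 1 := 0, d := ?v d + ?v (d + 1)) = v(d := A x ?\<sigma> + B x ?\<sigma>)"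
      using v by (auto simp: fun_eq_iff)
    ultimately show "exec_within x (move (d + 1) d) (0, ?v, out) (4 * B x ?\<sigma> + 1)
      (0, v(d := A x ?\<sigma> + B x ?\<sigma>), out)" by simp
  qed
  have P: "pbound (\<lambda>x \<sigma>. TA x \<sigma> + (TB x \<sigma> + (4 * B x \<sigma> + 1)))"
    by (rule A(1) B(1) pbound_DEF[OF assms(2)] pbound_intros)+
  show "\<exists>c T. pbound T \<and> (\<forall>x v out. (\<forall>l\<ge>d. v l = 0) \<longrightarrow>
     exec_within x c (0, v, out) (T x (v \<circ> \<rho>)) (0, v(d := A x (v \<circ> \<rho>) + B x (v \<circ> \<rho>)), out))"
    by (rule implemented_witness[OF P E])
qed

lemma implemented_diff:
  assumes "DEF A" "DEF B" "implemented A" "implemented B"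
  shows "implemented (\<lambda>x \<sigma>. A x \<sigma> - B x \<sigma>)"
proof (rule implementedI)
  fix d and \<rho> :: "nat \<Rightarrow> nat"
  obtain cA TA where A: "pbound TA" "\<forall>x v out \<sigma>. (\<forall>l\<ge>d. v l = 0) \<longrightarrow> v \<circ> \<rho> = \<sigma> \<longrightarrow>
     exec_within x cA (0, v, out) (TA x \<sigma>) (0, v(d := A x \<sigma>), out)"
    using implementedD[OF assms(3), where d = "d" and \<rho> = "\<rho>"] by blast
  obtain cB TB where B: "pbound TB" "\<forall>x v out \<sigma>. (\<forall>l\<ge>d + 1. v l = 0) \<longrightarrow> v \<circ> shift_map d (d + 1) \<rho> = \<sigma> \<longrightarrow>
     exec_within x cB (0, v, out) (TB x \<sigma>) (0, v(d + 1 := B x \<sigma>), out)"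
    using implementedD[OF assms(4), where d = "d + 1" and \<rho> = "shift_map d (d + 1) \<rho>"] by blast
  \<comment> \<open>Testing counter \<open>d\<close> before each decrement yields truncated
    subtraction.\<close>
  define c where "c = Loop (NonZero (d + 1)) (Seq (Dec (d + 1)) (Cond (NonZero d) (Dec d) Skip))"
  have E: "exec_within x (Seq cA (Seq cB c)) (0, v, out)
      (TA x (v \<circ> \<rho>) + (TB x (v \<circ> \<rho>) + (6 * B x (v \<circ> \<rho>) + 1)))
      (0, v(d := A x (v \<circ> \<rho>) - B x (v \<circ> \<rho>)), out)"
    if v: "\<forall>l\<ge>d. v l = 0" for x v out
  proof (intro exec_within_seq)
    let ?\<sigma> = "v \<circ> \<rho>"
    let ?a = "A x ?\<sigma>" let ?b = "B x ?\<sigma>"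
    show "exec_within x cA (0, v, out) (TA x ?\<sigma>) (0, v(d := ?a), out)" using A v by blast
    show "exec_within x cB (0, v(d := ?a), out) (TB x ?\<sigma>) (0, v(d := ?a, d + 1 := ?b), out)"
      by (rule B(2)[rule_format]) (use v in \<open>auto intro!: comp_shift_map\<close>)
    have "exec_within x c (0, v(d := ?a, d + 1 := ?b), out) ((\<Sum>i<?b. (1 + (1 + 2)) + 2) + 1)
      (0, v(d := ?a - ?b), out)"
      unfolding c_def
    proof (rule exec_within_loop[where s = "\<lambda>i. (0, v(d := ?a - i, d + 1 := ?b - i), out)"])
      fix i assume i: "i < ?b"
      show "exec_within x (Seq (Dec (d + 1)) (Cond (NonZero d) (Dec d) Skip))
          (0, v(d := ?a - i, d + 1 := ?b - i), out) (1 + (1 + 2))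
          (0, v(d := ?a - Suc i, d + 1 := ?b - Suc i), out)"
      proof (rule exec_within_seq)
        show "exec_within x (Dec (d + 1)) (0, v(d := ?a - i, d + 1 := ?b - i), out) 1
          (0, v(d := ?a - i, d + 1 := ?b - Suc i), out)"
          by (rule exec_within_dec) (use i in auto)
        have "v(d := ?a - Suc i, d + 1 := ?b - Suc i) = v(d := ?a - i, d + 1 := ?b - Suc i)"
          if "?a - i = 0" using that by (auto simp: fun_eq_iff)
        then show "exec_within x (Cond (NonZero d) (Dec d) Skip) (0, v(d := ?a - i, d + 1 := ?b - Suc i), out)
          (1 + 2) (0, v(d := ?a - Suc i, d + 1 := ?b - Suc i), out)"
          by (intro exec_within_cond)
            (auto intro!: exec_within_dec exec_within_mono[OF exec_within_skip] simp: fun_eq_iff simp del: One_nat_def)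
      qed
    qed (use v in \<open>auto simp: fun_eq_iff\<close>)
    then show "exec_within x c (0, v(d := ?a, d + 1 := ?b), out) (6 * ?b + 1) (0, v(d := ?a - ?b), out)"
      by (rule exec_within_mono) simp
  qed
  have P: "pbound (\<lambda>x \<sigma>. TA x \<sigma> + (TB x \<sigma> + (6 * B x \<sigma> + 1)))"
    by (rule A(1) B(1) pbound_DEF[OF assms(2)] pbound_intros)+
  show "\<exists>c T. pbound T \<and> (\<forall>x v out. (\<forall>l\<ge>d. v l = 0) \<longrightarrow>
     exec_within x c (0, v, out) (T x (v \<circ> \<rho>)) (0, v(d := A x (v \<circ> \<rho>) - B x (v \<circ> \<rho>)), out))"
    by (rule implemented_witness[OF P E])
qed

lemma implemented_bit:
  assumes "DEF A" "implemented A"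
  shows "implemented (\<lambda>x \<sigma>. of_bool (A x \<sigma> < length x \<and> x ! A x \<sigma>))"
proof (rule implementedI)
  fix d and \<rho> :: "nat \<Rightarrow> nat"
  obtain cA TA where A: "pbound TA" "\<forall>x v out \<sigma>. (\<forall>l\<ge>d. v l = 0) \<longrightarrow> v \<circ> \<rho> = \<sigma> \<longrightarrow>
     exec_within x cA (0, v, out) (TA x \<sigma>) (0, v(d := A x \<sigma>), out)"
    using implementedD[OF assms(2), where d = "d" and \<rho> = "\<rho>"] by blast
  \<comment> \<open>The head walks to the queried position, possibly beyond the word, where
    \<open>AtOne\<close> is false; \<open>c2\<close> walks back the distance recorded in counter
    \<open>d + 1\<close>.\<close>
  define c1 where "c1 = Loop (NonZero d) (Seq (Dec d) (Seq InR (Inc (d + 1))))"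
  define c2 where "c2 = Loop (NonZero (d + 1)) (Seq (Dec (d + 1)) InL)"
  define c where "c = Seq cA (Seq c1 (Seq (Cond AtOne (Inc d) Skip) c2))"
  have E: "exec_within x c (0, v, out)
      (TA x (v \<circ> \<rho>) + ((5 * A x (v \<circ> \<rho>) + 1) + ((1 + 2) + (4 * A x (v \<circ> \<rho>) + 1))))
      (0, v(d := of_bool (A x (v \<circ> \<rho>) < length x \<and> x ! A x (v \<circ> \<rho>))), out)"
    if v: "\<forall>l\<ge>d. v l = 0" for x v out
    unfolding c_def
  proof (intro exec_within_seq)
    let ?\<sigma> = "v \<circ> \<rho>"
    let ?a = "A x ?\<sigma>" let ?r = "of_bool (?a < length x \<and> x ! ?a) :: nat"
    show "exec_within x cA (0, v, out) (TA x ?\<sigma>) (0, v(d := ?a), out)" using A v by blast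
    have "exec_within x c1 (0, v(d := ?a), out) ((\<Sum>i<?a. (1 + (1 + 1)) + 2) + 1)
        (?a, v(d := 0, d + 1 := ?a), out)"
      unfolding c1_def
    proof (rule exec_within_loop[where s = "\<lambda>i. (i, v(d := ?a - i, d + 1 := i), out)"])
      fix i assume "i < ?a"
      then show "exec_within x (Seq (Dec d) (Seq InR (Inc (d + 1)))) (i, v(d := ?a - i, d + 1 := i), out)
          (1 + (1 + 1)) (Suc i, v(d := ?a - Suc i, d + 1 := Suc i), out)"
        by (intro exec_within_eq[OF exec_within_seq[OF exec_dec exec_within_seq[OF exec_within_inr exec_inc]]])
          (auto simp: fun_eq_iff)
    qed (use v in \<open>auto simp: fun_eq_iff\<close>)
    then show "exec_within x c1 (0, v(d := ?a), out) (5 * ?a + 1) (?a, v(d := 0, d + 1 := ?a), out)"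
      by (rule exec_within_mono) simp
    have "v(d := 0, d + 1 := ?a) = v(d := ?r, d + 1 := ?a)" if "?r = 0" using that by (simp add: fun_eq_iff)
    then show "exec_within x (Cond AtOne (Inc d) Skip) (?a, v(d := 0, d + 1 := ?a), out) (1 + 2)
        (?a, v(d := ?r, d + 1 := ?a), out)"
      by (intro exec_within_cond)
        (auto intro!: exec_within_inc exec_within_mono[OF exec_within_skip] simp: fun_eq_iff simp del: One_nat_def)
    have "exec_within x c2 (?a, v(d := ?r, d + 1 := ?a), out)
        ((\<Sum>i<?a. (1 + 1) + 2) + 1) (0, v(d := ?r), out)"
      unfolding c2_def
    proof (rule exec_within_loop[where s = "\<lambda>i. (?a - i, v(d := ?r, d + 1 := ?a - i), out)"])
      fix i assume "i < ?a"
      then have *: "?a - i = Suc (?a - Suc i)" by simp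
      show "exec_within x (Seq (Dec (d + 1)) InL) (?a - i, v(d := ?r, d + 1 := ?a - i), out)
          (1 + 1) (?a - Suc i, v(d := ?r, d + 1 := ?a - Suc i), out)"
        unfolding * by (rule exec_within_seq[OF exec_within_dec exec_within_inl]) auto
    qed (use v in \<open>auto simp: fun_eq_iff\<close>)
    then show "exec_within x c2 (?a, v(d := ?r, d + 1 := ?a), out) (4 * ?a + 1) (0, v(d := ?r), out)"
      by (rule exec_within_mono) simp
  qed
  have P: "pbound (\<lambda>x \<sigma>. TA x \<sigma> + ((5 * A x \<sigma> + 1) + ((1 + 2) + (4 * A x \<sigma> + 1))))"
    by (rule A(1) pbound_DEF[OF assms(1)] pbound_intros)+
  show "\<exists>c T. pbound T \<and> (\<forall>x v out. (\<forall>l\<ge>d. v l = 0) \<longrightarrow>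
     exec_within x c (0, v, out) (T x (v \<circ> \<rho>))
       (0, v(d := of_bool (A x (v \<circ> \<rho>) < length x \<and> x ! A x (v \<circ> \<rho>))), out))"
    by (rule implemented_witness[OF P E])
qed

lemma implemented_sum:
  assumes "DEF A" "DEF B" "implemented A" "implemented B"
  shows "implemented (\<lambda>x \<sigma>. \<Sum>i<A x \<sigma>. B x (case_nat i \<sigma>))"
proof (rule implementedI)
  fix d and \<rho> :: "nat \<Rightarrow> nat"
  obtain cA TA where A: "pbound TA" "\<forall>x v out \<sigma>. (\<forall>l\<ge>d. v l = 0) \<longrightarrow> v \<circ> \<rho> = \<sigma> \<longrightarrow>
     exec_within x cA (0, v, out) (TA x \<sigma>) (0, v(d := A x \<sigma>), out)"
    using implementedD[OF assms(3), where d = "d" and \<rho> = "\<rho>"] by blast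
  obtain cB TB where B: "pbound TB" "\<forall>x v out \<sigma>. (\<forall>l\<ge>d + 3. v l = 0) \<longrightarrow>
      v \<circ> case_nat (d + 1) (shift_map d (d + 3) \<rho>) = \<sigma> \<longrightarrow>
     exec_within x cB (0, v, out) (TB x \<sigma>) (0, v(d + 3 := B x \<sigma>), out)"
    using implementedD[OF assms(4), where d = "d + 3" and \<rho> = "case_nat (d + 1) (shift_map d (d + 3) \<rho>)"] by blast
  \<comment> \<open>Counter \<open>d\<close> holds the number of rounds left, \<open>d + 1\<close>
    the bound variable, \<open>d + 2\<close> the partial sum and \<open>d + 3\<close> the current
    summand.\<close>
  define body where "body = Seq (Dec d) (Seq cB (Seq (move (d + 3) (d + 2)) (Inc (d + 1))))"
  define c where "c = Seq cA (Seq (Loop (NonZero d) body) (Seq (clear (d + 1)) (move (d + 2) d)))"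
  define T where "T x \<sigma> = 1 + (TB x \<sigma> + ((4 * B x \<sigma> + 1) + 1))" for x \<sigma>
  have E: "exec_within x c (0, v, out)
      (TA x (v \<circ> \<rho>) + (((\<Sum>i<A x (v \<circ> \<rho>). T x (case_nat i (v \<circ> \<rho>)) + 2) + 1) +
        ((3 * A x (v \<circ> \<rho>) + 1) + (4 * (\<Sum>i<A x (v \<circ> \<rho>). B x (case_nat i (v \<circ> \<rho>))) + 1))))
      (0, v(d := \<Sum>i<A x (v \<circ> \<rho>). B x (case_nat i (v \<circ> \<rho>))), out)"
    if v: "\<forall>l\<ge>d. v l = 0" for x v out
    unfolding c_def
  proof (intro exec_within_seq)
    let ?\<sigma> = "v \<circ> \<rho>"
    let ?a = "A x ?\<sigma>"
    let ?b = "\<lambda>i. B x (case_nat i ?\<sigma>)"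
    let ?s = "\<lambda>i. sum ?b {..<i}"
    show "exec_within x cA (0, v, out) (TA x ?\<sigma>) (0, v(d := ?a), out)" using A v by blast
    show "exec_within x (Loop (NonZero d) body) (0, v(d := ?a), out)
      ((\<Sum>i<?a. T x (case_nat i ?\<sigma>) + 2) + 1) (0, v(d := 0, d + 1 := ?a, d + 2 := ?s ?a), out)"
    proof (rule exec_within_loop[where s = "\<lambda>i. (0, v(d := ?a - i, d + 1 := i, d + 2 := ?s i), out)"])
      fix i assume i: "i < ?a"
      show "exec_within x body (0, v(d := ?a - i, d + 1 := i, d + 2 := ?s i), out) (T x (case_nat i ?\<sigma>))
        (0, v(d := ?a - Suc i, d + 1 := Suc i, d + 2 := ?s (Suc i)), out)"
        unfolding body_def T_def
      proof (intro exec_within_seq)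
        let ?v = "v(d := ?a - Suc i, d + 1 := i, d + 2 := ?s i)"
        show "exec_within x (Dec d) (0, v(d := ?a - i, d + 1 := i, d + 2 := ?s i), out) 1 (0, ?v, out)"
          by (rule exec_within_dec) (use i in \<open>auto simp: fun_eq_iff\<close>)
        have "?v \<circ> case_nat (d + 1) (shift_map d (d + 3) \<rho>) = case_nat i ?\<sigma>"
          using v by (auto simp: fun_eq_iff shift_map_def split: nat.split)
        then show "exec_within x cB (0, ?v, out) (TB x (case_nat i ?\<sigma>)) (0, ?v(d + 3 := ?b i), out)"
          by (intro B(2)[rule_format]) (use v in auto)
        let ?w = "?v(d + 3 := ?b i)"
        have "exec_within x (move (d + 3) (d + 2)) (0, ?w, out) (4 * ?w (d + 3) + 1)
          (0, ?w(d + 3 := 0, d + 2 := ?w (d + 2) + ?w (d + 3)), out)"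
          by (rule exec_move) simp
        moreover have "?w(d + 3 := 0, d + 2 := ?w (d + 2) + ?w (d + 3)) =
            v(d := ?a - Suc i, d + 1 := i, d + 2 := ?s (Suc i))"
          using v by (auto simp: fun_eq_iff)
        ultimately show "exec_within x (move (d + 3) (d + 2)) (0, ?w, out) (4 * ?b i + 1)
          (0, v(d := ?a - Suc i, d + 1 := i, d + 2 := ?s (Suc i)), out)" by simp
        show "exec_within x (Inc (d + 1)) (0, v(d := ?a - Suc i, d + 1 := i, d + 2 := ?s (Suc i)), out) 1
          (0, v(d := ?a - Suc i, d + 1 := Suc i, d + 2 := ?s (Suc i)), out)"
          by (rule exec_within_inc) (auto simp: fun_eq_iff)
      qed
    qed (use v in \<open>auto simp: fun_eq_iff\<close>)
    let ?v = "v(d := 0, d + 1 := ?a, d + 2 := ?s ?a)"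
    have "exec_within x (clear (d + 1)) (0, ?v, out) (3 * ?v (d + 1) + 1) (0, ?v(d + 1 := 0), out)"
      by (rule exec_clear)
    then show "exec_within x (clear (d + 1)) (0, ?v, out) (3 * ?a + 1) (0, ?v(d + 1 := 0), out)" by simp
    let ?w = "?v(d + 1 := 0)"
    have "exec_within x (move (d + 2) d) (0, ?w, out) (4 * ?w (d + 2) + 1)
      (0, ?w(d + 2 := 0, d := ?w d + ?w (d + 2)), out)"
      by (rule exec_move) simp
    moreover have "?w(d + 2 := 0, d := ?w d + ?w (d + 2)) = v(d := ?s ?a)"
      using v by (auto simp: fun_eq_iff)
    ultimately show "exec_within x (move (d + 2) d) (0, ?w, out) (4 * ?s ?a + 1) (0, v(d := ?s ?a), out)"
      by simp
  qed
  have P: "pbound (\<lambda>x \<sigma>. TA x \<sigma> + (((\<Sum>i<A x \<sigma>. T x (case_nat i \<sigma>) + 2) + 1) +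
        ((3 * A x \<sigma> + 1) + (4 * (\<Sum>i<A x \<sigma>. B x (case_nat i \<sigma>)) + 1))))"
  proof -
    have "pbound (\<lambda>x \<sigma>. T x \<sigma> + 2)"
      unfolding T_def by (rule B(1) pbound_DEF[OF assms(2)] pbound_intros)+
    note * = pbound_sum[OF pbound_DEF[OF assms(1)] this]
    show ?thesis
      by (rule * A(1) pbound_DEF[OF assms(2)] pbound_DEF[OF assms(1)] pbound_intros)+
  qed
  show "\<exists>c T. pbound T \<and> (\<forall>x v out. (\<forall>l\<ge>d. v l = 0) \<longrightarrow>
     exec_within x c (0, v, out) (T x (v \<circ> \<rho>))
       (0, v(d := \<Sum>i<A x (v \<circ> \<rho>). B x (case_nat i (v \<circ> \<rho>))), out))"
    by (rule implemented_witness[OF P E])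
qed

lemma implemented_DEF: "DEF A \<Longrightarrow> implemented A"
proof (induction rule: DEF.induct)
  case zero
  have E: "exec_within x Skip (0, v, out) 0 (0, v(d := 0), out)"
    if "\<forall>l\<ge>d. v l = 0" for x v out and d :: nat
  proof -
    have "v(d := 0) = v" using that by (auto simp: fun_eq_iff)
    then show ?thesis by (simp only: exec_within_skip)
  qed
  show ?case by (rule implementedI, rule implemented_witness[OF pbound_const E])
next
  case one
  have E: "exec_within x (Inc d) (0, v, out) 1 (0, v(d := 1), out)"
    if "\<forall>l\<ge>d. v l = 0" for x v out and d :: nat
    by (rule exec_within_inc) (use that in auto)
  show ?case by (rule implementedI, rule implemented_witness[OF pbound_const E])
next
  case (var i)
  show ?case by (rule implemented_var)
next
  case length
  show ?case by (rule implemented_length)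
next
  case (add A B)
  then show ?case by (rule implemented_add)
next
  case (diff A B)
  then show ?case by (rule implemented_diff)
next
  case (bit A)
  then show ?case by (rule implemented_bit)
next
  case (sum A B)
  then show ?case by (rule implemented_sum)
qed

section \<open>Words generated by nested loops\<close>

inductive GEN :: "(bool list \<Rightarrow> env \<Rightarrow> bool list) \<Rightarrow> bool" where
  emit: "DEF A \<Longrightarrow> GEN (\<lambda>x \<sigma>. [A x \<sigma> \<noteq> 0])"
| app: "GEN F \<Longrightarrow> GEN G \<Longrightarrow> GEN (\<lambda>x \<sigma>. F x \<sigma> @ G x \<sigma>)"
| "for": "DEF A \<Longrightarrow> GEN G \<Longrightarrow> GEN (\<lambda>x \<sigma>. concat (map (\<lambda>i. G x (case_nat i \<sigma>)) [0..<A x \<sigma>]))"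

definition emits :: "(bool list \<Rightarrow> env \<Rightarrow> bool list) \<Rightarrow> bool" where
  "emits G \<longleftrightarrow> (\<forall>d \<rho>. \<exists>c T. pbound T \<and> (\<forall>x v out. (\<forall>l\<ge>d. v l = 0) \<longrightarrow>
     exec_within x c (0, v, out) (T x (v \<circ> \<rho>)) (0, v, out @ G x (v \<circ> \<rho>))))"

lemma emits_witness:
  assumes "pbound T" "\<And>x v out. \<forall>l\<ge>d. v l = 0 \<Longrightarrow>
     exec_within x c (0, v, out) (T x (v \<circ> \<rho>)) (0, v, out @ G x (v \<circ> \<rho>))"
  shows "\<exists>c T. pbound T \<and> (\<forall>x v out. (\<forall>l\<ge>d. v l = 0) \<longrightarrow>
     exec_within x c (0, v, out) (T x (v \<circ> \<rho>)) (0, v, out @ G x (v \<circ> \<rho>)))"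
  using assms by blast

lemma emitsD:
  assumes "emits G"
  shows "\<exists>c T. pbound T \<and> (\<forall>x v out \<sigma>. (\<forall>l\<ge>d. v l = 0) \<longrightarrow> v \<circ> \<rho> = \<sigma> \<longrightarrow>
     exec_within x c (0, v, out) (T x \<sigma>) (0, v, out @ G x \<sigma>))"
  using assms[unfolded emits_def, THEN spec, THEN spec, of d \<rho>] by auto

lemma emits_GEN: "GEN G \<Longrightarrow> emits G"
proof (induction rule: GEN.induct)
  case (emit A)
  show ?case unfolding emits_def
  proof (intro allI)
    fix d and \<rho> :: "nat \<Rightarrow> nat"
    obtain cA TA where A: "pbound TA" "\<forall>x v out \<sigma>. (\<forall>l\<ge>d. v l = 0) \<longrightarrow> v \<circ> \<rho> = \<sigma> \<longrightarrow>
       exec_within x cA (0, v, out) (TA x \<sigma>) (0, v(d := A x \<sigma>), out)"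
      using implementedD[OF implemented_DEF[OF emit], where d = "d" and \<rho> = "\<rho>"] by blast
    define c where "c = Seq cA (Seq (Cond (NonZero d) (Emit True) (Emit False)) (clear d))"
    have E: "exec_within x c (0, v, out) (TA x (v \<circ> \<rho>) + ((1 + 2) + (3 * A x (v \<circ> \<rho>) + 1)))
        (0, v, out @ [A x (v \<circ> \<rho>) \<noteq> 0])"
      if v: "\<forall>l\<ge>d. v l = 0" for x v out
      unfolding c_def
    proof (intro exec_within_seq)
      let ?a = "A x (v \<circ> \<rho>)"
      show "exec_within x cA (0, v, out) (TA x (v \<circ> \<rho>)) (0, v(d := ?a), out)" using A v by blast
      show "exec_within x (Cond (NonZero d) (Emit True) (Emit False)) (0, v(d := ?a), out) (1 + 2)
        (0, v(d := ?a), out @ [?a \<noteq> 0])"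
        using exec_within_emit[of x True] exec_within_emit[of x False]
        by (intro exec_within_cond) (auto simp del: One_nat_def)
      have "v(d := ?a, d := 0) = v" using v by (auto simp: fun_eq_iff)
      then show "exec_within x (clear d) (0, v(d := ?a), out @ [?a \<noteq> 0]) (3 * ?a + 1) (0, v, out @ [?a \<noteq> 0])"
        using exec_clear[of x d 0 "v(d := ?a)"] by (simp del: fun_upd_upd)
    qed
    have P: "pbound (\<lambda>x \<sigma>. TA x \<sigma> + ((1 + 2) + (3 * A x \<sigma> + 1)))"
      by (rule A(1) pbound_DEF[OF emit] pbound_intros)+
    show "\<exists>c T. pbound T \<and> (\<forall>x v out. (\<forall>l\<ge>d. v l = 0) \<longrightarrow>
       exec_within x c (0, v, out) (T x (v \<circ> \<rho>)) (0, v, out @ [A x (v \<circ> \<rho>) \<noteq> 0]))"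
      by (rule emits_witness[OF P E])
  qed
next
  case (app F G)
  show ?case unfolding emits_def
  proof (intro allI)
    fix d and \<rho> :: "nat \<Rightarrow> nat"
    obtain cF TF where F: "pbound TF" "\<forall>x v out \<sigma>. (\<forall>l\<ge>d. v l = 0) \<longrightarrow> v \<circ> \<rho> = \<sigma> \<longrightarrow>
       exec_within x cF (0, v, out) (TF x \<sigma>) (0, v, out @ F x \<sigma>)"
      using emitsD[OF app.IH(1), where d = "d" and \<rho> = "\<rho>"] by blast
    obtain cG TG where G: "pbound TG" "\<forall>x v out \<sigma>. (\<forall>l\<ge>d. v l = 0) \<longrightarrow> v \<circ> \<rho> = \<sigma> \<longrightarrow>
       exec_within x cG (0, v, out) (TG x \<sigma>) (0, v, out @ G x \<sigma>)"
      using emitsD[OF app.IH(2), where d = "d" and \<rho> = "\<rho>"] by blast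
    have E: "exec_within x (Seq cF cG) (0, v, out) (TF x (v \<circ> \<rho>) + TG x (v \<circ> \<rho>))
        (0, v, (out @ F x (v \<circ> \<rho>)) @ G x (v \<circ> \<rho>))"
      if v: "\<forall>l\<ge>d. v l = 0" for x v out
    proof (rule exec_within_seq)
      show "exec_within x cF (0, v, out) (TF x (v \<circ> \<rho>)) (0, v, out @ F x (v \<circ> \<rho>))"
        using F(2) v by blast
      show "exec_within x cG (0, v, out @ F x (v \<circ> \<rho>)) (TG x (v \<circ> \<rho>))
          (0, v, (out @ F x (v \<circ> \<rho>)) @ G x (v \<circ> \<rho>))"
        using G(2) v by blast
    qed
    have P: "pbound (\<lambda>x \<sigma>. TF x \<sigma> + TG x \<sigma>)" using F(1) G(1) by (rule pbound_add)
    show "\<exists>c T. pbound T \<and> (\<forall>x v out. (\<forall>l\<ge>d. v l = 0) \<longrightarrow>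
       exec_within x c (0, v, out) (T x (v \<circ> \<rho>)) (0, v, out @ F x (v \<circ> \<rho>) @ G x (v \<circ> \<rho>)))"
      by (rule emits_witness[OF P E[unfolded append_assoc]])
  qed
next
  case ("for" A G)
  show ?case unfolding emits_def
  proof (intro allI)
    fix d and \<rho> :: "nat \<Rightarrow> nat"
    obtain cA TA where A: "pbound TA" "\<forall>x v out \<sigma>. (\<forall>l\<ge>d. v l = 0) \<longrightarrow> v \<circ> \<rho> = \<sigma> \<longrightarrow>
       exec_within x cA (0, v, out) (TA x \<sigma>) (0, v(d := A x \<sigma>), out)"
      using implementedD[OF implemented_DEF[OF "for.hyps"(1)], where d = "d" and \<rho> = "\<rho>"] by blast
    obtain cG TG where G: "pbound TG" "\<forall>x v out \<sigma>. (\<forall>l\<ge>d + 2. v l = 0) \<longrightarrow>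
        v \<circ> case_nat (d + 1) (shift_map d (d + 2) \<rho>) = \<sigma> \<longrightarrow>
       exec_within x cG (0, v, out) (TG x \<sigma>) (0, v, out @ G x \<sigma>)"
      using emitsD[OF "for.IH", where d = "d + 2" and \<rho> = "case_nat (d + 1) (shift_map d (d + 2) \<rho>)"] by blast
    define body where "body = Seq (Dec d) (Seq cG (Inc (d + 1)))"
    define c where "c = Seq cA (Seq (Loop (NonZero d) body) (clear (d + 1)))"
    define T where "T x \<sigma> = 1 + (TG x \<sigma> + 1)" for x \<sigma>
    have E: "exec_within x c (0, v, out)
        (TA x (v \<circ> \<rho>) + (((\<Sum>i<A x (v \<circ> \<rho>). T x (case_nat i (v \<circ> \<rho>)) + 2) + 1) + (3 * A x (v \<circ> \<rho>) + 1)))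
        (0, v, out @ concat (map (\<lambda>i. G x (case_nat i (v \<circ> \<rho>))) [0..<A x (v \<circ> \<rho>)]))"
      if v: "\<forall>l\<ge>d. v l = 0" for x v out
      unfolding c_def
    proof (intro exec_within_seq)
      let ?\<sigma> = "v \<circ> \<rho>"
      let ?a = "A x ?\<sigma>"
      let ?o = "\<lambda>i. out @ concat (map (\<lambda>i. G x (case_nat i ?\<sigma>)) [0..<i])"
      show "exec_within x cA (0, v, out) (TA x ?\<sigma>) (0, v(d := ?a), out)" using A v by blast
      show "exec_within x (Loop (NonZero d) body) (0, v(d := ?a), out)
        ((\<Sum>i<?a. T x (case_nat i ?\<sigma>) + 2) + 1) (0, v(d := 0, d + 1 := ?a), ?o ?a)"
      proof (rule exec_within_loop[where s = "\<lambda>i. (0, v(d := ?a - i, d + 1 := i), ?o i)"])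
        fix i assume i: "i < ?a"
        show "exec_within x body (0, v(d := ?a - i, d + 1 := i), ?o i) (T x (case_nat i ?\<sigma>))
          (0, v(d := ?a - Suc i, d + 1 := Suc i), ?o (Suc i))"
          unfolding body_def T_def
        proof (intro exec_within_seq)
          let ?v = "v(d := ?a - Suc i, d + 1 := i)"
          show "exec_within x (Dec d) (0, v(d := ?a - i, d + 1 := i), ?o i) 1 (0, ?v, ?o i)"
            by (rule exec_within_dec) (use i in \<open>auto simp: fun_eq_iff\<close>)
          have "?v \<circ> case_nat (d + 1) (shift_map d (d + 2) \<rho>) = case_nat i ?\<sigma>"
            using v by (auto simp: fun_eq_iff shift_map_def split: nat.split)
          then have "exec_within x cG (0, ?v, ?o i) (TG x (case_nat i ?\<sigma>)) (0, ?v, ?o i @ G x (case_nat i ?\<sigma>))"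
            by (intro G(2)[rule_format]) (use v in auto)
          then show "exec_within x cG (0, ?v, ?o i) (TG x (case_nat i ?\<sigma>)) (0, ?v, ?o (Suc i))"
            by simp
          show "exec_within x (Inc (d + 1)) (0, ?v, ?o (Suc i)) 1
            (0, v(d := ?a - Suc i, d + 1 := Suc i), ?o (Suc i))"
            by (rule exec_within_inc) (auto simp: fun_eq_iff)
        qed
      qed (use v in \<open>auto simp: fun_eq_iff\<close>)
      let ?v = "v(d := 0, d + 1 := ?a)"
      have "exec_within x (clear (d + 1)) (0, ?v, ?o ?a) (3 * ?v (d + 1) + 1) (0, ?v(d + 1 := 0), ?o ?a)"
        by (rule exec_clear)
      moreover have "?v(d + 1 := 0) = v" using v by (auto simp: fun_eq_iff)
      ultimately show "exec_within x (clear (d + 1)) (0, ?v, ?o ?a) (3 * ?a + 1) (0, v, ?o ?a)" by simp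
    qed
    have P: "pbound (\<lambda>x \<sigma>. TA x \<sigma> + (((\<Sum>i<A x \<sigma>. T x (case_nat i \<sigma>) + 2) + 1) + (3 * A x \<sigma> + 1)))"
    proof -
      have "pbound (\<lambda>x \<sigma>. T x \<sigma> + 2)"
        unfolding T_def by (rule G(1) pbound_intros)+
      note * = pbound_sum[OF pbound_DEF[OF "for.hyps"(1)] this]
      show ?thesis
        by (rule * A(1) pbound_DEF[OF "for.hyps"(1)] pbound_intros)+
    qed
    show "\<exists>c T. pbound T \<and> (\<forall>x v out. (\<forall>l\<ge>d. v l = 0) \<longrightarrow>
       exec_within x c (0, v, out) (T x (v \<circ> \<rho>))
        (0, v, out @ concat (map (\<lambda>i. G x (case_nat i (v \<circ> \<rho>))) [0..<A x (v \<circ> \<rho>)])))"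
      by (rule emits_witness[OF P E])
  qed
qed

lemma polytime_GEN:
  assumes "GEN G"
  shows "polytime (\<lambda>x. G x (\<lambda>_. 0))"
proof -
  obtain c T where T: "pbound T" "\<forall>x v out \<sigma>. (\<forall>l\<ge>0. v l = 0) \<longrightarrow> v \<circ> (\<lambda>_. 0) = \<sigma> \<longrightarrow>
     exec_within x c (0, v, out) (T x \<sigma>) (0, v, out @ G x \<sigma>)"
    using emitsD[OF emits_GEN[OF assms], where d = "0" and \<rho> = "(\<lambda>_. 0)"] by blast
  obtain w k where k: "\<And>x \<sigma>. T x \<sigma> \<le> (length x + (\<Sum>i<w. \<sigma> i) + 2) ^ k"
    using T(1) unfolding pbound_def by blast
  show ?thesis
  \<comment> \<open>With \<open>d = 0\<close> no counter holds a variable, so all variables read 0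
    and the time bound becomes \<open>(length x + 2) ^ k\<close>.\<close>
  proof (rule polytime_exec[where c = c and p = "[:2, 1:] ^ k"])
    fix x
    have "exec_within x c (0, \<lambda>_. 0, []) (T x (\<lambda>_. 0)) (0, \<lambda>_. 0, [] @ G x (\<lambda>_. 0))"
      by (rule T(2)[rule_format]) (auto simp: fun_eq_iff)
    then obtain t where "t \<le> T x (\<lambda>_. 0)" "exec x c (0, \<lambda>_. 0, []) t (0, \<lambda>_. 0, G x (\<lambda>_. 0))"
      unfolding exec_within_def by auto
    moreover have "T x (\<lambda>_. 0) \<le> poly ([:2, 1:] ^ k) (length x)"
      using k[of x "\<lambda>_. 0"] by (simp add: poly_power add.commute)
    ultimately show "\<exists>t \<le> poly ([:2, 1:] ^ k) (length x). \<exists>h v. exec x c (0, \<lambda>_. 0, []) t (h, v, G x (\<lambda>_. 0))"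
      using le_trans by blast
  qed
qed

section \<open>A library of definable functions\<close>

lemma DEF_rename: "DEF A \<Longrightarrow> DEF (\<lambda>x \<sigma>. A x (\<lambda>n. \<sigma> (\<rho> n)))"
proof (induction arbitrary: \<rho> rule: DEF.induct)
  case (sum A B)
  have "(\<lambda>n. (case_nat i \<sigma> :: env) (case n of 0 \<Rightarrow> 0 | Suc m \<Rightarrow> Suc (\<rho> m))) = case_nat i (\<lambda>n. \<sigma> (\<rho> n))" for i \<sigma>
    by (auto simp: fun_eq_iff split: nat.split)
  then show ?case
    using DEF.sum[OF sum.IH(1)[of \<rho>] sum.IH(2)[of "\<lambda>n. case n of 0 \<Rightarrow> 0 | Suc m \<Rightarrow> Suc (\<rho> m)"]] by simp
qed (rule DEF.intros | assumption)+

text \<open>Makes the bound variable an explicit argument: in the summand it is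
  \<open>\<sigma> 0\<close>, and the outer variables are shifted by one. Rules of this shape let
  \<open>intro\<close> prove definability of nested expressions.\<close>

lemma DEF_sum:
  assumes "DEF A" "DEF (\<lambda>x \<sigma>. B x (\<sigma> 0) (\<lambda>n. \<sigma> (Suc n)))"
  shows "DEF (\<lambda>x \<sigma>. \<Sum>i<A x \<sigma>. B x i \<sigma>)"
  using DEF.sum[OF assms] by simp

lemma DEF_const: "DEF (\<lambda>x \<sigma>. c)"
proof (induction c)
  case 0
  show ?case by (rule DEF.zero)
next
  case (Suc c)
  show ?case using DEF.add[OF Suc DEF.one] by simp
qed

lemma DEF_Suc: "DEF A \<Longrightarrow> DEF (\<lambda>x \<sigma>. Suc (A x \<sigma>))"
  using DEF.add[OF _ DEF.one, of A] by simp

lemma DEF_mult: assumes "DEF A" "DEF B" shows "DEF (\<lambda>x \<sigma>. A x \<sigma> * B x \<sigma>)"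
  using DEF_sum[OF assms(1), of "\<lambda>x i. B x"] DEF_rename[OF assms(2), of Suc] by simp

section \<open>Definable predicates\<close>

definition DEFP :: "(bool list \<Rightarrow> env \<Rightarrow> bool) \<Rightarrow> bool" where
  "DEFP P \<longleftrightarrow> DEF (\<lambda>x \<sigma>. of_bool (P x \<sigma>))"

lemma DEFP_cong: "DEF A \<Longrightarrow> (\<And>x \<sigma>. A x \<sigma> = of_bool (P x \<sigma>)) \<Longrightarrow> DEFP P"
proof -
  assume "DEF A" and *: "\<And>x \<sigma>. A x \<sigma> = of_bool (P x \<sigma>)"
  have "A = (\<lambda>x \<sigma>. of_bool (P x \<sigma>))" by (intro ext *)
  with \<open>DEF A\<close> show ?thesis unfolding DEFP_def by simp
qed

lemma DEFP_const: "DEFP (\<lambda>x \<sigma>. P)"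
  unfolding DEFP_def by (rule DEF_const)

lemma DEFP_not: "DEFP P \<Longrightarrow> DEFP (\<lambda>x \<sigma>. \<not> P x \<sigma>)"
proof -
  assume "DEFP P"
  then have "DEF (\<lambda>x \<sigma>. 1 - of_bool (P x \<sigma>))" unfolding DEFP_def by (rule DEF.diff[OF DEF.one])
  then show ?thesis by (rule DEFP_cong) simp
qed

lemma DEFP_conj: "DEFP P \<Longrightarrow> DEFP Q \<Longrightarrow> DEFP (\<lambda>x \<sigma>. P x \<sigma> \<and> Q x \<sigma>)"
  unfolding DEFP_def of_bool_conj by (rule DEF_mult)

lemma DEFP_disj: assumes "DEFP P" "DEFP Q" shows "DEFP (\<lambda>x \<sigma>. P x \<sigma> \<or> Q x \<sigma>)"
proof -
  have "DEFP (\<lambda>x \<sigma>. \<not> (\<not> P x \<sigma> \<and> \<not> Q x \<sigma>))" by (intro DEFP_not DEFP_conj assms)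
  then show ?thesis by (simp only: de_Morgan_conj not_not)
qed

lemma DEFP_imp: assumes "DEFP P" "DEFP Q" shows "DEFP (\<lambda>x \<sigma>. P x \<sigma> \<longrightarrow> Q x \<sigma>)"
  unfolding imp_conv_disj by (intro DEFP_disj DEFP_not assms)

lemma DEFP_iff: assumes "DEFP P" "DEFP Q" shows "DEFP (\<lambda>x \<sigma>. P x \<sigma> \<longleftrightarrow> Q x \<sigma>)"
  unfolding iff_conv_conj_imp by (intro DEFP_conj DEFP_imp assms)

lemma DEFP_less: "DEF A \<Longrightarrow> DEF B \<Longrightarrow> DEFP (\<lambda>x \<sigma>. A x \<sigma> < B x \<sigma>)"
proof -
  assume "DEF A" "DEF B"
  then have "DEF (\<lambda>x \<sigma>. 1 - (1 - (B x \<sigma> - A x \<sigma>)))" by (intro DEF.diff DEF.one)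
  then show ?thesis by (rule DEFP_cong) simp
qed

lemma DEFP_le: "DEF A \<Longrightarrow> DEF B \<Longrightarrow> DEFP (\<lambda>x \<sigma>. A x \<sigma> \<le> B x \<sigma>)"
  unfolding not_less[symmetric] by (intro DEFP_not DEFP_less)

lemma DEFP_eq: assumes "DEF A" "DEF B" shows "DEFP (\<lambda>x \<sigma>. A x \<sigma> = B x \<sigma>)"
  unfolding order_eq_iff by (intro DEFP_conj DEFP_le assms)

lemma DEFP_ex:
  assumes "DEF A" "DEFP (\<lambda>x \<sigma>. P x (\<sigma> 0) (\<lambda>n. \<sigma> (Suc n)))"
  shows "DEFP (\<lambda>x \<sigma>. \<exists>i<A x \<sigma>. P x i \<sigma>)"
proof (rule DEFP_cong)
  \<comment> \<open>The sum counts the witnesses, and \<open>1 - (1 - m)\<close> turns a count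
    \<open>m\<close> into a truth value.\<close>
  show "DEF (\<lambda>x \<sigma>. 1 - (1 - (\<Sum>i<A x \<sigma>. of_bool (P x i \<sigma>))))"
    by (intro DEF.diff DEF.one DEF_sum assms assms(2)[unfolded DEFP_def])
  show "1 - (1 - (\<Sum>i<A x \<sigma>. of_bool (P x i \<sigma>) :: nat)) = of_bool (\<exists>i<A x \<sigma>. P x i \<sigma>)" for x \<sigma>
  proof -
    have "(\<Sum>i<A x \<sigma>. of_bool (P x i \<sigma>) :: nat) = 0 \<longleftrightarrow> \<not> (\<exists>i<A x \<sigma>. P x i \<sigma>)"
      unfolding sum_eq_0_iff[OF finite_lessThan] by auto
    moreover have "1 - (1 - n) = of_bool (n \<noteq> 0)" for n :: nat by (cases n) auto
    ultimately show ?thesis by (simp only: not_not)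
  qed
qed

lemma DEFP_all:
  assumes "DEF A" "DEFP (\<lambda>x \<sigma>. P x (\<sigma> 0) (\<lambda>n. \<sigma> (Suc n)))"
  shows "DEFP (\<lambda>x \<sigma>. \<forall>i<A x \<sigma>. P x i \<sigma>)"
proof -
  have "DEFP (\<lambda>x \<sigma>. \<not> (\<exists>i<A x \<sigma>. \<not> P x i \<sigma>))" by (intro DEFP_not DEFP_ex assms)
  then show ?thesis by simp
qed

lemma DEFP_bit: "DEF A \<Longrightarrow> DEFP (\<lambda>x \<sigma>. A x \<sigma> < length x \<and> x ! A x \<sigma>)"
  unfolding DEFP_def by (rule DEF.bit)

lemma DEF_of_bool: "DEFP P \<Longrightarrow> DEF (\<lambda>x \<sigma>. of_bool (P x \<sigma>))"
  unfolding DEFP_def .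

lemma DEF_if:
  assumes "DEFP P" "DEF A" "DEF B"
  shows "DEF (\<lambda>x \<sigma>. if P x \<sigma> then A x \<sigma> else B x \<sigma>)"
proof -
  have "DEF (\<lambda>x \<sigma>. of_bool (P x \<sigma>) * A x \<sigma> + of_bool (\<not> P x \<sigma>) * B x \<sigma>)"
    using assms DEFP_not[OF assms(1)] by (intro DEF.add DEF_mult DEF_of_bool)
  moreover have "of_bool (P x \<sigma>) * A x \<sigma> + of_bool (\<not> P x \<sigma>) * B x \<sigma> = (if P x \<sigma> then A x \<sigma> else B x \<sigma>)" for x \<sigma>
    by simp
  ultimately show ?thesis by simp
qed

lemma DEFP_if:
  assumes "DEFP P" "DEFP Q" "DEFP R"
  shows "DEFP (\<lambda>x \<sigma>. if P x \<sigma> then Q x \<sigma> else R x \<sigma>)"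
  using DEF_if[OF assms(1) assms(2,3)[unfolded DEFP_def]] unfolding DEFP_def by (simp add: if_distrib cong: if_cong)

text \<open>Substitution is not a clause of \<open>DEF\<close>. It is simulated by a sum whose only
  nonzero term is the one at \<open>i = A x \<sigma>\<close>.\<close>

lemma DEF_let:
  assumes "DEF A" "DEF B"
  shows "DEF (\<lambda>x \<sigma>. B x (case_nat (A x \<sigma>) \<sigma>))"
proof -
  have "DEF (\<lambda>x \<sigma>. \<Sum>i<Suc (A x \<sigma>). if i = A x \<sigma> then B x (case_nat i \<sigma>) else 0)"
  proof (intro DEF_sum DEF_Suc assms DEF_if DEFP_eq DEF.var DEF.zero)
    show "DEF (\<lambda>x \<sigma>. A x (\<lambda>n. \<sigma> (Suc n)))" by (rule DEF_rename) (rule assms)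
    have "case_nat (\<sigma> 0) (\<lambda>n. \<sigma> (Suc n)) = \<sigma>" for \<sigma> :: env
      by (auto simp: fun_eq_iff split: nat.split)
    then show "DEF (\<lambda>x \<sigma>. B x (case_nat (\<sigma> 0) (\<lambda>n. \<sigma> (Suc n))))" using assms(2) by simp
  qed
  then show ?thesis by (simp add: sum.delta)
qed

lemma DEF_comp1:
  assumes "DEF (\<lambda>x \<sigma>. h x (\<sigma> 0))" "DEF A"
  shows "DEF (\<lambda>x \<sigma>. h x (A x \<sigma>))"
  using DEF_let[OF assms(2,1)] by simp

lemma DEF_comp2:
  assumes "DEF (\<lambda>x \<sigma>. h x (\<sigma> 0) (\<sigma> 1))" "DEF A" "DEF B"
  shows "DEF (\<lambda>x \<sigma>. h x (A x \<sigma>) (B x \<sigma>))"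
  using DEF_let[OF assms(3) DEF_let[OF DEF_rename[OF assms(2), of Suc] assms(1)]] by simp

lemma DEFP_comp2:
  "DEFP (\<lambda>x \<sigma>. h x (\<sigma> 0) (\<sigma> 1)) \<Longrightarrow> DEF A \<Longrightarrow> DEF B \<Longrightarrow> DEFP (\<lambda>x \<sigma>. h x (A x \<sigma>) (B x \<sigma>))"
  unfolding DEFP_def by (rule DEF_comp2)

lemma DEF_div:
  assumes "DEF A" "DEF B"
  shows "DEF (\<lambda>x \<sigma>. A x \<sigma> div B x \<sigma>)"
proof -
  \<comment> \<open>For \<open>b > 0\<close> the quotient of \<open>a\<close> by \<open>b\<close> is
    the number of positive multiples of \<open>b\<close> up to \<open>a\<close>; the case
    \<open>b = 0\<close> follows the convention for \<open>div\<close>.\<close>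
  have "DEF (\<lambda>x \<sigma>. if \<sigma> 1 = 0 then 0 else \<Sum>i<\<sigma> 0. of_bool (Suc i * \<sigma> 1 \<le> \<sigma> 0))"
    by (intro DEF_if DEFP_eq DEF.var DEF_const DEF_sum DEF_of_bool DEFP_le DEF_mult DEF_Suc)
  moreover have "(if b = 0 then 0 else \<Sum>i<a. of_bool (Suc i * b \<le> a)) = a div b" for a b :: nat
  proof (cases "b = 0")
    case False
    have "{..<a} \<inter> {i. Suc i * b \<le> a} = {..<a div b}"
    proof -
      have "Suc i * b \<le> a \<longleftrightarrow> i < a div b" for i
        using False by (simp add: Suc_le_eq[symmetric] less_eq_div_iff_mult_less_eq del: mult_Suc)
      moreover have "i < a" if "i < a div b" for i using that div_le_dividend[of a b] by linarith
      ultimately show ?thesis by auto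
    qed
    then show ?thesis using False by (simp add: of_bool_def sum.If_cases del: mult_Suc)
  qed simp
  ultimately have "DEF (\<lambda>x \<sigma>. \<sigma> 0 div \<sigma> 1)" by (simp only:)
  from DEF_comp2[of "\<lambda>x a b. a div b", OF this assms] show ?thesis .
qed

lemma DEF_mod: assumes "DEF A" "DEF B" shows "DEF (\<lambda>x \<sigma>. A x \<sigma> mod B x \<sigma>)"
proof -
  have "DEF (\<lambda>x \<sigma>. A x \<sigma> - A x \<sigma> div B x \<sigma> * B x \<sigma>)" by (intro DEF.diff DEF_mult DEF_div assms)
  then show ?thesis by (simp only: minus_div_mult_eq_mod)
qed

lemma DEF_poly: assumes "DEF A" shows "DEF (\<lambda>x \<sigma>. poly p (A x \<sigma>))"
proof (induction p)
  case 0
  show ?case by (simp add: DEF.zero)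
next
  case (pCons a p)
  then show ?case using assms by (simp add: DEF.add DEF_mult DEF_const)
qed

text \<open>A function on a fixed finite range is a finite case distinction, however complicated
  \<open>F\<close> may be, because \<open>D\<close> and \<open>F\<close> are chosen before the word
  \<open>x\<close>. All data about tiles enter the reduction in this way.\<close>

lemma DEF_table:
  assumes "DEF A"
  shows "DEF (\<lambda>x \<sigma>. if A x \<sigma> < D then F (A x \<sigma>) else 0)"
proof (induction D)
  case 0
  show ?case by (simp add: DEF.zero)
next
  case (Suc D)
  have "DEF (\<lambda>x \<sigma>. if A x \<sigma> = D then F D else if A x \<sigma> < D then F (A x \<sigma>) else 0)"
    by (intro DEF_if DEFP_eq assms DEF_const Suc)
  moreover have "(if a = D then F D else if a < D then F a else 0) = (if a < Suc D then F a else 0)" for a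
    by auto
  ultimately show ?case by simp
qed

lemma DEFP_table: assumes "DEF A" shows "DEFP (\<lambda>x \<sigma>. A x \<sigma> < D \<and> Q (A x \<sigma>))"
  by (rule DEFP_cong[OF DEF_table[OF assms, of D "\<lambda>t. of_bool (Q t)"]]) auto

lemmas def_intros = DEF.var DEF_const DEF.length DEF.add DEF.diff DEF_Suc DEF_mult DEF_div DEF_mod
  DEF_poly DEF_if DEF_sum DEF_of_bool DEFP_bit DEFP_const DEFP_not DEFP_conj DEFP_disj DEFP_imp DEFP_if
  DEFP_less DEFP_le DEFP_eq DEFP_iff DEFP_ex DEFP_all

lemma GEN_rename: "GEN G \<Longrightarrow> GEN (\<lambda>x \<sigma>. G x (\<lambda>n. \<sigma> (\<rho> n)))"
proof (induction arbitrary: \<rho> rule: GEN.induct)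
  case (emit A)
  show ?case by (rule GEN.emit[OF DEF_rename[OF emit]])
next
  case (app F G)
  show ?case by (rule GEN.app[OF app.IH])
next
  case ("for" A G)
  have "(\<lambda>n. (case_nat i \<sigma> :: env) (case n of 0 \<Rightarrow> 0 | Suc m \<Rightarrow> Suc (\<rho> m))) = case_nat i (\<lambda>n. \<sigma> (\<rho> n))" for i \<sigma>
    by (auto simp: fun_eq_iff split: nat.split)
  then show ?case
    using GEN.for[OF DEF_rename[OF "for.hyps"(1)] "for.IH"[of "\<lambda>n. case n of 0 \<Rightarrow> 0 | Suc m \<Rightarrow> Suc (\<rho> m)"], of \<rho>] by simp
qed

lemma GEN_for:
  assumes "DEF A" "GEN (\<lambda>x \<sigma>. G x (\<sigma> 0) (\<lambda>n. \<sigma> (Suc n)))"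
  shows "GEN (\<lambda>x \<sigma>. concat (map (\<lambda>i. G x i \<sigma>) [0..<A x \<sigma>]))"
  using GEN.for[OF assms] by simp

lemma GEN_emit: assumes "DEFP P" shows "GEN (\<lambda>x \<sigma>. [P x \<sigma>])"
  using GEN.emit[OF assms[unfolded DEFP_def]] by simp

text \<open>A loop with 0 or 1 rounds acts as a conditional.\<close>

lemma GEN_if:
  assumes "DEFP P" "GEN G"
  shows "GEN (\<lambda>x \<sigma>. if P x \<sigma> then G x \<sigma> else [])"
proof -
  have "GEN (\<lambda>x \<sigma>. concat (map (\<lambda>i. G x \<sigma>) [0..<of_bool (P x \<sigma>)]))"
    by (rule GEN_for[OF DEF_of_bool[OF assms(1)], where G = "\<lambda>x i \<sigma>. G x \<sigma>"])
      (rule GEN_rename[OF assms(2), where \<rho> = Suc])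
  moreover have "concat (map (\<lambda>i. G x \<sigma>) [0..<of_bool (P x \<sigma>)]) = (if P x \<sigma> then G x \<sigma> else [])" for x \<sigma>
    by simp
  ultimately show ?thesis by simp
qed

lemma class_P_DEFP: assumes "DEFP P" shows "{x. P x (\<lambda>_. 0)} \<in> class_P"
  unfolding class_P_def mem_Collect_eq by (rule polytime_GEN[OF GEN_emit[OF assms]])

lemma polytime_reducible_GEN:
  assumes "GEN G" "\<And>x. x \<in> L \<longleftrightarrow> G x (\<lambda>_. 0) \<in> L'"
  shows "polytime_reducible L L'"
  unfolding polytime_reducible_def
  by (rule exI[of _ "\<lambda>x. G x (\<lambda>_. 0)"]) (intro conjI polytime_GEN[OF assms(1)] assms(2) allI)

section \<open>Point sets as separated matchings\<close>

text \<open>A point of the plane becomes an edge between its two coordinates; the shift by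
  \<open>K\<close> is meant to put all vertical coordinates after all horizontal ones.\<close>

definition graph_of :: "nat \<Rightarrow> 'i set \<Rightarrow> ('i \<Rightarrow> nat) \<Rightarrow> ('i \<Rightarrow> nat) \<Rightarrow> nat ordered_graph" where
  "graph_of K I X Y = \<lparr>verts = X ` I \<union> (\<lambda>i. K + Y i) ` I, edges = (\<lambda>i. {X i, K + Y i}) ` I\<rparr>"

lemma ordered_matching_graph_of:
  assumes "finite I" "inj_on X I" "inj_on Y I" "\<And>i. i \<in> I \<Longrightarrow> X i < K"
  shows "ordered_matching (graph_of K I X Y)"
  unfolding ordered_matching_def
proof
  have "X i \<noteq> K + Y i" if "i \<in> I" for i using assms(4)[OF that] by simp
  then show "ordered_graph (graph_of K I X Y)"
    using assms(1) by (auto simp: ordered_graph_def graph_of_def card_insert_if)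
  have "\<exists>!e. e \<in> edges (graph_of K I X Y) \<and> X i \<in> e" if "i \<in> I" for i
  proof (rule ex1I[of _ "{X i, K + Y i}"])
    fix e assume "e \<in> edges (graph_of K I X Y) \<and> X i \<in> e"
    then obtain j where j: "j \<in> I" "e = {X j, K + Y j}" "X i \<in> e" by (auto simp: graph_of_def)
    then have "X i = X j" using assms(4)[OF that] by auto
    then show "e = {X i, K + Y i}" using j inj_onD[OF assms(2) _ that j(1)] by simp
  qed (use that in \<open>auto simp: graph_of_def\<close>)
  moreover have "\<exists>!e. e \<in> edges (graph_of K I X Y) \<and> K + Y i \<in> e" if "i \<in> I" for i
  proof (rule ex1I[of _ "{X i, K + Y i}"])
    fix e assume "e \<in> edges (graph_of K I X Y) \<and> K + Y i \<in> e"
    then obtain j where j: "j \<in> I" "e = {X j, K + Y j}" "K + Y i \<in> e" by (auto simp: graph_of_def)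
    then have "Y i = Y j" using assms(4)[OF j(1)] by auto
    then show "e = {X i, K + Y i}" using j inj_onD[OF assms(3) _ that j(1)] by simp
  qed (use that in \<open>auto simp: graph_of_def\<close>)
  ultimately have *: "\<And>i. i \<in> I \<Longrightarrow> (\<exists>!e. e \<in> edges (graph_of K I X Y) \<and> X i \<in> e) \<and>
    (\<exists>!e. e \<in> edges (graph_of K I X Y) \<and> K + Y i \<in> e)" by simp
  show "\<forall>v\<in>verts (graph_of K I X Y). \<exists>!e. e \<in> edges (graph_of K I X Y) \<and> v \<in> e"
  proof
    fix v assume "v \<in> verts (graph_of K I X Y)"
    then obtain i where i: "i \<in> I" "v = X i \<or> v = K + Y i" by (auto simp: graph_of_def)
    then show "\<exists>!e. e \<in> edges (graph_of K I X Y) \<and> v \<in> e" using *[OF i(1)] by (elim disjE) simp_all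
  qed
qed

lemma sorted_list_of_set_Un:
  assumes "finite A" "finite B" "\<And>a b. a \<in> A \<Longrightarrow> b \<in> B \<Longrightarrow> a < b"
  shows "sorted_list_of_set (A \<union> B) = sorted_list_of_set A @ sorted_list_of_set (B :: 'a :: linorder set)"
proof (rule sorted_distinct_set_unique)
  show "sorted (sorted_list_of_set A @ sorted_list_of_set B)"
    using assms by (auto simp: sorted_append intro: less_imp_le)
  have "A \<inter> B = {}" using assms(3) by fastforce
  then show "distinct (sorted_list_of_set A @ sorted_list_of_set B)" using assms by simp
qed (use assms in auto)

lemma separated_graph_of:
  assumes "finite I" "I \<noteq> {}" "\<And>i. i \<in> I \<Longrightarrow> X i < K"
  shows "separated (graph_of K I X Y)"
proof -
  let ?G = "graph_of K I X Y" and ?B = "(\<lambda>i. K + Y i) ` I"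
  have lt: "a < b" if "a \<in> X ` I" "b \<in> ?B" for a b
    using that assms(3) by fastforce
  have vl: "vertex_list ?G = sorted_list_of_set (X ` I) @ sorted_list_of_set ?B"
    unfolding vertex_list_def graph_of_def
    using sorted_list_of_set_Un[of "X ` I" ?B, OF _ _ lt] assms(1) by simp
  have len: "length (sorted_list_of_set (X ` I)) = card (X ` I)" by simp
  have cut: "cut ?G (card (X ` I)) = (X ` I, ?B)"
    unfolding cut_def vl using assms(1) by simp
  have "card (verts ?G) = card (X ` I) + card ?B"
  proof -
    have "X ` I \<inter> ?B = {}" using lt by fastforce
    then show ?thesis using assms(1) by (simp add: graph_of_def card_Un_disjoint)
  qed
  moreover have "0 < card (X ` I)" "0 < card ?B" using assms by (simp_all add: card_gt_0_iff)
  ultimately have 1: "card (X ` I) \<in> {1..card (verts ?G) - 1}" by simp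
  have 2: "\<forall>e\<in>edges ?G. goes_across e (cut ?G (card (X ` I)))"
    unfolding cut goes_across_def by (auto simp: graph_of_def)
  show ?thesis unfolding separated_def using 2 1 by (rule bexI[where x = "card (X ` I)"])
qed

text \<open>Edges go to edges, and monotonicity sends left ends to left ends. A map of vertices is
  therefore the same as a map of points that preserves both coordinate orders.\<close>

lemma ordered_subgraph_graph_of:
  assumes X: "inj_on X I" "\<And>i. i \<in> I \<Longrightarrow> X i < K"
    and Y: "inj_on Y I"
    and X': "\<And>j. j \<in> J \<Longrightarrow> X' j < K'"
  shows "ordered_subgraph (graph_of K I X Y) (graph_of K' J X' Y') \<longleftrightarrow>
    (\<exists>f. f ` I \<subseteq> J \<and> (\<forall>i\<in>I. \<forall>j\<in>I. (X i < X j \<longrightarrow> X' (f i) < X' (f j)) \<and> (Y i < Y j \<longrightarrow> Y' (f i) < Y' (f j))))"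
    (is "ordered_subgraph ?N ?M \<longleftrightarrow> _")
proof
  assume "ordered_subgraph ?N ?M"
  then obtain \<phi> where
    mono': "\<forall>u\<in>verts ?N. \<forall>v\<in>verts ?N. u < v \<longrightarrow> \<phi> u < \<phi> v" and
    edge': "\<forall>u\<in>verts ?N. \<forall>v\<in>verts ?N. {u, v} \<in> edges ?N \<longrightarrow> {\<phi> u, \<phi> v} \<in> edges ?M"
    unfolding ordered_subgraph_def by (elim exE conjE)
  note mono = mono'[rule_format] and edge = edge'[rule_format]
  have vX: "X i \<in> verts ?N" and vY: "K + Y i \<in> verts ?N" if "i \<in> I" for i
    using that by (auto simp: graph_of_def)
  have "\<exists>j\<in>J. \<phi> (X i) = X' j \<and> \<phi> (K + Y i) = K' + Y' j" if i: "i \<in> I" for i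
  proof -
    have "{X i, K + Y i} \<in> edges ?N" using i by (auto simp: graph_of_def)
    then have "{\<phi> (X i), \<phi> (K + Y i)} \<in> edges ?M" using edge vX vY i by blast
    then obtain j where j: "j \<in> J" "{\<phi> (X i), \<phi> (K + Y i)} = {X' j, K' + Y' j}"
      by (auto simp: graph_of_def)
    have "X i < K + Y i" using X(2)[OF i] by simp
    then have "\<phi> (X i) < \<phi> (K + Y i)" using mono vX vY i by blast
    then show ?thesis using j X'[OF j(1)] by (auto simp: doubleton_eq_iff)
  qed
  then obtain f where f: "\<And>i. i \<in> I \<Longrightarrow> f i \<in> J \<and> \<phi> (X i) = X' (f i) \<and> \<phi> (K + Y i) = K' + Y' (f i)"
    by metis
  have "X' (f i) < X' (f j)" if "i \<in> I" "j \<in> I" "X i < X j" for i j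
    using mono[OF vX[OF that(1)] vX[OF that(2)] that(3)] f[OF that(1)] f[OF that(2)] by simp
  moreover have "Y' (f i) < Y' (f j)" if "i \<in> I" "j \<in> I" "Y i < Y j" for i j
    using mono[OF vY[OF that(1)] vY[OF that(2)]] f[OF that(1)] f[OF that(2)] that(3) by simp
  ultimately show "\<exists>f. f ` I \<subseteq> J \<and> (\<forall>i\<in>I. \<forall>j\<in>I. (X i < X j \<longrightarrow> X' (f i) < X' (f j)) \<and> (Y i < Y j \<longrightarrow> Y' (f i) < Y' (f j)))"
    using f by (intro exI[of _ f] conjI ballI impI image_subsetI) simp_all
next
  assume "\<exists>f. f ` I \<subseteq> J \<and> (\<forall>i\<in>I. \<forall>j\<in>I. (X i < X j \<longrightarrow> X' (f i) < X' (f j)) \<and> (Y i < Y j \<longrightarrow> Y' (f i) < Y' (f j)))"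
  then obtain f where f: "f ` I \<subseteq> J"
      "\<forall>i\<in>I. \<forall>j\<in>I. (X i < X j \<longrightarrow> X' (f i) < X' (f j)) \<and> (Y i < Y j \<longrightarrow> Y' (f i) < Y' (f j))"
    by (elim exE conjE)
  have fJ: "f i \<in> J" if "i \<in> I" for i using f(1) that by blast
  have fX: "X' (f i) < X' (f j)" if "i \<in> I" "j \<in> I" "X i < X j" for i j using f(2) that by simp
  have fY: "Y' (f i) < Y' (f j)" if "i \<in> I" "j \<in> I" "Y i < Y j" for i j using f(2) that by simp
  define \<phi> where "\<phi> v = (if v < K then X' (f (inv_into I X v)) else K' + Y' (f (inv_into I Y (v - K))))" for v
  have pX: "\<phi> (X i) = X' (f i)" and pY: "\<phi> (K + Y i) = K' + Y' (f i)" if "i \<in> I" for i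
    using that X Y by (simp_all add: \<phi>_def)
  have cases: "(\<exists>i\<in>I. v = X i) \<or> (\<exists>i\<in>I. v = K + Y i)" if "v \<in> verts ?N" for v
    using that by (auto simp: graph_of_def)
  have mono: "\<phi> u < \<phi> v" if uv: "u \<in> verts ?N" "v \<in> verts ?N" "u < v" for u v
    using cases[OF uv(1)] cases[OF uv(2)]
  proof (elim disjE bexE)
    fix i j assume "i \<in> I" "u = X i" "j \<in> I" "v = X j"
    then show ?thesis using uv(3) by (simp add: pX fX)
  next
    fix i j assume "i \<in> I" "u = X i" "j \<in> I" "v = K + Y j"
    then show ?thesis using X'[OF fJ[of i]] by (simp add: pX pY)
  next
    fix i j assume "i \<in> I" "u = K + Y i" "j \<in> I" "v = X j"
    then show ?thesis using uv(3) X(2)[of j] by simp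
  next
    fix i j assume "i \<in> I" "u = K + Y i" "j \<in> I" "v = K + Y j"
    then show ?thesis using uv(3) by (simp add: pY fY)
  qed
  have 1: "\<phi> ` verts ?N \<subseteq> verts ?M"
  proof
    fix w assume "w \<in> \<phi> ` verts ?N"
    then obtain i where "i \<in> I" "w = X' (f i) \<or> w = K' + Y' (f i)"
      using cases pX pY by blast
    then show "w \<in> verts ?M" using fJ[of i] by (auto simp: graph_of_def)
  qed
  have 2: "inj_on \<phi> (verts ?N)"
  proof (rule inj_onI)
    fix u v assume "u \<in> verts ?N" "v \<in> verts ?N" "\<phi> u = \<phi> v"
    then show "u = v" using mono[of u v] mono[of v u] by (cases u v rule: linorder_cases) auto
  qed
  have 3: "{\<phi> u, \<phi> v} \<in> edges ?M" if "{u, v} \<in> edges ?N" for u v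
  proof -
    have "{u, v} \<in> (\<lambda>i. {X i, K + Y i}) ` I" using that by (simp add: graph_of_def)
    then obtain i where i: "{u, v} = {X i, K + Y i}" "i \<in> I" by (rule imageE)
    then have "u = X i \<and> v = K + Y i \<or> u = K + Y i \<and> v = X i" by (simp add: doubleton_eq_iff)
    then have "{\<phi> u, \<phi> v} = {X' (f i), K' + Y' (f i)}" using pX[OF i(2)] pY[OF i(2)] by auto
    then show ?thesis using fJ[OF i(2)] by (simp add: graph_of_def)
  qed
  show "ordered_subgraph ?N ?M"
    unfolding ordered_subgraph_def by (rule exI[of _ \<phi>]) (intro conjI ballI impI 1 2 3 mono)
qed

section \<open>A constraint problem as a pattern problem for point sets\<close>

text \<open>Coordinates consist of a block index times the block width plus a position in the block;
  this turns their comparison into a lexicographic one.\<close>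

lemma lex_less_iff:
  fixes a a' r r' W :: nat
  assumes "r < W" "r' < W"
  shows "a * W + r < a' * W + r' \<longleftrightarrow> a < a' \<or> a = a' \<and> r < r'"
proof (cases a a' rule: linorder_cases)
  case less
  then have "Suc a * W \<le> a' * W" by (intro mult_le_mono1) simp
  then show ?thesis using less assms by simp
next
  case greater
  then have "Suc a' * W \<le> a * W" by (intro mult_le_mono1) simp
  then show ?thesis using greater assms by simp
qed simp

text \<open>A strictly increasing map grows by at least \<open>d\<close> over \<open>d\<close>
  steps. Counted from 0 this gives \<open>i \<le> h i\<close>, counted up to \<open>n - 1\<close> it
  gives \<open>h i \<le> i\<close>.\<close>

lemma strict_mono_below_id:
  fixes h :: "nat \<Rightarrow> nat"
  assumes "\<And>i. i < n \<Longrightarrow> h i < n" "\<And>i j. i < j \<Longrightarrow> j < n \<Longrightarrow> h i < h j" "i < n"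
  shows "h i = i"
proof -
  have ge: "i + d < n \<Longrightarrow> h i + d \<le> h (i + d)" for i d
  proof (induction d)
    case (Suc d)
    then show ?case using assms(2)[of "i + d" "i + Suc d"] by simp
  qed simp
  have "i \<le> h i" using ge[of 0 i] assms(3) by simp
  moreover have "h i \<le> i" using ge[of i "n - 1 - i"] assms(1)[of "n - 1"] assms(3) by simp
  ultimately show ?thesis by simp
qed

section \<open>Layout of the points in the plane\<close>

datatype point = Slot nat nat | Alpha nat | Beta nat | Gamma nat

text \<open>The order is by vertical strip, then by tile, then by a tie-break: the even slot of a
  synchronising strip comes first, the odd one last, and all constraint slots lie between. A
  constraint slot is thereby squeezed between two points of known tile.\<close>

definition slot_x :: "nat \<Rightarrow> nat \<Rightarrow> nat \<Rightarrow> (nat \<Rightarrow> nat) \<Rightarrow> nat \<Rightarrow> nat \<Rightarrow> nat" where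
  "slot_x n E D xs z t = xs z * (D * (2 * E + 1) + 1) +
     (t * (2 * E + 1) + (if z < 2 * n then if even z then 0 else 2 * E else z))"

text \<open>The order is by horizontal strip, then by value, then by parity of the slot, then by
  tile. For equal values the even slot is below the odd one, so the pattern forces
  \<open>\<le>\<close> and not \<open><\<close>.\<close>

definition slot_y :: "nat \<Rightarrow> nat \<Rightarrow> (nat \<Rightarrow> nat \<Rightarrow> nat) \<Rightarrow> nat \<Rightarrow> nat \<Rightarrow> nat" where
  "slot_y D C val z t = z div 2 * (C * (2 * D) + 1) + (val z t * (2 * D) + (z mod 2 * D + t))"

text \<open>The final 1 in the two strip sizes is room for a separator: \<open>Alpha i\<close>
  closes vertical strip \<open>i\<close> and \<open>Beta e\<close> closes horizontal strip
  \<open>e\<close>. Beyond all strips the \<open>Gamma\<close> points form an increasing sequence,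
  with every \<open>Alpha\<close> to its upper left and every \<open>Beta\<close> to its lower
  right.\<close>

fun point_x :: "nat \<Rightarrow> nat \<Rightarrow> nat \<Rightarrow> nat \<Rightarrow> (nat \<Rightarrow> nat) \<Rightarrow> point \<Rightarrow> nat" where
  "point_x n E D L xs (Slot z t) = slot_x n E D xs z t"
| "point_x n E D L xs (Alpha i) = i * (D * (2 * E + 1) + 1) + D * (2 * E + 1)"
| "point_x n E D L xs (Beta e) = n * (D * (2 * E + 1) + 1) + L + e"
| "point_x n E D L xs (Gamma k) = n * (D * (2 * E + 1) + 1) + k"

fun point_y :: "nat \<Rightarrow> nat \<Rightarrow> nat \<Rightarrow> nat \<Rightarrow> (nat \<Rightarrow> nat \<Rightarrow> nat) \<Rightarrow> point \<Rightarrow> nat" where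
  "point_y E D C L val (Slot z t) = slot_y D C val z t"
| "point_y E D C L val (Alpha i) = E * (C * (2 * D) + 1) + L + i"
| "point_y E D C L val (Beta e) = e * (C * (2 * D) + 1) + C * (2 * D)"
| "point_y E D C L val (Gamma k) = E * (C * (2 * D) + 1) + k"

definition points :: "nat \<Rightarrow> nat \<Rightarrow> nat \<Rightarrow> nat \<Rightarrow> (nat \<Rightarrow> nat \<Rightarrow> bool) \<Rightarrow> point set" where
  "points n E D L ok = {Slot z t | z t. z < 2 * E \<and> t < D \<and> ok z t} \<union>
     Alpha ` {..<n} \<union> Beta ` {..<E} \<union> Gamma ` {..<L}"

lemma finite_card_slots:
  "finite {Slot z t | z t. z < 2 * E \<and> t < D \<and> ok z t}"
  "card {Slot z t | z t. z < 2 * E \<and> t < D \<and> ok z t} \<le> 2 * E * D"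
proof -
  have sub: "{Slot z t | z t. z < 2 * E \<and> t < D \<and> ok z t} \<subseteq> (\<lambda>(z, t). Slot z t) ` ({..<2 * E} \<times> {..<D})"
    by auto
  then show "finite {Slot z t | z t. z < 2 * E \<and> t < D \<and> ok z t}" by (rule finite_subset) simp
  have "card {Slot z t | z t. z < 2 * E \<and> t < D \<and> ok z t} \<le> card ((\<lambda>(z, t). Slot z t) ` ({..<2 * E} \<times> {..<D}))"
    by (rule card_mono[OF _ sub]) simp
  also have "\<dots> \<le> card ({..<2 * E} \<times> {..<D})" by (rule card_image_le) simp
  finally show "card {Slot z t | z t. z < 2 * E \<and> t < D \<and> ok z t} \<le> 2 * E * D" by simp
qed

text \<open>
  Strip \<open>e < n\<close> synchronises variable \<open>e\<close>; each later strip \<open>e\<close> with \<open>vs e\<close> is a constraint between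
  the variables of its two slots \<open>2 e\<close> and \<open>2 e + 1\<close>.
\<close>

locale strips =
  fixes n E D C L :: nat and xs :: "nat \<Rightarrow> nat" and vs :: "nat \<Rightarrow> bool"
  assumes n_pos: "0 < n" and n_le: "n \<le> E" and D_pos: "0 < D" and D_le: "D \<le> C"
    and L_gt: "2 * E * D + n + E < L"
    and xs_less: "\<And>z. z < 2 * E \<Longrightarrow> vs (z div 2) \<Longrightarrow> xs z < n"
    and vs_sync: "\<And>e. e < n \<Longrightarrow> vs e"
    and xs_sync: "\<And>e. e < n \<Longrightarrow> xs (2 * e) = e \<and> xs (2 * e + 1) = e"
    and xs_diff: "\<And>e. n \<le> e \<Longrightarrow> e < E \<Longrightarrow> vs e \<Longrightarrow> xs (2 * e) \<noteq> xs (2 * e + 1)"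
begin

definition xi :: "nat \<Rightarrow> nat" where
  "xi z = (if z < 2 * n then if even z then 0 else 2 * E else z)"

abbreviation "W \<equiv> D * (2 * E + 1) + 1"
abbreviation "H \<equiv> C * (2 * D) + 1"
abbreviation "X \<equiv> point_x n E D L xs"
abbreviation "Y \<equiv> point_y E D C L"

lemma X_Slot: "X (Slot z t) = xs z * W + (t * (2 * E + 1) + xi z)"
  by (simp add: slot_x_def xi_def)

lemma xi_less: "z < 2 * E \<Longrightarrow> xi z < 2 * E + 1"
  by (simp add: xi_def)

lemma x_rem: "z < 2 * E \<Longrightarrow> t < D \<Longrightarrow> t * (2 * E + 1) + xi z < D * (2 * E + 1)"
proof -
  assume *: "z < 2 * E" "t < D"
  then have "Suc t * (2 * E + 1) \<le> D * (2 * E + 1)" by (intro mult_le_mono1) simp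
  then show ?thesis using xi_less[OF *(1)] by simp
qed

lemma X_slot_slot:
  assumes "z < 2 * E" "t < D" "z' < 2 * E" "t' < D"
  shows "X (Slot z t) < X (Slot z' t') \<longleftrightarrow>
    xs z < xs z' \<or> xs z = xs z' \<and> (t < t' \<or> t = t' \<and> xi z < xi z')"
proof -
  have "X (Slot z t) < X (Slot z' t') \<longleftrightarrow> xs z < xs z' \<or> xs z = xs z' \<and>
     t * (2 * E + 1) + xi z < t' * (2 * E + 1) + xi z'"
    unfolding X_Slot by (rule lex_less_iff) (use x_rem assms in \<open>meson less_SucI less_add_one order_less_trans\<close>)+
  then show ?thesis using lex_less_iff[OF xi_less[OF assms(1)] xi_less[OF assms(3)]] by simp
qed

lemma X_slot_alpha:
  assumes "z < 2 * E" "t < D"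
  shows "X (Slot z t) < X (Alpha i) \<longleftrightarrow> xs z \<le> i" "X (Alpha i) < X (Slot z t) \<longleftrightarrow> i < xs z"
proof -
  have r: "t * (2 * E + 1) + xi z < W" "D * (2 * E + 1) < W" using x_rem[OF assms] by simp_all
  show "X (Slot z t) < X (Alpha i) \<longleftrightarrow> xs z \<le> i"
    unfolding X_Slot unfolding point_x.simps lex_less_iff[OF r] using x_rem[OF assms] by auto
  show "X (Alpha i) < X (Slot z t) \<longleftrightarrow> i < xs z"
    unfolding X_Slot unfolding point_x.simps lex_less_iff[OF r(2,1)] using x_rem[OF assms] by auto
qed

lemma X_alpha_alpha: "X (Alpha i) < X (Alpha j) \<longleftrightarrow> i < j"
  unfolding point_x.simps by (subst lex_less_iff) auto

lemma strip_bound: "i < k \<Longrightarrow> r < w \<Longrightarrow> i * w + r < k * w" for i k r w :: nat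
  using mult_le_mono1[of "Suc i" k w] by simp

lemma X_alpha_less: "i < n \<Longrightarrow> X (Alpha i) < n * W"
  unfolding point_x.simps by (rule strip_bound) simp_all

lemma X_slot_less: "z < 2 * E \<Longrightarrow> t < D \<Longrightarrow> vs (z div 2) \<Longrightarrow> X (Slot z t) < n * W"
  unfolding X_Slot by (rule strip_bound[OF xs_less]) (use x_rem[of z t] in simp_all)

lemma y_rem:
  assumes "val z t < C" "t < D"
  shows "z mod 2 * D + t < 2 * D" "val z t * (2 * D) + (z mod 2 * D + t) < C * (2 * D)"
proof -
  have "z mod 2 * D \<le> D" by (cases "even z") (simp_all add: odd_iff_mod_2_eq_one)
  then show *: "z mod 2 * D + t < 2 * D" using assms(2) by linarith
  show "val z t * (2 * D) + (z mod 2 * D + t) < C * (2 * D)" by (rule strip_bound[OF assms(1) *])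
qed

lemma Y_slot_slot:
  assumes "val z t < C" "t < D" "val' z' t' < C" "t' < D"
  shows "slot_y D C val z t < slot_y D C val' z' t' \<longleftrightarrow> z div 2 < z' div 2 \<or> z div 2 = z' div 2 \<and>
    (val z t < val' z' t' \<or> val z t = val' z' t' \<and> (z mod 2 < z' mod 2 \<or> z mod 2 = z' mod 2 \<and> t < t'))"
proof -
  note r = y_rem[of val, OF assms(1,2)] y_rem[of val', OF assms(3,4)]
  have "val z t * (2 * D) + (z mod 2 * D + t) < H" "val' z' t' * (2 * D) + (z' mod 2 * D + t') < H"
    using r by simp_all
  then have "slot_y D C val z t < slot_y D C val' z' t' \<longleftrightarrow> z div 2 < z' div 2 \<or> z div 2 = z' div 2 \<and>
      val z t * (2 * D) + (z mod 2 * D + t) < val' z' t' * (2 * D) + (z' mod 2 * D + t')"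
    unfolding slot_y_def by (rule lex_less_iff)
  then show ?thesis
    unfolding lex_less_iff[OF r(1,3), of "val z t" "val' z' t'"] lex_less_iff[OF assms(2,4), of "z mod 2" "z' mod 2"] .
qed

lemma Y_slot_beta:
  assumes "val z t < C" "t < D"
  shows "Y val (Slot z t) < Y val (Beta e) \<longleftrightarrow> z div 2 \<le> e" "Y val (Beta e) < Y val (Slot z t) \<longleftrightarrow> e < z div 2"
proof -
  have r: "val z t * (2 * D) + (z mod 2 * D + t) < H" "C * (2 * D) < H" using y_rem[of val, OF assms] by simp_all
  show "Y val (Slot z t) < Y val (Beta e) \<longleftrightarrow> z div 2 \<le> e"
    unfolding point_y.simps slot_y_def lex_less_iff[OF r] using y_rem(2)[of val, OF assms] by auto
  show "Y val (Beta e) < Y val (Slot z t) \<longleftrightarrow> e < z div 2"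
    unfolding point_y.simps slot_y_def lex_less_iff[OF r(2,1)] using y_rem(2)[of val, OF assms] by auto
qed

lemma Y_beta_beta: "Y val (Beta i) < Y val' (Beta j) \<longleftrightarrow> i < j"
  unfolding point_y.simps by (subst lex_less_iff) auto

lemma Y_beta_less: "i < E \<Longrightarrow> Y val (Beta i) < E * H"
  unfolding point_y.simps by (rule strip_bound) simp_all

lemma Y_slot_less: "val z t < C \<Longrightarrow> t < D \<Longrightarrow> z < 2 * E \<Longrightarrow> Y val (Slot z t) < E * H"
  unfolding point_y.simps slot_y_def by (rule strip_bound) (use y_rem[of val z t] in simp_all)

definition width where "width = n * W + L + E"

lemma finite_points: "finite (points n E D L ok)"
  unfolding points_def using finite_card_slots(1)[of E D ok] by simp

lemma points_cases:
  assumes "p \<in> points n E D L ok"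
  obtains z t where "p = Slot z t" "z < 2 * E" "t < D" "ok z t"
    | i where "p = Alpha i" "i < n" | e where "p = Beta e" "e < E" | k where "p = Gamma k" "k < L"
  using assms unfolding points_def by blast

lemma X_less_width:
  assumes "\<And>z t. ok z t \<Longrightarrow> vs (z div 2)" "p \<in> points n E D L ok"
  shows "X p < width"
  using assms(2)
proof (cases rule: points_cases)
  case (1 z t)
  then show ?thesis using X_slot_less[of z t] assms(1) by (simp add: width_def del: point_x.simps)
next
  case (2 i)
  then show ?thesis using X_alpha_less[of i] by (simp add: width_def del: point_x.simps)
qed (auto simp: width_def)

lemma inj_X:
  assumes "\<And>z t. ok z t \<Longrightarrow> vs (z div 2)"
  shows "inj_on X (points n E D L ok)"
proof (rule inj_onI)
  fix p q assume p: "p \<in> points n E D L ok" and q: "q \<in> points n E D L ok" and eq: "X p = X q"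
  have nl: "\<not> X p < X q" "\<not> X q < X p" using eq by simp_all
  have slot: False if "r \<in> points n E D L ok" "s \<in> points n E D L ok" "r = Slot z t" "s = Alpha i \<or> s = Beta i \<or> s = Gamma i"
    "\<not> X r < X s" "\<not> X s < X r" for r s z t i
  proof -
    have z: "z < 2 * E" "t < D" "vs (z div 2)" using that(1,3) assms by (auto simp: points_def)
    show False
      using that(4-6) X_slot_alpha[OF z(1,2), of i] X_slot_less[OF z] unfolding that(3) by auto
  qed
  have other: "p = q" if "p = Alpha i \<or> p = Beta i \<or> p = Gamma i" "q = Alpha j \<or> q = Beta j \<or> q = Gamma j" for i j
  proof -
    have "i < n" if "p = Alpha i" using p that by (auto simp: points_def)
    moreover have "j < n" if "q = Alpha j" using q that by (auto simp: points_def)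
    moreover have "i < L" if "p = Gamma i" using p that by (auto simp: points_def)
    moreover have "j < L" if "q = Gamma j" using q that by (auto simp: points_def)
    ultimately have "(p = Alpha i \<longrightarrow> X p < n * W) \<and> (q = Alpha j \<longrightarrow> X q < n * W) \<and>
        (p = Gamma i \<longrightarrow> i < L) \<and> (q = Gamma j \<longrightarrow> j < L)"
      using X_alpha_less[of i] X_alpha_less[of j] by (simp del: point_x.simps)
    then show ?thesis
      using that nl X_alpha_alpha[of i j] X_alpha_alpha[of j i] by (elim disjE) simp_all
  qed
  show "p = q"
  proof (cases p)
    case (Slot z t)
    show ?thesis
    proof (cases q)
      case q': (Slot z' t')
      have z: "z < 2 * E" "t < D" "vs (z div 2)" "z' < 2 * E" "t' < D" "vs (z' div 2)"
        using p q Slot q' assms by (auto simp: points_def)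
      have e: "xs z = xs z'" "t = t'" "xi z = xi z'"
        using nl unfolding Slot q' X_slot_slot[OF z(1,2,4,5)] X_slot_slot[OF z(4,5,1,2)] by auto
      \<comment> \<open>Equal \<open>xi\<close> means equal slots among the constraints. For
        synchronising slots it gives only the parity, and the strip index supplies the rest.\<close>
      have small: "z = 2 * xs z \<or> z = 2 * xs z + 1" if "z < 2 * n" for z
      proof -
        have "z = 2 * (z div 2) \<or> z = 2 * (z div 2) + 1" by presburger
        then show ?thesis using xs_sync[of "z div 2"] that by auto
      qed
      have "z = z'"
        using e(3) small[of z] small[of z'] z n_pos e(1) unfolding xi_def by (auto split: if_splits)
      then show ?thesis using Slot q' e by simp
    qed (use slot[OF p q Slot _ nl] in blast)+
  next
    case (Alpha i)
    then show ?thesis using slot[OF q p _ _ nl(2,1)] other by (cases q) blast+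
  next
    case (Beta i)
    then show ?thesis using slot[OF q p _ _ nl(2,1)] other by (cases q) blast+
  next
    case (Gamma i)
    then show ?thesis using slot[OF q p _ _ nl(2,1)] other by (cases q) blast+
  qed
qed

lemma inj_Y:
  assumes "\<And>z t. t < D \<Longrightarrow> ok z t \<Longrightarrow> val z t < C"
  shows "inj_on (Y val) (points n E D L ok)"
proof (rule inj_onI)
  fix p q assume p: "p \<in> points n E D L ok" and q: "q \<in> points n E D L ok" and eq: "Y val p = Y val q"
  have nl: "\<not> Y val p < Y val q" "\<not> Y val q < Y val p" using eq by simp_all
  have slot: False if "r \<in> points n E D L ok" "s \<in> points n E D L ok" "r = Slot z t" "s = Alpha i \<or> s = Beta i \<or> s = Gamma i"
    "\<not> Y val r < Y val s" "\<not> Y val s < Y val r" for r s z t i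
  proof -
    have z: "z < 2 * E" "t < D" "val z t < C" using that(1,3) assms by (auto simp: points_def)
    show False
      using that(4-6) Y_slot_beta[of val, OF z(3,2), of i] Y_slot_less[of val, OF z(3,2,1)] unfolding that(3) by auto
  qed
  have other: "p = q" if "p = Alpha i \<or> p = Beta i \<or> p = Gamma i" "q = Alpha j \<or> q = Beta j \<or> q = Gamma j" for i j
  proof -
    have "i < E" if "p = Beta i" using p that by (auto simp: points_def)
    moreover have "j < E" if "q = Beta j" using q that by (auto simp: points_def)
    moreover have "i < L" if "p = Gamma i" using p that by (auto simp: points_def)
    moreover have "j < L" if "q = Gamma j" using q that by (auto simp: points_def)
    ultimately have "(p = Beta i \<longrightarrow> Y val p < E * H) \<and> (q = Beta j \<longrightarrow> Y val q < E * H) \<and>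
        (p = Gamma i \<longrightarrow> i < L) \<and> (q = Gamma j \<longrightarrow> j < L)"
      using Y_beta_less[of i val] Y_beta_less[of j val] by (simp del: point_y.simps)
    then show ?thesis
      using that nl Y_beta_beta[of val i val j] Y_beta_beta[of val j val i] by (elim disjE) simp_all
  qed
  show "p = q"
  proof (cases p)
    case (Slot z t)
    show ?thesis
    proof (cases q)
      case q': (Slot z' t')
      have z: "t < D" "val z t < C" "t' < D" "val z' t' < C"
        using p q Slot q' assms by (auto simp: points_def)
      have e: "z div 2 = z' div 2" "z mod 2 = z' mod 2" "t = t'"
        using nl unfolding Slot q' point_y.simps Y_slot_slot[of val z t val z' t', OF z(2,1,4,3)] Y_slot_slot[of val z' t' val z t, OF z(4,3,2,1)] by auto
      have "z = z'" using e(1,2) by presburger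
      then show ?thesis using Slot q' e by simp
    qed (use slot[OF p q Slot _ nl] in blast)+
  next
    case (Alpha i)
    then show ?thesis using slot[OF q p _ _ nl(2,1)] other by (cases q) blast+
  next
    case (Beta i)
    then show ?thesis using slot[OF q p _ _ nl(2,1)] other by (cases q) blast+
  next
    case (Gamma i)
    then show ?thesis using slot[OF q p _ _ nl(2,1)] other by (cases q) blast+
  qed
qed

text \<open>The pattern has one copy of each slot, filed under the dummy tile 0 and, through
  \<open>zero_val\<close>, under the dummy value 0. It thus uses the same coordinate formulas as the
  text.\<close>

definition pattern_slot :: "nat \<Rightarrow> nat \<Rightarrow> bool" where
  "pattern_slot z t \<longleftrightarrow> vs (z div 2) \<and> t = 0"

definition text_slot :: "(nat \<Rightarrow> nat \<Rightarrow> bool) \<Rightarrow> nat \<Rightarrow> nat \<Rightarrow> bool" where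
  "text_slot al z t \<longleftrightarrow> vs (z div 2) \<and> al (xs z) t"

abbreviation "zero_val \<equiv> \<lambda>z t. 0 :: nat"

section \<open>Solutions of the constraints and embeddings of the pattern\<close>

context
  fixes val :: "nat \<Rightarrow> nat \<Rightarrow> nat" and al :: "nat \<Rightarrow> nat \<Rightarrow> bool"
  assumes val_less: "\<And>z t. t < D \<Longrightarrow> val z t < C"
    and val_sync: "\<And>e t. e < n \<Longrightarrow> val (2 * e) t = D - 1 - t \<and> val (2 * e + 1) t = D - 1 - t"
begin

abbreviation "P \<equiv> points n E D L pattern_slot"
abbreviation "T \<equiv> points n E D L (text_slot al)"

definition solution :: "(nat \<Rightarrow> nat) \<Rightarrow> bool" where
  "solution s \<longleftrightarrow> (\<forall>i<n. s i < D \<and> al i (s i)) \<and>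
     (\<forall>e. n \<le> e \<and> e < E \<and> vs e \<longrightarrow> val (2 * e) (s (xs (2 * e))) \<le> val (2 * e + 1) (s (xs (2 * e + 1))))"

definition embedding :: "(point \<Rightarrow> point) \<Rightarrow> bool" where
  "embedding f \<longleftrightarrow> f ` P \<subseteq> T \<and> (\<forall>p\<in>P. \<forall>q\<in>P. (X p < X q \<longrightarrow> X (f p) < X (f q)) \<and>
     (Y zero_val p < Y zero_val q \<longrightarrow> Y val (f p) < Y val (f q)))"

text \<open>Anchors stay fixed, and every slot goes to its copy for the tile of its variable. Slots
  of one variable receive the same tile, which preserves the horizontal order; in each horizontal
  strip the even slot receives at most the value of the odd one, which preserves the vertical
  order.\<close>

lemma embedding_of_solution:
  assumes "solution s"
  shows "\<exists>f. embedding f"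
proof -
  define f where "f p = (case p of Slot z t \<Rightarrow> Slot z (s (xs z)) | _ \<Rightarrow> p)" for p
  have f: "f (Slot z t) = Slot z (s (xs z))" "f (Alpha i) = Alpha i" "f (Beta i) = Beta i" "f (Gamma i) = Gamma i" for z t i
    by (simp_all add: f_def)
  have C: "0 < C" using D_pos D_le by simp
  have slot: "s (xs z) < D \<and> al (xs z) (s (xs z))" if "z < 2 * E" "vs (z div 2)" for z
    using xs_less[OF that] assms unfolding solution_def by blast
  have "f p \<in> T" if "p \<in> P" for p
    using that
  proof (cases rule: points_cases)
    case (1 z t)
    then show ?thesis using slot[of z] by (auto simp: f points_def pattern_slot_def text_slot_def)
  qed (auto simp: f points_def)
  moreover have "X (f p) < X (f q)" if p: "p \<in> P" and q: "q \<in> P" and less: "X p < X q" for p q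
    using p
  proof (cases rule: points_cases)
    case (1 z t)
    then have z: "z < 2 * E" "t < D" "t = 0" "vs (z div 2)" by (auto simp: pattern_slot_def)
    note s = slot[OF z(1,4), THEN conjunct1]
    show ?thesis using q
    proof (cases rule: points_cases)
      case (1 z' t')
      then have z': "z' < 2 * E" "t' < D" "t' = 0" "vs (z' div 2)" by (auto simp: pattern_slot_def)
      note s' = slot[OF z'(1,4), THEN conjunct1]
      show ?thesis
        using less z(3) z'(3) unfolding \<open>p = Slot z t\<close> \<open>q = Slot z' t'\<close> f X_slot_slot[OF z(1,2) z'(1,2)]
          X_slot_slot[OF z(1) s z'(1) s'] by auto
    next
      case (2 i)
      then show ?thesis using less unfolding \<open>p = Slot z t\<close> \<open>q = Alpha i\<close> f
        X_slot_alpha[OF z(1,2)] X_slot_alpha[OF z(1) s] by simp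
    next
      case (3 i)
      then show ?thesis using X_slot_less[OF z(1) s z(4)] unfolding \<open>p = Slot z t\<close> \<open>q = Beta i\<close> f by simp
    next
      case (4 i)
      then show ?thesis using X_slot_less[OF z(1) s z(4)] unfolding \<open>p = Slot z t\<close> \<open>q = Gamma i\<close> f by simp
    qed
  next
    case (2 i)
    show ?thesis using q
    proof (cases rule: points_cases)
      case (1 z t)
      then have z: "z < 2 * E" "t < D" "vs (z div 2)" by (auto simp: pattern_slot_def)
      note s = slot[OF z(1,3), THEN conjunct1]
      show ?thesis using less unfolding \<open>p = Alpha i\<close> \<open>q = Slot z t\<close> f
        X_slot_alpha[OF z(1,2)] X_slot_alpha[OF z(1) s] by simp
    qed (use less \<open>p = Alpha i\<close> f in auto)
  next
    case (3 i)
    show ?thesis using q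
    proof (cases rule: points_cases)
      case (1 z t)
      then have z: "z < 2 * E" "t < D" "vs (z div 2)" by (auto simp: pattern_slot_def)
      show ?thesis using less X_slot_less[OF z] unfolding \<open>p = Beta i\<close> \<open>q = Slot z t\<close> f by simp
    qed (use less \<open>p = Beta i\<close> f in auto)
  next
    case (4 i)
    show ?thesis using q
    proof (cases rule: points_cases)
      case (1 z t)
      then have z: "z < 2 * E" "t < D" "vs (z div 2)" by (auto simp: pattern_slot_def)
      show ?thesis using less X_slot_less[OF z] unfolding \<open>p = Gamma i\<close> \<open>q = Slot z t\<close> f by simp
    qed (use less \<open>p = Gamma i\<close> f in auto)
  qed
  moreover have "Y val (f p) < Y val (f q)" if p: "p \<in> P" and q: "q \<in> P" and less: "Y zero_val p < Y zero_val q" for p q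
    using p
  proof (cases rule: points_cases)
    case (1 z t)
    then have z: "z < 2 * E" "t < D" "t = 0" "vs (z div 2)" by (auto simp: pattern_slot_def)
    note s = slot[OF z(1,4), THEN conjunct1]
    show ?thesis using q
    proof (cases rule: points_cases)
      case (1 z' t')
      then have z': "z' < 2 * E" "t' < D" "t' = 0" "vs (z' div 2)" by (auto simp: pattern_slot_def)
      note s' = slot[OF z'(1,4), THEN conjunct1]
      have "z div 2 < z' div 2 \<or> z div 2 = z' div 2 \<and> z mod 2 < z' mod 2"
        using less z(3) z'(3) Y_slot_slot[of zero_val z t zero_val z' t', OF C z(2) C z'(2)]
        unfolding \<open>p = Slot z t\<close> \<open>q = Slot z' t'\<close> by simp
      moreover have "val z (s (xs z)) \<le> val z' (s (xs z'))" if e: "z div 2 = z' div 2" "z mod 2 < z' mod 2"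
      proof -
        define e where "e = z div 2"
        have "z mod 2 = 0" "z' mod 2 = 1" using e(2) mod_less_divisor[of 2 z'] by linarith+
        then have *: "z = 2 * e" "z' = 2 * e + 1" "e < E"
          using div_mult_mod_eq[of z 2] div_mult_mod_eq[of z' 2] e(1) z(1) unfolding e_def by linarith+
        show ?thesis
        \<comment> \<open>In a synchronising strip both slots belong to variable \<open>e\<close>
          and have equal values; in the other strips the inequality is the constraint
          itself.\<close>
        proof (cases "e < n")
          case True
          then show ?thesis using val_sync[OF True] xs_sync[OF True] * by simp
        next
          case False
          then show ?thesis using assms z(4) * unfolding solution_def e_def[symmetric] by simp
        qed
      qed
      ultimately show ?thesis
        using Y_slot_slot[of val z "s (xs z)" val z' "s (xs z')", OF val_less[OF s] s val_less[OF s'] s']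
        unfolding \<open>p = Slot z t\<close> \<open>q = Slot z' t'\<close> f by auto
    next
      case (2 i)
      then show ?thesis using Y_slot_less[of val, OF val_less[OF s] s z(1)]
        unfolding \<open>p = Slot z t\<close> \<open>q = Alpha i\<close> f by simp
    next
      case (3 i)
      then show ?thesis using less Y_slot_beta[of zero_val z t, OF C z(2)] Y_slot_beta[of val z "s (xs z)", OF val_less[OF s] s]
        unfolding \<open>p = Slot z t\<close> \<open>q = Beta i\<close> f by simp
    next
      case (4 i)
      then show ?thesis using Y_slot_less[of val, OF val_less[OF s] s z(1)]
        unfolding \<open>p = Slot z t\<close> \<open>q = Gamma i\<close> f by simp
    qed
  next
    case (2 i)
    show ?thesis using q
    proof (cases rule: points_cases)
      case (1 z t)
      show ?thesis using less Y_slot_less[of zero_val z t, OF C 1(3,2)] unfolding \<open>p = Alpha i\<close> \<open>q = Slot z t\<close> f by simp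
    qed (use less \<open>p = Alpha i\<close> f in auto)
  next
    case (3 i)
    show ?thesis using q
    proof (cases rule: points_cases)
      case (1 z t)
      then have z: "z < 2 * E" "t < D" "vs (z div 2)" by (auto simp: pattern_slot_def)
      note s = slot[OF z(1,3), THEN conjunct1]
      show ?thesis using less Y_slot_beta[of zero_val z t, OF C z(2)] Y_slot_beta[of val z "s (xs z)", OF val_less[OF s] s]
        unfolding \<open>p = Beta i\<close> \<open>q = Slot z t\<close> f by simp
    qed (use less \<open>p = Beta i\<close> f in auto)
  next
    case (4 i)
    show ?thesis using q
    proof (cases rule: points_cases)
      case (1 z t)
      show ?thesis using less Y_slot_less[of zero_val z t, OF C 1(3,2)] unfolding \<open>p = Gamma i\<close> \<open>q = Slot z t\<close> f by simp
    qed (use less \<open>p = Gamma i\<close> f in auto)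
  qed
  ultimately have "embedding f" unfolding embedding_def by (intro conjI ballI impI image_subsetI)
  then show ?thesis by (intro exI)
qed

lemma solution_of_embedding:
  assumes "embedding f"
  shows "\<exists>s. solution s"
proof -
  have fT: "f p \<in> T" if "p \<in> P" for p using assms that unfolding embedding_def by blast
  have fX: "X (f p) < X (f q)" if "p \<in> P" "q \<in> P" "X p < X q" for p q
    using assms that unfolding embedding_def by blast
  have fY: "Y val (f p) < Y val (f q)" if "p \<in> P" "q \<in> P" "Y zero_val p < Y zero_val q" for p q
    using assms that unfolding embedding_def by blast
  have C: "0 < C" using D_pos D_le by simp
  have alphaP: "Alpha i \<in> P" if "i < n" for i using that by (auto simp: points_def)
  have betaP: "Beta i \<in> P" if "i < E" for i using that by (auto simp: points_def)
  have gammaP: "Gamma i \<in> P" if "i < L" for i using that by (auto simp: points_def)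
  have slotP: "Slot z 0 \<in> P" if "z < 2 * E" "vs (z div 2)" for z
    using that D_pos by (auto simp: points_def pattern_slot_def)
  have slotT: "z < 2 * E \<and> t < D \<and> vs (z div 2) \<and> al (xs z) t" if "Slot z t \<in> T" for z t
    using that by (auto simp: points_def text_slot_def)
  have inj: "inj_on f P"
  proof (rule inj_onI)
    fix p q assume "p \<in> P" "q \<in> P" "f p = f q"
    then have "X p = X q" using fX[of p q] fX[of q p] by (cases "X p" "X q" rule: linorder_cases) auto
    then show "p = q"
      using inj_onD[OF inj_X[of pattern_slot]] \<open>p \<in> P\<close> \<open>q \<in> P\<close> by (auto simp: pattern_slot_def)
  qed
  \<comment> \<open>By \<open>L_gt\<close> there are more \<open>Gamma\<close> points than other
    points in the text, and \<open>f\<close> is injective.\<close>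
  have "\<exists>k<L. \<exists>l<L. f (Gamma k) = Gamma l"
  proof (rule ccontr)
    assume *: "\<not> ?thesis"
    let ?S = "{Slot z t | z t. z < 2 * E \<and> t < D \<and> text_slot al z t}"
    let ?R = "?S \<union> (Alpha ` {..<n} \<union> Beta ` {..<E})"
    have sub: "f ` Gamma ` {..<L} \<subseteq> ?R"
    proof (rule image_subsetI)
      fix p assume "p \<in> Gamma ` {..<L}"
      then obtain k where p: "p = Gamma k" and "k \<in> {..<L}" by blast
      then have "f (Gamma k) \<in> T" using fT gammaP by simp
      moreover have "f (Gamma k) \<notin> Gamma ` {..<L}" using * \<open>k \<in> {..<L}\<close> by blast
      ultimately show "f p \<in> ?R" by (simp add: p points_def Un_assoc)
    qed
    have "inj_on f (Gamma ` {..<L})" using inj by (rule inj_on_subset) (use gammaP in auto)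
    then have "card (f ` Gamma ` {..<L}) = card (Gamma ` {..<L})" by (rule card_image)
    also have "\<dots> = L" by (subst card_image) (auto simp: inj_on_def)
    finally have "L \<le> card ?R" using card_mono[OF _ sub] finite_card_slots(1)[of E D "text_slot al"] by simp
    also have "\<dots> \<le> card ?S + card (Alpha ` {..<n} \<union> Beta ` {..<E})" by (rule card_Un_le)
    also have "\<dots> \<le> 2 * E * D + (card (Alpha ` {..<n}) + card (Beta ` {..<E}))"
      by (intro add_mono finite_card_slots(2) card_Un_le)
    also have "\<dots> \<le> 2 * E * D + (n + E)"
      using card_image_le[of "{..<n}" Alpha] card_image_le[of "{..<E}" Beta] by simp
    finally show False using L_gt by simp
  qed
  then obtain k l where k: "k < L" "l < L" "f (Gamma k) = Gamma l" by blast
  \<comment> \<open>\<open>Alpha i\<close> is to the upper left of \<open>Gamma k\<close>. To the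
    upper left of \<open>Gamma l\<close> the text has only \<open>Alpha\<close> points, since slots
    and \<open>Beta\<close> points are lower and the \<open>Gamma\<close> points increase.\<close>
  have "\<exists>j<n. f (Alpha i) = Alpha j" if i: "i < n" for i
  proof -
    have "X (Alpha i) < X (Gamma k)" using X_alpha_less[OF i] by simp
    then have 1: "X (f (Alpha i)) < X (Gamma l)" using fX[OF alphaP[OF i] gammaP[OF k(1)]] k(3) by simp
    have "Y zero_val (Gamma k) < Y zero_val (Alpha i)" using k(1) by simp
    then have 2: "Y val (Gamma l) < Y val (f (Alpha i))" using fY[OF gammaP[OF k(1)] alphaP[OF i]] k(3) by simp
    from fT[OF alphaP[OF i]] show ?thesis
    proof (cases rule: points_cases)
      case (1 z t)
      then show ?thesis using 2 Y_slot_less[of val z t, OF val_less] by simp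
    next
      case (3 e)
      then show ?thesis using 2 Y_beta_less[of e val] by simp
    next
      case (4 k')
      then show ?thesis using \<open>X (f (Alpha i)) < X (Gamma l)\<close> 2 by simp
    qed blast
  qed
  then obtain h where h: "\<And>i. i < n \<Longrightarrow> h i < n \<and> f (Alpha i) = Alpha (h i)" by metis
  have "h i = i" if "i < n" for i
  proof (rule strict_mono_below_id[OF _ _ that])
    fix i j assume "i < j" "j < n"
    then show "h i < h j"
      using fX[OF alphaP alphaP, of i j] h[of i] h[of j] X_alpha_alpha by (simp del: point_x.simps)
  qed (use h in blast)
  then have fA: "f (Alpha i) = Alpha i" if "i < n" for i using h that by simp
  \<comment> \<open>Symmetrically, to the lower right of \<open>Gamma l\<close> there are only
    \<open>Beta\<close> points, since slots and \<open>Alpha\<close> points are further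
    left.\<close>
  have "\<exists>j<E. f (Beta i) = Beta j" if i: "i < E" for i
  proof -
    have "X (Gamma k) < X (Beta i)" using k(1) by simp
    then have 1: "X (Gamma l) < X (f (Beta i))" using fX[OF gammaP[OF k(1)] betaP[OF i]] k(3) by simp
    have "Y zero_val (Beta i) < Y zero_val (Gamma k)" using Y_beta_less[OF i] by simp
    then have 2: "Y val (f (Beta i)) < Y val (Gamma l)" using fY[OF betaP[OF i] gammaP[OF k(1)]] k(3) by simp
    from fT[OF betaP[OF i]] show ?thesis
    proof (cases rule: points_cases)
      case (1 z t)
      then show ?thesis using \<open>X (Gamma l) < X (f (Beta i))\<close> X_slot_less[of z t] by (simp add: text_slot_def)
    next
      case (2 e)
      then show ?thesis using \<open>X (Gamma l) < X (f (Beta i))\<close> X_alpha_less[of e] by simp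
    next
      case (4 k')
      then show ?thesis using \<open>X (Gamma l) < X (f (Beta i))\<close> 2 by simp
    qed blast
  qed
  then obtain g where g: "\<And>i. i < E \<Longrightarrow> g i < E \<and> f (Beta i) = Beta (g i)" by metis
  have "g i = i" if "i < E" for i
  proof (rule strict_mono_below_id[OF _ _ that])
    fix i j assume "i < j" "j < E"
    then show "g i < g j"
      using fY[OF betaP betaP, of i j] g[of i] g[of j] Y_beta_beta by (simp del: point_y.simps)
  qed (use g in blast)
  then have fB: "f (Beta i) = Beta i" if "i < E" for i using g that by simp
  \<comment> \<open>The fixed separators confine the image of a slot to its own horizontal and
    vertical strip. Its parity and its tile remain open.\<close>
  have slot: "\<exists>z' t. f (Slot z 0) = Slot z' t \<and> z' < 2 * E \<and> t < D \<and> vs (z' div 2) \<and> al (xs z') t \<and> z' div 2 = z div 2 \<and> xs z' = xs z"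
    if z: "z < 2 * E" "vs (z div 2)" for z
  proof -
    have xn: "xs z < n" using xs_less z by blast
    have e: "z div 2 < E" using z by simp
    let ?p = "f (Slot z 0)"
    have x1: "X ?p < X (Alpha (xs z))"
      using fX[OF slotP[OF z] alphaP[OF xn]] X_slot_alpha[OF z(1) D_pos] fA[OF xn] by simp
    have y1: "Y val ?p < Y val (Beta (z div 2))"
      using fY[OF slotP[OF z] betaP[OF e]] Y_slot_beta[of zero_val z 0, OF C D_pos] fB[OF e] by simp
    have x2: "X (Alpha i) < X ?p" if "i < xs z" for i
      using fX[OF alphaP slotP[OF z], of i] X_slot_alpha[OF z(1) D_pos] fA[of i] that xn by simp
    have y2: "Y val (Beta i) < Y val ?p" if "i < z div 2" for i
      using fY[OF betaP slotP[OF z], of i] Y_slot_beta[of zero_val z 0, OF C D_pos] fB[of i] that e by simp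
    from fT[OF slotP[OF z]] show ?thesis
    proof (cases rule: points_cases)
      case (1 z' t)
      then have z': "z' < 2 * E" "t < D" "vs (z' div 2)" "al (xs z') t" by (auto simp: text_slot_def)
      have "xs z' \<le> xs z" using x1 X_slot_alpha(1)[OF z'(1,2)] 1(1) by simp
      moreover have "i < xs z'" if "i < xs z" for i using x2[OF that] X_slot_alpha(2)[OF z'(1,2)] 1(1) by simp
      ultimately have xs: "xs z' = xs z" by (meson le_antisym leI less_irrefl)
      have "z' div 2 \<le> z div 2" using y1 Y_slot_beta(1)[of val z' t, OF val_less[OF z'(2)] z'(2)] 1(1) by simp
      moreover have "i < z' div 2" if "i < z div 2" for i
        using y2[OF that] Y_slot_beta(2)[of val z' t, OF val_less[OF z'(2)] z'(2)] 1(1) by simp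
      ultimately have "z' div 2 = z div 2" by (meson le_antisym leI less_irrefl)
      then show ?thesis using 1(1) xs z' by blast
    next
      case (2 i)
      then show ?thesis using y1 Y_beta_less[OF e] by simp
    next
      case (3 i)
      then show ?thesis using x1 X_alpha_less[OF xn] by simp
    next
      case (4 i)
      then show ?thesis using x1 X_alpha_less[OF xn] by simp
    qed
  qed
  \<comment> \<open>In the pattern, slot \<open>2 * e\<close> is to the left of and below slot
    \<open>2 * e + 1\<close>. The horizontal order gives \<open>t1 \<le> t2\<close>, the decreasing
    values \<open>D - 1 - t\<close> give \<open>t2 \<le> t1\<close>, and for equal tiles the
    tie-break \<open>xi\<close> determines the parities as well.\<close>
  have "\<exists>t. f (Slot (2 * e) 0) = Slot (2 * e) t \<and> f (Slot (2 * e + 1) 0) = Slot (2 * e + 1) t \<and> t < D \<and> al e t"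
    if e: "e < n" for e
  proof -
    have z: "2 * e < 2 * E" "vs (2 * e div 2)" "2 * e + 1 < 2 * E" "vs ((2 * e + 1) div 2)"
      using e n_le vs_sync[OF e] by simp_all
    have d: "2 * e div 2 = e" "(2 * e + 1) div 2 = e" by simp_all
    obtain z1 t1 where "f (Slot (2 * e) 0) = Slot z1 t1" "z1 < 2 * E" "t1 < D" "al (xs z1) t1"
        "z1 div 2 = 2 * e div 2" "xs z1 = xs (2 * e)"
      using slot[OF z(1,2)] by blast
    note 1 = this(1-4) this(5)[unfolded d] this(6)[unfolded xs_sync[OF e, THEN conjunct1]]
    obtain z2 t2 where "f (Slot (2 * e + 1) 0) = Slot z2 t2" "z2 < 2 * E" "t2 < D"
        "z2 div 2 = (2 * e + 1) div 2" "xs z2 = xs (2 * e + 1)"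
      using slot[OF z(3,4)] by blast
    note 2 = this(1-3) this(4)[unfolded d] this(5)[unfolded xs_sync[OF e, THEN conjunct2]]
    have "xi (2 * e) < xi (2 * e + 1)" using e n_le by (simp add: xi_def)
    then have "X (Slot (2 * e) 0) < X (Slot (2 * e + 1) 0)"
      using X_slot_slot[OF z(1) D_pos z(3) D_pos] xs_sync[OF e] by simp
    from fX[OF slotP[OF z(1,2)] slotP[OF z(3,4)] this]
    have a: "t1 < t2 \<or> t1 = t2 \<and> xi z1 < xi z2"
      using X_slot_slot[OF 1(2,3) 2(2,3)] 1(1,6) 2(1,5) by simp
    have "Y zero_val (Slot (2 * e) 0) < Y zero_val (Slot (2 * e + 1) 0)"
      using Y_slot_slot[of zero_val "2 * e" 0 zero_val "2 * e + 1" 0, OF C D_pos C D_pos] by simp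
    from fY[OF slotP[OF z(1,2)] slotP[OF z(3,4)] this]
    have b: "val z1 t1 \<le> val z2 t2"
      using Y_slot_slot[of val z1 t1 val z2 t2, OF val_less[OF 1(3)] 1(3) val_less[OF 2(3)] 2(3)] 1(1,5) 2(1,4) by auto
    have zz: "z1 = 2 * e \<or> z1 = 2 * e + 1" "z2 = 2 * e \<or> z2 = 2 * e + 1" using 1(5) 2(4) by presburger+
    then have "val z1 t1 = D - 1 - t1" "val z2 t2 = D - 1 - t2" using val_sync[OF e] by auto
    then have "t2 \<le> t1" using b 1(3) 2(3) by simp
    then have "t1 = t2" "xi z1 < xi z2" using a by auto
    moreover have "z1 = 2 * e" "z2 = 2 * e + 1"
      using zz \<open>xi z1 < xi z2\<close> e by (auto simp: xi_def)
    ultimately show ?thesis using 1 2 by auto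
  qed
  then obtain s where s: "\<And>e. e < n \<Longrightarrow> f (Slot (2 * e) 0) = Slot (2 * e) (s e) \<and>
      f (Slot (2 * e + 1) 0) = Slot (2 * e + 1) (s e) \<and> s e < D \<and> al e (s e)" by metis
  \<comment> \<open>By \<open>xs_diff\<close> the two slots of a constraint lie in different
    vertical strips, which determines the parity. The pattern then has the slot between the two
    synchronising slots of its variable, and both of these have the same tile.\<close>
  have con: "f (Slot z 0) = Slot z (s (xs z))" if z: "z < 2 * E" "vs (z div 2)" "n \<le> z div 2" for z
  proof -
    obtain z' t where 1: "f (Slot z 0) = Slot z' t" "z' < 2 * E" "t < D" "z' div 2 = z div 2" "xs z' = xs z"
      using slot[OF z(1,2)] by blast
    define e where "e = z div 2"
    have "xs (2 * e) \<noteq> xs (2 * e + 1)" using xs_diff[of e] z by (simp add: e_def)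
    moreover have "z = 2 * e \<or> z = 2 * e + 1" "z' = 2 * e \<or> z' = 2 * e + 1" using 1(4) unfolding e_def by presburger+
    ultimately have zz: "z' = z" using 1(5) by auto
    let ?v = "xs z"
    have v: "?v < n" using xs_less z by blast
    have w: "2 * ?v < 2 * E" "vs (2 * ?v div 2)" "2 * ?v + 1 < 2 * E" "vs ((2 * ?v + 1) div 2)"
      using v n_le vs_sync[OF v] by simp_all
    have xiz: "0 < xi z" "xi z < 2 * E" "\<not> z < 2 * n" using z n_pos by (auto simp: xi_def)
    have xiv: "xi (2 * ?v) = 0" "xi (2 * ?v + 1) = 2 * E" using v by (simp_all add: xi_def)
    have "X (Slot (2 * ?v) 0) < X (Slot z 0)"
      using X_slot_slot[OF w(1) D_pos z(1) D_pos] xs_sync[OF v] xiz xiv by simp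
    from fX[OF slotP[OF w(1,2)] slotP[OF z(1,2)] this] have "s ?v \<le> t"
      using X_slot_slot[OF w(1) _ z(1) 1(3), of "s ?v"] s[OF v] 1(1) zz xs_sync[OF v] by auto
    moreover have "X (Slot z 0) < X (Slot (2 * ?v + 1) 0)"
      using X_slot_slot[OF z(1) D_pos w(3) D_pos] xs_sync[OF v] xiz xiv by simp
    from fX[OF slotP[OF z(1,2)] slotP[OF w(3,4)] this] have "t \<le> s ?v"
      using X_slot_slot[OF z(1) 1(3) w(3), of "s ?v"] s[OF v] 1(1) zz xs_sync[OF v] by auto
    ultimately show ?thesis using 1(1) zz by simp
  qed
  have "val (2 * e) (s (xs (2 * e))) \<le> val (2 * e + 1) (s (xs (2 * e + 1)))" if e: "n \<le> e" "e < E" "vs e" for e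
  proof -
    have z: "2 * e < 2 * E" "vs (2 * e div 2)" "2 * e + 1 < 2 * E" "vs ((2 * e + 1) div 2)" using e by simp_all
    have sD: "s (xs (2 * e)) < D" "s (xs (2 * e + 1)) < D" using s xs_less z by blast+
    have "Y zero_val (Slot (2 * e) 0) < Y zero_val (Slot (2 * e + 1) 0)"
      using Y_slot_slot[of zero_val "2 * e" 0 zero_val "2 * e + 1" 0, OF C D_pos C D_pos] by simp
    from fY[OF slotP[OF z(1,2)] slotP[OF z(3,4)] this]
    show ?thesis
      using con[OF z(1,2)] con[OF z(3,4)] e
        Y_slot_slot[of val "2 * e" "s (xs (2 * e))" val "2 * e + 1" "s (xs (2 * e + 1))", OF val_less[OF sD(1)] sD(1) val_less[OF sD(2)] sD(2)]
      by auto
  qed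
  then have "solution s" unfolding solution_def using s by blast
  then show ?thesis by blast
qed

end

end

section \<open>Encodings of point sets are computable\<close>

text \<open>A program cannot reread its output, but doubling commutes with concatenation and so can
  be pushed down to the single emitted bits.\<close>

lemma GEN_double: "GEN G \<Longrightarrow> GEN (\<lambda>x \<sigma>. concat (map (\<lambda>b. [True, b]) (G x \<sigma>)))"
proof (induction rule: GEN.induct)
  case (emit A)
  show ?case using GEN.app[OF GEN_emit[OF DEFP_const[of True]] GEN.emit[OF emit]] by simp
next
  case (app F G)
  show ?case using GEN.app[OF app.IH] by simp
next
  case ("for" A G)
  have "concat (map (\<lambda>b. [True, b]) (concat (map f xs))) = concat (map (\<lambda>i. concat (map (\<lambda>b. [True, b]) (f i))) xs)"
    for f :: "nat \<Rightarrow> bool list" and xs by (induction xs) auto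
  then show ?case using GEN.for[OF "for.hyps"(1) "for.IH"] by simp
qed

lemma GEN_pair_word: assumes "GEN F" "GEN G" shows "GEN (\<lambda>x \<sigma>. pair_word (F x \<sigma>) (G x \<sigma>))"
  unfolding pair_word_def by (rule GEN.app GEN_double GEN_emit[OF DEFP_const] assms)+

text \<open>Runs through all numbers below a bound and skips those that are not vertices. As the
  vertices are natural numbers, this lists them in their order.\<close>

definition list_graph :: "nat \<Rightarrow> (nat \<Rightarrow> bool) \<Rightarrow> (nat \<Rightarrow> nat \<Rightarrow> bool) \<Rightarrow> bool list" where
  "list_graph B V A = concat (map (\<lambda>u. if V u then [True] else []) [0..<B]) @ [False] @
     concat (map (\<lambda>u. if V u then concat (map (\<lambda>v. if V v then [A u v] else []) [0..<B]) else []) [0..<B])"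

lemma encode_graph_list_graph:
  fixes G :: "nat ordered_graph"
  assumes "verts G \<subseteq> {..<B}"
    "\<And>u. u < B \<Longrightarrow> V u \<longleftrightarrow> u \<in> verts G" "\<And>u v. u < B \<Longrightarrow> v < B \<Longrightarrow> A u v \<longleftrightarrow> {u, v} \<in> edges G"
  shows "encode_graph G = list_graph B V A"
proof -
  have fin: "finite (verts G)" using assms(1) finite_subset by blast
  have vl: "vertex_list G = filter V [0..<B]"
    unfolding vertex_list_def
    by (rule sorted_distinct_set_unique) (use assms(1,2) fin in \<open>auto intro: sorted_wrt_filter\<close>)
  have card: "card (verts G) = length (vertex_list G)" unfolding vertex_list_def using fin by simp
  have 1: "replicate (length (filter P xs)) True = concat (map (\<lambda>u. if P u then [True] else []) xs)"
    for P and xs :: "nat list" by (induction xs) auto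
  have 2: "map f (filter P xs) = concat (map (\<lambda>v. if P v then [f v] else []) xs)"
    for P and xs :: "nat list" and f :: "nat \<Rightarrow> bool" by (induction xs) auto
  have 3: "concat (map f (filter P xs)) = concat (map (\<lambda>v. if P v then f v else []) xs)"
    for P and xs :: "nat list" and f :: "nat \<Rightarrow> bool list" by (induction xs) auto
  have "[{u, v} \<in> edges G. u \<leftarrow> vertex_list G, v \<leftarrow> vertex_list G] = [A u v. u \<leftarrow> vertex_list G, v \<leftarrow> vertex_list G]"
    unfolding vl using assms(3) by (intro arg_cong[of _ _ concat] map_cong) auto
  then show ?thesis
    unfolding encode_graph_def list_graph_def card by (simp only: vl 1 2 3)
qed

lemma GEN_list_graph:
  assumes "DEF (\<lambda>x \<sigma>. B x)" "DEFP (\<lambda>x \<sigma>. V x (\<sigma> 0))" "DEFP (\<lambda>x \<sigma>. A x (\<sigma> 0) (\<sigma> 1))"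
  shows "GEN (\<lambda>x \<sigma>. list_graph (B x) (V x) (A x))"
proof -
  have 1: "GEN (\<lambda>x \<sigma>. concat (map (\<lambda>u. if V x u then [True] else []) [0..<B x]))"
    by (intro GEN_for[OF assms(1)] GEN_if GEN_emit DEFP_const assms(2))
  have "GEN (\<lambda>x \<sigma>. concat (map (\<lambda>v. if V x v then [A x (\<sigma> 0) v] else []) [0..<B x]))"
    by (intro GEN_for[OF assms(1)] GEN_if GEN_emit assms(2) DEFP_comp2[of A, OF assms(3)] DEF.var)
  from GEN_if[OF assms(2) this]
  have 2: "GEN (\<lambda>x \<sigma>. concat (map (\<lambda>u. if V x u then concat (map (\<lambda>v. if V x v then [A x u v] else []) [0..<B x]) else []) [0..<B x]))"
    by (rule GEN_for[OF assms(1), where G = "\<lambda>x u \<sigma>. if V x u then concat (map (\<lambda>v. if V x v then [A x u v] else []) [0..<B x]) else []"])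
  show ?thesis
    unfolding list_graph_def by (rule GEN.app[OF 1 GEN.app[OF GEN_emit[OF DEFP_const[of False]] 2]])
qed

text \<open>The point set with its coordinates, eliminated in favour of bounded quantifiers and
  arithmetic so that definability can be read off.\<close>

definition point_rel ::
  "nat \<Rightarrow> nat \<Rightarrow> nat \<Rightarrow> nat \<Rightarrow> nat \<Rightarrow> (nat \<Rightarrow> nat) \<Rightarrow> (nat \<Rightarrow> nat \<Rightarrow> nat) \<Rightarrow> (nat \<Rightarrow> nat \<Rightarrow> bool) \<Rightarrow> nat \<Rightarrow> nat \<Rightarrow> bool" where
  "point_rel n E D C L xs val ok u v \<longleftrightarrow>
     (\<exists>z<2 * E. \<exists>t<D. ok z t \<and> u = slot_x n E D xs z t \<and> v = slot_y D C val z t) \<or>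
     (\<exists>i<n. u = i * (D * (2 * E + 1) + 1) + D * (2 * E + 1) \<and> v = E * (C * (2 * D) + 1) + L + i) \<or>
     (\<exists>i<E. u = n * (D * (2 * E + 1) + 1) + L + i \<and> v = i * (C * (2 * D) + 1) + C * (2 * D)) \<or>
     (\<exists>i<L. u = n * (D * (2 * E + 1) + 1) + i \<and> v = E * (C * (2 * D) + 1) + i)"

lemma point_rel_iff:
  "point_rel n E D C L xs val ok u v \<longleftrightarrow>
    (\<exists>p\<in>points n E D L ok. u = point_x n E D L xs p \<and> v = point_y E D C L val p)"
proof
  assume "point_rel n E D C L xs val ok u v"
  then consider z t where "z < 2 * E" "t < D" "ok z t" "u = slot_x n E D xs z t" "v = slot_y D C val z t"
    | i where "i < n" "u = i * (D * (2 * E + 1) + 1) + D * (2 * E + 1)" "v = E * (C * (2 * D) + 1) + L + i"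
    | i where "i < E" "u = n * (D * (2 * E + 1) + 1) + L + i" "v = i * (C * (2 * D) + 1) + C * (2 * D)"
    | i where "i < L" "u = n * (D * (2 * E + 1) + 1) + i" "v = E * (C * (2 * D) + 1) + i"
    unfolding point_rel_def by (elim disjE exE conjE) blast+
  then show "\<exists>p\<in>points n E D L ok. u = point_x n E D L xs p \<and> v = point_y E D C L val p"
  proof cases
    case (1 z t)
    then show ?thesis by (intro bexI[of _ "Slot z t"]) (simp_all add: points_def)
  next
    case (2 i)
    then show ?thesis by (intro bexI[of _ "Alpha i"]) (simp_all add: points_def)
  next
    case (3 i)
    then show ?thesis by (intro bexI[of _ "Beta i"]) (simp_all add: points_def)
  next
    case (4 i)
    then show ?thesis by (intro bexI[of _ "Gamma i"]) (simp_all add: points_def)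
  qed
next
  assume "\<exists>p\<in>points n E D L ok. u = point_x n E D L xs p \<and> v = point_y E D C L val p"
  then obtain p where p: "p \<in> points n E D L ok" "u = point_x n E D L xs p" "v = point_y E D C L val p" by blast
  show "point_rel n E D C L xs val ok u v"
    unfolding point_rel_def using p by (cases p) (auto simp: points_def simp del: mult_Suc_right)
qed

definition point_width where "point_width n E D L = n * (D * (2 * E + 1) + 1) + L + E"
definition point_bound where "point_bound n E D C L = point_width n E D L + E * (C * (2 * D) + 1) + L + n"

definition point_edge where
  "point_edge n E D C L xs val ok u v \<longleftrightarrow> point_width n E D L \<le> v \<and>
     point_rel n E D C L xs val ok u (v - point_width n E D L)"

definition point_adj where
  "point_adj n E D C L xs val ok u v \<longleftrightarrow> point_edge n E D C L xs val ok u v \<or> point_edge n E D C L xs val ok v u"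

text \<open>Every vertex of a matching has a neighbour, so the vertices are recognised from
  adjacency alone.\<close>

definition point_vert where
  "point_vert n E D C L xs val ok u \<longleftrightarrow> (\<exists>v<point_bound n E D C L. point_adj n E D C L xs val ok u v)"

definition point_graph where
  "point_graph n E D C L xs val ok =
     graph_of (point_width n E D L) (points n E D L ok) (point_x n E D L xs) (point_y E D C L val)"

lemma point_adj_iff: "point_adj n E D C L xs val ok u v \<longleftrightarrow> {u, v} \<in> edges (point_graph n E D C L xs val ok)"
proof -
  have "point_edge n E D C L xs val ok u v \<longleftrightarrow>
      (\<exists>p\<in>points n E D L ok. u = point_x n E D L xs p \<and> v = point_width n E D L + point_y E D C L val p)" for u v
    unfolding point_edge_def point_rel_iff by (auto simp: le_iff_add simp del: point_x.simps point_y.simps)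
  then show ?thesis
    unfolding point_adj_def point_graph_def graph_of_def
    by (auto simp: image_iff doubleton_eq_iff simp del: point_x.simps point_y.simps)
qed

definition point_encoding where
  "point_encoding n E D C L xs val ok =
     list_graph (point_bound n E D C L) (point_vert n E D C L xs val ok) (point_adj n E D C L xs val ok)"

context strips
begin

lemma width_eq: "point_width n E D L = width"
  unfolding point_width_def width_def ..

lemma Y_less_bound:
  assumes "\<And>z t. t < D \<Longrightarrow> ok z t \<Longrightarrow> val z t < C" "p \<in> points n E D L ok"
  shows "Y val p < E * H + L + n"
  using assms(2)
proof (cases rule: points_cases)
  case (1 z t)
  then show ?thesis using Y_slot_less[of val z t] assms(1) by (simp del: point_y.simps)
next
  case (3 e)
  then show ?thesis using Y_beta_less[of e val] by (simp del: point_y.simps)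
qed simp_all

lemma encode_point_graph:
  assumes "\<And>z t. ok z t \<Longrightarrow> vs (z div 2)" "\<And>z t. t < D \<Longrightarrow> ok z t \<Longrightarrow> val z t < C"
  shows "encode_graph (point_graph n E D C L xs val ok) = point_encoding n E D C L xs val ok"
  unfolding point_encoding_def
proof (rule encode_graph_list_graph)
  let ?G = "point_graph n E D C L xs val ok" and ?B = "point_bound n E D C L"
  have b: "X p < ?B \<and> point_width n E D L + Y val p < ?B" if "p \<in> points n E D L ok" for p
  proof -
    have "X p < width" using assms(1) that by (rule X_less_width)
    moreover have "Y val p < E * H + L + n" by (rule Y_less_bound[OF _ that]) (rule assms(2))
    ultimately show ?thesis unfolding point_bound_def width_eq by (simp del: point_x.simps point_y.simps)
  qed
  then show sub: "verts ?G \<subseteq> {..<?B}"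
    unfolding point_graph_def graph_of_def by (auto simp del: point_x.simps point_y.simps)
  show "point_adj n E D C L xs val ok u v \<longleftrightarrow> {u, v} \<in> edges ?G" for u v by (rule point_adj_iff)
  show "point_vert n E D C L xs val ok u \<longleftrightarrow> u \<in> verts ?G" for u
  proof
    assume "point_vert n E D C L xs val ok u"
    then obtain v where "{u, v} \<in> edges ?G" unfolding point_vert_def point_adj_iff by blast
    moreover have "\<forall>e\<in>edges ?G. e \<subseteq> verts ?G"
      unfolding point_graph_def graph_of_def by (auto simp del: point_x.simps point_y.simps)
    ultimately show "u \<in> verts ?G" by blast
  next
    assume "u \<in> verts ?G"
    then obtain p where p: "p \<in> points n E D L ok" "u = X p \<or> u = point_width n E D L + Y val p"
      unfolding point_graph_def graph_of_def by (auto simp del: point_x.simps point_y.simps)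
    have "{X p, point_width n E D L + Y val p} \<in> edges ?G"
      using p(1) unfolding point_graph_def graph_of_def by (simp del: point_x.simps point_y.simps)
    then have "point_adj n E D C L xs val ok (X p) (point_width n E D L + Y val p)"
      "point_adj n E D C L xs val ok (point_width n E D L + Y val p) (X p)"
      unfolding point_adj_iff by (simp_all add: insert_commute del: point_x.simps point_y.simps)
    then show "point_vert n E D C L xs val ok u"
      unfolding point_vert_def using p(2) b[OF p(1)] by (elim disjE) (simp_all del: point_x.simps point_y.simps, blast+)
  qed
qed

lemma points_ne: "points n E D L ok \<noteq> {}"
proof -
  have "Alpha 0 \<in> points n E D L ok" using n_pos by (simp add: points_def)
  then show ?thesis by blast
qed

lemma point_graph_matching:
  assumes "\<And>z t. ok z t \<Longrightarrow> vs (z div 2)" "\<And>z t. t < D \<Longrightarrow> ok z t \<Longrightarrow> val z t < C"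
  shows "ordered_matching (point_graph n E D C L xs val ok)" "separated (point_graph n E D C L xs val ok)"
proof -
  show "ordered_matching (point_graph n E D C L xs val ok)"
    unfolding point_graph_def width_eq
    by (rule ordered_matching_graph_of[OF finite_points inj_X[OF assms(1)] inj_Y[OF assms(2)] X_less_width[OF assms(1)]])
  show "separated (point_graph n E D C L xs val ok)"
    unfolding point_graph_def width_eq
    by (rule separated_graph_of[OF finite_points points_ne X_less_width[OF assms(1)]])
qed

lemma ordered_subgraph_iff_solution:
  assumes "\<And>z t. t < D \<Longrightarrow> val z t < C"
    "\<And>e t. e < n \<Longrightarrow> val (2 * e) t = D - 1 - t \<and> val (2 * e + 1) t = D - 1 - t"
  shows "ordered_subgraph (point_graph n E D C L xs zero_val pattern_slot) (point_graph n E D C L xs val (text_slot al)) \<longleftrightarrow>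
    (\<exists>s. solution val al s)"
proof -
  have ok: "pattern_slot z t \<Longrightarrow> vs (z div 2)" "text_slot al z t \<Longrightarrow> vs (z div 2)" for z t
    by (simp_all add: pattern_slot_def text_slot_def)
  have C: "0 < C" using D_pos D_le by simp
  have "ordered_subgraph (point_graph n E D C L xs zero_val pattern_slot) (point_graph n E D C L xs val (text_slot al)) \<longleftrightarrow>
    (\<exists>f. f ` P \<subseteq> T al \<and> (\<forall>p\<in>P. \<forall>q\<in>P. (X p < X q \<longrightarrow> X (f p) < X (f q)) \<and>
     (Y zero_val p < Y zero_val q \<longrightarrow> Y val (f p) < Y val (f q))))"
    unfolding point_graph_def width_eq
    by (rule ordered_subgraph_graph_of[OF inj_X[OF ok(1)] X_less_width[OF ok(1)] inj_Y[OF C] X_less_width[OF ok(2)]])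
  also have "\<dots> \<longleftrightarrow> (\<exists>f. embedding val al f)"
    by (rule arg_cong[of _ _ Ex], rule ext, rule embedding_def[OF assms, symmetric])
  also have "\<dots> \<longleftrightarrow> (\<exists>s. solution val al s)"
    using embedding_of_solution[OF assms] solution_of_embedding[OF assms] by blast
  finally show ?thesis .
qed

end

text \<open>\<open>D\<close> and \<open>C\<close> will depend on the machine only; they are
  constants here, whereas the other parameters vary with the word.\<close>

lemma GEN_point_encoding:
  assumes n: "DEF (\<lambda>x \<sigma>. n x)" and E: "DEF (\<lambda>x \<sigma>. E x)" and L: "DEF (\<lambda>x \<sigma>. L x)"
    and xs: "DEF (\<lambda>x \<sigma>. xs x (\<sigma> 0))" and val: "DEF (\<lambda>x \<sigma>. val x (\<sigma> 0) (\<sigma> 1))"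
    and ok: "DEFP (\<lambda>x \<sigma>. ok x (\<sigma> 0) (\<sigma> 1))"
  shows "GEN (\<lambda>x \<sigma>. point_encoding (n x) (E x) D C (L x) (xs x) (val x) (ok x))"
proof -
  note i = n E L DEF_comp1[of xs, OF xs] DEF_comp2[of val, OF val] DEFP_comp2[of ok, OF ok] def_intros
  have w: "DEF (\<lambda>x \<sigma>. point_width (n x) (E x) D (L x))"
    unfolding point_width_def by (intro i)
  have b: "DEF (\<lambda>x \<sigma>. point_bound (n x) (E x) D C (L x))"
    unfolding point_bound_def by (intro w i)
  have sx: "DEF (\<lambda>x \<sigma>. slot_x (n x) (E x) D (xs x) (\<sigma> 0) (\<sigma> 1))"
  proof -
    have "DEFP (\<lambda>x \<sigma>. even (\<sigma> 0))" unfolding even_iff_mod_2_eq_zero by (intro i)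
    then show ?thesis unfolding slot_x_def by (intro i)
  qed
  have sy: "DEF (\<lambda>x \<sigma>. slot_y D C (val x) (\<sigma> 0) (\<sigma> 1))"
    unfolding slot_y_def by (intro i)
  have "DEFP (\<lambda>x \<sigma>. point_rel (n x) (E x) D C (L x) (xs x) (val x) (ok x) (\<sigma> 0) (\<sigma> 1))"
    unfolding point_rel_def
    by (intro DEF_comp2[of "\<lambda>x. slot_x (n x) (E x) D (xs x)", OF sx] DEF_comp2[of "\<lambda>x. slot_y D C (val x)", OF sy] i)
  note r = DEFP_comp2[of "\<lambda>x. point_rel (n x) (E x) D C (L x) (xs x) (val x) (ok x)", OF this]
  have "DEFP (\<lambda>x \<sigma>. point_adj (n x) (E x) D C (L x) (xs x) (val x) (ok x) (\<sigma> 0) (\<sigma> 1))"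
    unfolding point_adj_def point_edge_def by (intro w r i)
  note a = DEFP_comp2[of "\<lambda>x. point_adj (n x) (E x) D C (L x) (xs x) (val x) (ok x)", OF this]
  have v: "DEFP (\<lambda>x \<sigma>. point_vert (n x) (E x) D C (L x) (xs x) (val x) (ok x) (\<sigma> 0))"
    unfolding point_vert_def by (intro DEFP_ex b a DEF.var)
  show ?thesis
    unfolding point_encoding_def by (intro GEN_list_graph b v a DEF.var)
qed

section \<open>Computations as tilings\<close>

text \<open>
  A tile describes one column of all tapes at one time: the state, the list of all symbols that
  are read, and for every tape the symbol in the column together with three flags telling whether
  the head is one cell to the left, here, or one cell to the right.
\<close>

type_synonym tile = "nat \<times> nat list \<times> (nat \<times> bool \<times> bool \<times> bool) list"

fun tile_of :: "nat \<times> tape list \<Rightarrow> int \<Rightarrow> tile" where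
  "tile_of (q, tps) p = (q, map read_tape tps, map (\<lambda>tp. (fst tp p, snd tp = p - 1, snd tp = p, snd tp = p + 1)) tps)"

definition sym :: "tile \<Rightarrow> nat \<Rightarrow> nat" where "sym t i = fst (snd (snd t) ! i)"
definition flag_left :: "tile \<Rightarrow> nat \<Rightarrow> bool" where "flag_left t i = fst (snd (snd (snd t) ! i))"
definition flag_here :: "tile \<Rightarrow> nat \<Rightarrow> bool" where "flag_here t i = fst (snd (snd (snd (snd t) ! i)))"
definition flag_right :: "tile \<Rightarrow> nat \<Rightarrow> bool" where "flag_right t i = snd (snd (snd (snd (snd t) ! i)))"

text \<open>Extends the transition function to the halting state by an action that changes nothing,
  so that all rows obey the same rule.\<close>

definition action :: "turing_machine \<Rightarrow> nat \<Rightarrow> nat list \<Rightarrow> nat \<times> (nat \<times> direction) list" where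
  "action M q rs = (if q < n_states M then transition M q rs else (q, map (\<lambda>r. (r, Stay)) rs))"

text \<open>Neighbouring columns share the state, the symbols read, and the heads in either of the
  two columns: \<open>left\<close> and \<open>here\<close> on the right side are \<open>here\<close>
  and \<open>right\<close> on the left side.\<close>

definition left_color :: "nat \<Rightarrow> tile \<Rightarrow> nat \<times> nat list \<times> (bool \<times> bool) list" where
  "left_color k t = (fst t, fst (snd t), map (\<lambda>i. (flag_left t i, flag_here t i)) [0..<k])"

definition right_color :: "nat \<Rightarrow> tile \<Rightarrow> nat \<times> nat list \<times> (bool \<times> bool) list" where
  "right_color k t = (fst t, fst (snd t), map (\<lambda>i. (flag_here t i, flag_right t i)) [0..<k])"

definition down_color :: "nat \<Rightarrow> tile \<Rightarrow> nat \<times> (nat \<times> bool) list" where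
  "down_color k t = (fst t, map (\<lambda>i. (sym t i, flag_here t i)) [0..<k])"

text \<open>The next row is predicted from one column: the state and the symbols read give the
  action, and a head that moves to the left arrives here if it was one cell to the right.\<close>

definition up_color :: "turing_machine \<Rightarrow> nat \<Rightarrow> tile \<Rightarrow> nat \<times> (nat \<times> bool) list" where
  "up_color M k t = (case action M (fst t) (fst (snd t)) of (q, acts) \<Rightarrow>
     (q, map (\<lambda>i. (if flag_here t i then fst (acts ! i) else sym t i,
        case snd (acts ! i) of MoveLeft \<Rightarrow> flag_right t i | Stay \<Rightarrow> flag_here t i | MoveRight \<Rightarrow> flag_left t i)) [0..<k]))"

text \<open>The condition at a head ties the recorded list of symbols to the actual contents of the
  tapes.\<close>

definition tiles :: "turing_machine \<Rightarrow> tile set" where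
  "tiles M = {t. fst t \<le> n_states M \<and> length (fst (snd t)) = n_tapes M \<and> set (fst (snd t)) \<subseteq> {..<n_symbols M} \<and>
     length (snd (snd t)) = n_tapes M \<and> (\<forall>i<n_tapes M. sym t i < n_symbols M \<and>
       (flag_here t i \<longrightarrow> sym t i = fst (snd t) ! i))}"

lemma finite_tiles: "finite (tiles M)"
proof (rule finite_subset)
  show "tiles M \<subseteq> {..n_states M} \<times> {rs. set rs \<subseteq> {..<n_symbols M} \<and> length rs = n_tapes M} \<times>
      {cs. set cs \<subseteq> {..<n_symbols M} \<times> UNIV \<and> length cs = n_tapes M}"
  proof
    fix t assume t: "t \<in> tiles M"
    have "set (snd (snd t)) \<subseteq> {..<n_symbols M} \<times> UNIV"
    proof
      fix c assume "c \<in> set (snd (snd t))"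
      then obtain i where "i < length (snd (snd t))" "c = snd (snd t) ! i" by (metis in_set_conv_nth)
      then have "fst c < n_symbols M" using t by (simp add: tiles_def sym_def)
      then show "c \<in> {..<n_symbols M} \<times> UNIV" by (simp add: mem_Times_iff)
    qed
    then show "t \<in> {..n_states M} \<times> {rs. set rs \<subseteq> {..<n_symbols M} \<and> length rs = n_tapes M} \<times>
      {cs. set cs \<subseteq> {..<n_symbols M} \<times> UNIV \<and> length cs = n_tapes M}"
      using t by (simp add: tiles_def mem_Times_iff)
  qed
  show "finite ({..n_states M} \<times> {rs. set rs \<subseteq> {..<n_symbols M} \<and> length rs = n_tapes M} \<times>
      {cs :: (nat \<times> bool \<times> bool \<times> bool) list. set cs \<subseteq> {..<n_symbols M} \<times> UNIV \<and> length cs = n_tapes M})"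
    by (intro finite_cartesian_product finite_lists_length_eq) auto
qed

lemma tile_of_simps:
  assumes "i < length tps"
  shows "sym (tile_of (q, tps) p) i = fst (tps ! i) p" "flag_left (tile_of (q, tps) p) i \<longleftrightarrow> snd (tps ! i) = p - 1"
    "flag_here (tile_of (q, tps) p) i \<longleftrightarrow> snd (tps ! i) = p" "flag_right (tile_of (q, tps) p) i \<longleftrightarrow> snd (tps ! i) = p + 1"
  using assms by (simp_all add: sym_def flag_left_def flag_here_def flag_right_def)

lemma fst_tile_of: "fst (tile_of c p) = fst c" "fst (snd (tile_of c p)) = map read_tape (snd c)"
  by (cases c; simp)+

lemma left_right_color_tile_of:
  assumes "length (snd c) = k"
  shows "right_color k (tile_of c p) = left_color k (tile_of c (p + 1))"
proof (cases c)
  case (Pair q tps)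
  then show ?thesis
    using assms unfolding right_color_def left_color_def fst_tile_of by (auto simp: tile_of_simps simp del: tile_of.simps)
qed

lemma read_tape_eq: "read_tape tp = fst tp (snd tp)"
  by (cases tp) simp

lemma update_tape_eq: "update_tape a tp = ((fst tp)(snd tp := fst a), snd tp + displacement (snd a))"
  by (cases a; cases tp) simp

definition valid_config :: "turing_machine \<Rightarrow> int \<Rightarrow> nat \<times> tape list \<Rightarrow> bool" where
  "valid_config M b c \<longleftrightarrow> fst c \<le> n_states M \<and> length (snd c) = n_tapes M \<and>
     (\<forall>tp\<in>set (snd c). \<bar>snd tp\<bar> \<le> b \<and> (\<forall>p. fst tp p < n_symbols M))"

lemma action_wf:
  assumes "wf_tm M" "valid_config M b c" "action M (fst c) (map read_tape (snd c)) = (q, acts)"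
  shows "q \<le> n_states M" "length acts = n_tapes M" "\<forall>(s, d)\<in>set acts. s < n_symbols M"
    "tm_step M c = (q, map2 update_tape acts (snd c))"
proof -
  have len: "length (map read_tape (snd c)) = n_tapes M" and sy: "\<forall>r\<in>set (map read_tape (snd c)). r < n_symbols M"
    and q: "fst c \<le> n_states M"
    using assms(2) by (auto simp: valid_config_def read_tape_eq)
  obtain q0 tps where c: "c = (q0, tps)" by (cases c)
  have "q \<le> n_states M \<and> length acts = n_tapes M \<and> (\<forall>(s, d)\<in>set acts. s < n_symbols M) \<and>
    tm_step M c = (q, map2 update_tape acts (snd c))"
  proof (cases "q0 < n_states M")
    case True
    then have *: "transition M q0 (map read_tape tps) = (q, acts)" using assms(3) by (simp add: action_def c)
    have "case transition M q0 (map read_tape tps) of (q', acts) \<Rightarrow>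
           q' \<le> n_states M \<and> length acts = n_tapes M \<and> (\<forall>(s, d)\<in>set acts. s < n_symbols M)"
      using assms(1)[unfolded wf_tm_def, THEN conjunct2, THEN conjunct2, rule_format, OF True, of "map read_tape tps"]
        len sy by (simp add: c)
    then show ?thesis using True * by (simp add: c)
  next
    case False
    then have *: "q = q0" "acts = map (\<lambda>r. (r, Stay)) (map read_tape tps)" using assms(3) by (auto simp: action_def c)
    have "map2 update_tape acts tps = tps"
      by (rule nth_equalityI) (auto simp: * update_tape_eq read_tape_eq)
    then show ?thesis using False q len sy by (auto simp: c *)
  qed
  then show "q \<le> n_states M" "length acts = n_tapes M" "\<forall>(s, d)\<in>set acts. s < n_symbols M"
    "tm_step M c = (q, map2 update_tape acts (snd c))" by auto
qed

lemma valid_config_step: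
  assumes "wf_tm M" "valid_config M b c"
  shows "valid_config M (b + 1) (tm_step M c)"
proof -
  obtain q acts where a: "action M (fst c) (map read_tape (snd c)) = (q, acts)" by fastforce
  note w = action_wf[OF assms a]
  have len: "length (snd c) = n_tapes M" using assms(2) by (simp add: valid_config_def)
  have "\<bar>snd tp\<bar> \<le> b + 1 \<and> (\<forall>p. fst tp p < n_symbols M)" if tp: "tp \<in> set (map2 update_tape acts (snd c))" for tp
  proof -
    obtain i where "i < length (map2 update_tape acts (snd c))" "map2 update_tape acts (snd c) ! i = tp"
      using tp unfolding in_set_conv_nth by blast
    then have i: "i < n_tapes M" "tp = update_tape (acts ! i) (snd c ! i)" using w(2) len by auto
    have "snd c ! i \<in> set (snd c)" "acts ! i \<in> set acts" using i len w(2) by auto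
    then have 1: "\<bar>snd (snd c ! i)\<bar> \<le> b \<and> (\<forall>p. fst (snd c ! i) p < n_symbols M)" and 2: "fst (acts ! i) < n_symbols M"
      using assms(2) w(3) unfolding valid_config_def by (blast, force)
    have d: "\<bar>displacement d\<bar> \<le> 1" for d by (cases d) auto
    then have "\<bar>snd (snd c ! i) + displacement (snd (acts ! i))\<bar> \<le> b + 1"
      using conjunct1[OF 1] d[of "snd (acts ! i)"] abs_triangle_ineq[of "snd (snd c ! i)" "displacement (snd (acts ! i))"]
      by linarith
    then show ?thesis using 1 2 by (simp add: i(2) update_tape_eq)
  qed
  then show ?thesis using w len unfolding valid_config_def by simp
qed

lemma up_down_color_tile_of:
  assumes "wf_tm M" "valid_config M b c"
  shows "up_color M (n_tapes M) (tile_of c p) = down_color (n_tapes M) (tile_of (tm_step M c) p)"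
proof -
  obtain q acts where a: "action M (fst c) (map read_tape (snd c)) = (q, acts)" by fastforce
  note w = action_wf[OF assms a]
  have len: "length (snd c) = n_tapes M" using assms(2) by (simp add: valid_config_def)
  obtain q0 tps where c: "c = (q0, tps)" by (cases c)
  have "(if flag_here (tile_of c p) i then fst (acts ! i) else sym (tile_of c p) i,
        case snd (acts ! i) of MoveLeft \<Rightarrow> flag_right (tile_of c p) i | Stay \<Rightarrow> flag_here (tile_of c p) i
          | MoveRight \<Rightarrow> flag_left (tile_of c p) i) =
    (sym (tile_of (tm_step M c) p) i, flag_here (tile_of (tm_step M c) p) i)" if "i < n_tapes M" for i
  proof -
    have i: "i < length tps" "i < length (map2 update_tape acts tps)" using that len w(2) by (auto simp: c)
    show ?thesis
      unfolding w(4) unfolding c snd_conv tile_of_simps[OF i(1)] tile_of_simps[OF i(2)]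
      using i by (cases "snd (acts ! i)") (auto simp: update_tape_eq)
  qed
  then show ?thesis
    unfolding up_color_def down_color_def fst_tile_of a by (auto simp: w(4))
qed

lemma tile_of_in_tiles:
  assumes "valid_config M b c"
  shows "tile_of c p \<in> tiles M"
proof -
  obtain q tps where c: "c = (q, tps)" by (cases c)
  have len: "length tps = n_tapes M" using assms by (simp add: valid_config_def c)
  have "sym (tile_of c p) i < n_symbols M \<and> (flag_here (tile_of c p) i \<longrightarrow> sym (tile_of c p) i = map read_tape tps ! i)"
    if "i < n_tapes M" for i
  proof -
    have i: "i < length tps" using that len by simp
    then have "tps ! i \<in> set tps" by simp
    then show ?thesis
      using assms i unfolding c tile_of_simps[OF i] by (auto simp: valid_config_def read_tape_eq)
  qed
  then show ?thesis
    using assms len unfolding tiles_def mem_Collect_eq fst_tile_of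
    by (auto simp: c valid_config_def read_tape_eq)
qed

lemma tile_eqI:
  assumes "t \<in> tiles M" "t' \<in> tiles M" "fst t = fst t'" "fst (snd t) = fst (snd t')"
    "\<And>i. i < n_tapes M \<Longrightarrow> sym t i = sym t' i \<and> flag_left t i = flag_left t' i \<and>
      flag_here t i = flag_here t' i \<and> flag_right t i = flag_right t' i"
  shows "t = t'"
proof -
  have "snd (snd t) = snd (snd t')"
  proof (rule nth_equalityI)
    show "length (snd (snd t)) = length (snd (snd t'))" using assms(1,2) by (simp add: tiles_def)
    fix i assume "i < length (snd (snd t))"
    then have "i < n_tapes M" using assms(1) by (simp add: tiles_def)
    from assms(5)[OF this] show "snd (snd t) ! i = snd (snd t') ! i"
      by (simp add: sym_def flag_left_def flag_here_def flag_right_def prod_eq_iff)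
  qed
  then show ?thesis using assms(3,4) by (simp add: prod_eq_iff)
qed

text \<open>The symbols that are read are known in every column because some column holds the head.\<close>

lemma row_determined:
  assumes valid: "valid_config M b c" and b: "b \<le> int off" "int off + b < int w"
    and t: "\<And>j. j < w \<Longrightarrow> t j \<in> tiles M"
    and hor: "\<And>j. j + 1 < w \<Longrightarrow> right_color (n_tapes M) (t j) = left_color (n_tapes M) (t (j + 1))"
    and first: "\<And>i. i < n_tapes M \<Longrightarrow> \<not> flag_left (t 0) i"
    and last: "\<And>i. i < n_tapes M \<Longrightarrow> \<not> flag_right (t (w - 1)) i"
    and down: "\<And>j. j < w \<Longrightarrow> down_color (n_tapes M) (t j) = down_color (n_tapes M) (tile_of c (int j - int off))"
    and j: "j < w"
  shows "t j = tile_of c (int j - int off)"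
proof -
  obtain q tps where c: "c = (q, tps)" by (cases c)
  have len: "length tps = n_tapes M" using valid by (simp add: valid_config_def c)
  have d: "fst (t j) = q \<and> (\<forall>i<n_tapes M. sym (t j) i = fst (tps ! i) (int j - int off) \<and>
      (flag_here (t j) i \<longleftrightarrow> snd (tps ! i) = int j - int off))" if "j < w" for j
    using down[OF that] len unfolding down_color_def fst_tile_of by (auto simp: tile_of_simps c simp del: tile_of.simps)
  have h: "fst (snd (t j)) = fst (snd (t (j + 1))) \<and> (\<forall>i<n_tapes M. flag_here (t j) i = flag_left (t (j + 1)) i \<and>
      flag_right (t j) i = flag_here (t (j + 1)) i)" if "j + 1 < w" for j
    using hor[OF that] unfolding right_color_def left_color_def by auto
  have reads0: "fst (snd (t j)) = fst (snd (t 0))" if "j < w" for j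
    using that
  proof (induction j)
    case (Suc j)
    then show ?case using h[of j] by simp
  qed simp
  have rng: "\<bar>snd (tps ! i)\<bar> \<le> b" if "i < n_tapes M" for i
    using valid that len by (auto simp: valid_config_def c)
  have "fst (snd (t 0)) = map read_tape tps"
  proof (rule nth_equalityI)
    show "length (fst (snd (t 0))) = length (map read_tape tps)" using t[of 0] len j by (simp add: tiles_def)
    fix i assume "i < length (fst (snd (t 0)))"
    then have i: "i < n_tapes M" using t[of 0] j by (simp add: tiles_def)
    \<comment> \<open>The column of the head of tape \<open>i\<close>; column \<open>off\<close> is
      cell 0.\<close>
    define j0 where "j0 = nat (snd (tps ! i) + int off)"
    have j0: "int j0 - int off = snd (tps ! i)" "j0 < w" using rng[OF i] b unfolding j0_def by auto
    have "flag_here (t j0) i" using d[OF j0(2)] i j0(1) by simp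
    then have "sym (t j0) i = fst (snd (t j0)) ! i" using t[OF j0(2)] i by (simp add: tiles_def)
    then have "fst (snd (t 0)) ! i = fst (tps ! i) (snd (tps ! i))"
      using d[OF j0(2)] i j0(1) reads0[OF j0(2)] by simp
    then show "fst (snd (t 0)) ! i = map read_tape tps ! i" using i len by (simp add: read_tape_eq)
  qed
  then have reads: "fst (snd (t j)) = map read_tape tps" using reads0[OF j] by simp
  show ?thesis
  proof (rule tile_eqI[OF t[OF j] tile_of_in_tiles[OF valid]])
    show "fst (t j) = fst (tile_of c (int j - int off))" "fst (snd (t j)) = fst (snd (tile_of c (int j - int off)))"
      using d[OF j] reads by (simp_all add: c)
    fix i assume i: "i < n_tapes M"
    then have il: "i < length tps" using len by simp
    \<comment> \<open>Inside the row the flag is copied from the left neighbour. In column 0 it is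
      false by \<open>first\<close>, and the bound \<open>b \<le> int off\<close> keeps the head
      from being further left.\<close>
    have "flag_left (t j) i \<longleftrightarrow> snd (tps ! i) = int j - int off - 1"
    proof (cases j)
      case 0
      then show ?thesis using first[OF i] rng[OF i] b by auto
    next
      case (Suc j')
      then show ?thesis using h[of j'] d[of j'] i j by (simp add: algebra_simps)
    qed
    moreover have "flag_right (t j) i \<longleftrightarrow> snd (tps ! i) = int j - int off + 1"
    proof (cases "j + 1 < w")
      case True
      then show ?thesis using h[of j] d[of "j + 1"] i by (simp add: algebra_simps)
    next
      case False
      then have "j = w - 1" using j by simp
      then show ?thesis using last[OF i] rng[OF i] b j by auto
    qed
    ultimately show "sym (t j) i = sym (tile_of c (int j - int off)) i \<and>
        flag_left (t j) i = flag_left (tile_of c (int j - int off)) i \<and>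
        flag_here (t j) i = flag_here (tile_of c (int j - int off)) i \<and>
        flag_right (t j) i = flag_right (tile_of c (int j - int off)) i"
      using d[OF j] i unfolding c tile_of_simps[OF il] by simp
  qed
qed

lemma valid_config_run:
  assumes "wf_tm M"
  shows "valid_config M (int i) ((tm_step M ^^ i) (initial_config M y))"
proof (induction i)
  case 0
  have "3 \<le> n_symbols M" "1 \<le> n_tapes M" using assms by (simp_all add: wf_tm_def)
  then show ?case
    by (auto simp: valid_config_def initial_config_def word_tape_def bit_symbol_def)
next
  case (Suc i)
  then show ?case using valid_config_step[OF assms Suc] by (simp add: add.commute)
qed

section \<open>The input word on the first tape\<close>

lemma pair_word_Cons: "pair_word (b # x) u = True # b # pair_word x u"
  by (simp add: pair_word_def)

lemma length_pair_word: "length (pair_word x u) = 2 * length x + 1 + length u"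
  by (induction x) (simp_all add: pair_word_Cons, simp add: pair_word_def)

lemma nth_pair_word:
  "a < length x \<Longrightarrow> pair_word x u ! (2 * a)"
  "a < length x \<Longrightarrow> pair_word x u ! (2 * a + 1) = x ! a"
  "\<not> pair_word x u ! (2 * length x)"
  "pair_word x u ! (2 * length x + 1 + b) = u ! b"
proof -
  show "a < length x \<Longrightarrow> pair_word x u ! (2 * a)"
  proof (induction x arbitrary: a)
    case (Cons b x)
    then show ?case by (cases a) (simp_all add: pair_word_Cons)
  qed simp
  show "a < length x \<Longrightarrow> pair_word x u ! (2 * a + 1) = x ! a"
  proof (induction x arbitrary: a)
    case (Cons b x)
    then show ?case by (cases a) (simp_all add: pair_word_Cons)
  qed simp
  show "\<not> pair_word x u ! (2 * length x)"
    by (induction x) (auto simp: pair_word_Cons, simp add: pair_word_def)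
  show "pair_word x u ! (2 * length x + 1 + b) = u ! b"
  proof (induction x)
    case Nil
    show ?case by (simp add: pair_word_def)
  qed (simp add: pair_word_Cons)
qed

lemma word_tape_pair_word:
  "p < 0 \<Longrightarrow> fst (word_tape (pair_word x u)) p = 0"
  "a < length x \<Longrightarrow> fst (word_tape (pair_word x u)) (int (2 * a)) = 2"
  "a < length x \<Longrightarrow> fst (word_tape (pair_word x u)) (int (2 * a + 1)) = bit_symbol (x ! a)"
  "fst (word_tape (pair_word x u)) (int (2 * length x)) = 1"
  "b < length u \<Longrightarrow> fst (word_tape (pair_word x u)) (int (2 * length x + 1 + b)) = bit_symbol (u ! b)"
  "length u \<le> b \<Longrightarrow> fst (word_tape (pair_word x u)) (int (2 * length x + 1 + b)) = 0"
proof -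
  have w: "fst (word_tape y) (int m) = (if m < length y then bit_symbol (y ! m) else 0)" for y m
    by (simp add: word_tape_def)
  show "p < 0 \<Longrightarrow> fst (word_tape (pair_word x u)) p = 0" by (simp add: word_tape_def)
  show "a < length x \<Longrightarrow> fst (word_tape (pair_word x u)) (int (2 * a)) = 2"
    unfolding w length_pair_word using nth_pair_word(1)[of a x u] by (simp add: bit_symbol_def)
  show "a < length x \<Longrightarrow> fst (word_tape (pair_word x u)) (int (2 * a + 1)) = bit_symbol (x ! a)"
    unfolding w length_pair_word using nth_pair_word(2)[of a x u] by simp
  show "fst (word_tape (pair_word x u)) (int (2 * length x)) = 1"
    unfolding w length_pair_word using nth_pair_word(3)[of x u] by (simp add: bit_symbol_def)
  show "b < length u \<Longrightarrow> fst (word_tape (pair_word x u)) (int (2 * length x + 1 + b)) = bit_symbol (u ! b)"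
    unfolding w length_pair_word using nth_pair_word(4)[of x u b] by simp
  show "length u \<le> b \<Longrightarrow> fst (word_tape (pair_word x u)) (int (2 * length x + 1 + b)) = 0"
    unfolding w length_pair_word by simp
qed

text \<open>Column \<open>off\<close> is cell 0. The columns of \<open>x\<close> and its end marker
  are prescribed; the \<open>pl\<close> columns after them may hold blanks and bits freely, which is
  how an unknown certificate enters the tiling.\<close>

definition init_tile :: "nat \<Rightarrow> nat \<Rightarrow> bool list \<Rightarrow> nat \<Rightarrow> nat \<Rightarrow> tile \<Rightarrow> bool" where
  "init_tile k off x pl j t \<longleftrightarrow>
     (fst t = 0 \<and> (\<forall>i<k. 0 < i \<longrightarrow> sym t i = 0) \<and> sym t 0 \<le> 2) \<and>
     (j = off \<longrightarrow> (\<forall>i<k. flag_here t i)) \<and> (j \<noteq> off \<longrightarrow> (\<forall>i<k. \<not> flag_here t i)) \<and>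
     (j < off \<or> off + (2 * length x + 1) + pl \<le> j \<longrightarrow> sym t 0 = 0) \<and>
     (\<forall>a<length x. j = off + 2 * a \<longrightarrow> sym t 0 = 2) \<and>
     (\<forall>a<length x. j = off + (2 * a + 1) \<longrightarrow> sym t 0 = bit_symbol (x ! a)) \<and>
     (j = off + 2 * length x \<longrightarrow> sym t 0 = 1)"

definition allowed_tile :: "nat \<Rightarrow> nat \<Rightarrow> nat \<Rightarrow> nat \<Rightarrow> bool list \<Rightarrow> nat \<Rightarrow> nat \<Rightarrow> nat \<Rightarrow> tile \<Rightarrow> bool" where
  "allowed_tile k off T w x pl i j t \<longleftrightarrow>
     (j = 0 \<longrightarrow> (\<forall>i<k. \<not> flag_left t i)) \<and> (j = w - 1 \<longrightarrow> (\<forall>i<k. \<not> flag_right t i)) \<and>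
     (i = 0 \<longrightarrow> init_tile k off x pl j t) \<and> (i = T \<and> j = off \<longrightarrow> sym t (k - 1) = 2)"

text \<open>Both \<open>j\<close> and \<open>j + 1\<close> lie in the certificate area. In
  \<open>tiling\<close> no nonblank symbol may follow a blank one there, so that the area holds one
  word of any length up to \<open>pl\<close>.\<close>

definition in_certificate :: "nat \<Rightarrow> bool list \<Rightarrow> nat \<Rightarrow> nat \<Rightarrow> bool" where
  "in_certificate off x pl j \<longleftrightarrow> off + (2 * length x + 1) \<le> j \<and> j + 1 < off + (2 * length x + 1) + pl"

definition tiling :: "turing_machine \<Rightarrow> nat \<Rightarrow> nat \<Rightarrow> nat \<Rightarrow> bool list \<Rightarrow> nat \<Rightarrow> (nat \<Rightarrow> nat \<Rightarrow> tile) \<Rightarrow> bool" where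
  "tiling M off T w x pl tt \<longleftrightarrow>
     (\<forall>i\<le>T. \<forall>j<w. tt i j \<in> tiles M \<and> allowed_tile (n_tapes M) off T w x pl i j (tt i j)) \<and>
     (\<forall>i\<le>T. \<forall>j. j + 1 < w \<longrightarrow> right_color (n_tapes M) (tt i j) = left_color (n_tapes M) (tt i (j + 1))) \<and>
     (\<forall>i<T. \<forall>j<w. up_color M (n_tapes M) (tt i j) = down_color (n_tapes M) (tt (i + 1) j)) \<and>
     (\<forall>j. in_certificate off x pl j \<longrightarrow> sym (tt 0 (j + 1)) 0 \<noteq> 0 \<longrightarrow> sym (tt 0 j) 0 \<noteq> 0)"

lemma tile_of_initial:
  assumes "i < n_tapes M"
  shows "sym (tile_of (initial_config M y) p) i = (if i = 0 then fst (word_tape y) p else 0)"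
    "flag_here (tile_of (initial_config M y) p) i \<longleftrightarrow> p = 0"
proof -
  have i: "i < length (word_tape y # replicate (n_tapes M - 1) (word_tape []))" using assms by simp
  have n: "(word_tape y # replicate (n_tapes M - 1) (word_tape [])) ! i = (if i = 0 then word_tape y else word_tape [])"
    using assms by (cases i) auto
  show "sym (tile_of (initial_config M y) p) i = (if i = 0 then fst (word_tape y) p else 0)"
    unfolding initial_config_def tile_of_simps[OF i] n by (simp add: word_tape_def)
  show "flag_here (tile_of (initial_config M y) p) i \<longleftrightarrow> p = 0"
    unfolding initial_config_def tile_of_simps[OF i] n by (auto simp: word_tape_def)
qed

lemma input_cases:
  fixes j off n pl :: nat
  obtains "j < off" | a where "a < n" "j = off + 2 * a" | a where "a < n" "j = off + (2 * a + 1)"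
    | "j = off + 2 * n" | b where "b < pl" "j = off + (2 * n + 1) + b" | "off + (2 * n + 1) + pl \<le> j"
proof -
  define m where "m = j - off"
  have m: "j = off + m" if "\<not> j < off" using that by (simp add: m_def)
  have "\<exists>a. m = 2 * a \<or> m = 2 * a + 1" by presburger
  then obtain a where a: "m = 2 * a \<or> m = 2 * a + 1" by blast
  consider "j < off" | "\<not> j < off" "m < 2 * n" | "\<not> j < off" "m = 2 * n" | "\<not> j < off" "2 * n < m" "m < 2 * n + 1 + pl"
    | "\<not> j < off" "2 * n + 1 + pl \<le> m" by linarith
  then show thesis
  proof cases
    case 2
    then show ?thesis using a m[OF 2(1)] that(2)[of a] that(3)[of a] by auto
  next
    case 4
    then show ?thesis using m[OF 4(1)] that(5)[of "m - (2 * n + 1)"] by auto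
  qed (use that m in auto)
qed

text \<open>There are more than \<open>T\<close> columns on either side of cell 0, so no head leaves
  the table within \<open>T\<close> steps.\<close>

context
  fixes M :: turing_machine and off T w pl :: nat and x :: "bool list"
  assumes wf: "wf_tm M" and T_off: "T < off" and off_w: "off + T + 1 < w"
    and cert_w: "off + (2 * length x + 1) + pl < w"
begin

abbreviation config :: "bool list \<Rightarrow> nat \<Rightarrow> nat \<times> tape list" where
  "config u i \<equiv> (tm_step M ^^ i) (initial_config M (pair_word x u))"

lemma tapes_pos: "0 < n_tapes M"
  using wf by (simp add: wf_tm_def)

lemma init_tile_of:
  assumes "length u \<le> pl"
  shows "init_tile (n_tapes M) off x pl j (tile_of (initial_config M (pair_word x u)) (int j - int off))"
proof -
  let ?t = "tile_of (initial_config M (pair_word x u)) (int j - int off)"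
  have s0: "sym ?t 0 = fst (word_tape (pair_word x u)) (int j - int off)"
    using tile_of_initial(1)[OF tapes_pos] by simp
  have b: "bit_symbol c \<le> 2" for c by (simp add: bit_symbol_def)
  have le: "fst (word_tape y) p \<le> 2" for y p by (simp add: word_tape_def b)
  have pos: "int j - int off = int m" if "j = off + m" for m using that by simp
  have 1: "fst ?t = 0 \<and> (\<forall>i<n_tapes M. 0 < i \<longrightarrow> sym ?t i = 0) \<and> sym ?t 0 \<le> 2"
    using le by (simp add: s0 fst_tile_of tile_of_initial) (simp add: initial_config_def)
  have 2: "\<forall>i<n_tapes M. flag_here ?t i" if "j = off" using that by (simp add: tile_of_initial)
  have 3: "\<forall>i<n_tapes M. \<not> flag_here ?t i" if "j \<noteq> off" using that by (simp add: tile_of_initial)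
  have 4: "sym ?t 0 = 0" if "j < off \<or> off + (2 * length x + 1) + pl \<le> j"
  proof (cases "j < off")
    case True
    then show ?thesis unfolding s0 by (intro word_tape_pair_word) simp
  next
    case False
    then have "off + (2 * length x + 1) + pl \<le> j" using that by simp
    then obtain b where b: "j = off + (2 * length x + 1 + b)" "pl \<le> b"
      by (metis add.assoc add_le_cancel_left le_iff_add)
    have "length u \<le> b" using assms b(2) by simp
    then show ?thesis unfolding s0 unfolding pos[OF b(1)] by (rule word_tape_pair_word(6))
  qed
  have 5: "sym ?t 0 = 2" if "a < length x" "j = off + 2 * a" for a
    unfolding s0 unfolding pos[OF that(2)] by (rule word_tape_pair_word(2)[OF that(1)])
  have 6: "sym ?t 0 = bit_symbol (x ! a)" if "a < length x" "j = off + (2 * a + 1)" for a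
    unfolding s0 unfolding pos[OF that(2)] by (rule word_tape_pair_word(3)[OF that(1)])
  have 7: "sym ?t 0 = 1" if "j = off + 2 * length x"
    unfolding s0 unfolding pos[OF that] by (rule word_tape_pair_word(4))
  show ?thesis unfolding init_tile_def by (intro conjI impI allI 1 2 3 4 5 6 7) auto
qed

lemma tiling_of_run:
  assumes u: "length u \<le> pl" and acc: "fst (last (snd (config u T))) 0 = 2"
  shows "\<exists>tt. tiling M off T w x pl tt"
proof -
  define tt where "tt i j = tile_of (config u i) (int j - int off)" for i j
  have v: "valid_config M (int i) (config u i)" for i by (rule valid_config_run[OF wf])
  have len: "length (snd (config u i)) = n_tapes M" for i using v[of i] by (simp add: valid_config_def)
  have rng: "\<bar>snd (snd (config u i) ! l)\<bar> \<le> int i" if "l < n_tapes M" for i l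
    using v[of i] that len[of i] by (auto simp: valid_config_def)
  have flags: "flag_left (tt i j) l \<longleftrightarrow> snd (snd (config u i) ! l) = int j - int off - 1"
    "flag_right (tt i j) l \<longleftrightarrow> snd (snd (config u i) ! l) = int j - int off + 1"
    "sym (tt i j) l = fst (snd (config u i) ! l) (int j - int off)" if "l < n_tapes M" for i j l
  proof -
    have "l < length (snd (config u i))" using that len[of i] by simp
    note * = tile_of_simps[OF this, of "fst (config u i)" "int j - int off", unfolded prod.collapse]
    show "flag_left (tt i j) l \<longleftrightarrow> snd (snd (config u i) ! l) = int j - int off - 1"
      unfolding tt_def by (rule *(2))
    show "flag_right (tt i j) l \<longleftrightarrow> snd (snd (config u i) ! l) = int j - int off + 1"
      unfolding tt_def by (rule *(4))
    show "sym (tt i j) l = fst (snd (config u i) ! l) (int j - int off)"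
      unfolding tt_def by (rule *(1))
  qed
  have allowed: "allowed_tile (n_tapes M) off T w x pl i j (tt i j)" if "i \<le> T" for i j
    unfolding allowed_tile_def
  proof (intro conjI impI allI)
    fix l assume "j = 0" "l < n_tapes M"
    then show "\<not> flag_left (tt i j) l" using flags(1) rng[of l i] T_off that by auto
  next
    fix l assume "j = w - 1" "l < n_tapes M"
    then show "\<not> flag_right (tt i j) l" using flags(2) rng[of l i] off_w that by auto
  next
    assume "i = 0"
    then show "init_tile (n_tapes M) off x pl j (tt i j)" using init_tile_of[OF u] by (simp add: tt_def)
  next
    assume "i = T \<and> j = off"
    then have i: "i = T" and j: "j = off" by simp_all
    have "snd (config u T) \<noteq> []" using len[of T] tapes_pos by force
    then have "last (snd (config u T)) = snd (config u T) ! (n_tapes M - 1)" by (simp add: last_conv_nth len)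
    then show "sym (tt i j) (n_tapes M - 1) = 2"
      unfolding i j using flags(3)[of "n_tapes M - 1" T off] acc tapes_pos by simp
  qed
  have hor: "right_color (n_tapes M) (tt i j) = left_color (n_tapes M) (tt i (j + 1))" for i j
    using left_right_color_tile_of[OF len[of i], of "int j - int off"] unfolding tt_def by (simp add: algebra_simps)
  have ver: "up_color M (n_tapes M) (tt i j) = down_color (n_tapes M) (tt (i + 1) j)" for i j
    using up_down_color_tile_of[OF wf v[of i], of "int j - int off"] unfolding tt_def by simp
  have cert: "sym (tt 0 j) 0 \<noteq> 0" if c: "in_certificate off x pl j" "sym (tt 0 (j + 1)) 0 \<noteq> 0" for j
  proof -
    obtain b where j: "j = off + (2 * length x + 1 + b)"
      using c(1) unfolding in_certificate_def by (metis add.assoc le_iff_add)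
    have s0: "sym (tt 0 j) 0 = fst (word_tape (pair_word x u)) (int j - int off)" for j
      using tile_of_initial(1)[OF tapes_pos] by (simp add: tt_def)
    have e: "int j - int off = int (2 * length x + 1 + b)" "int (j + 1) - int off = int (2 * length x + 1 + (b + 1))"
      using j by simp_all
    have "\<not> length u \<le> b + 1"
    proof
      assume "length u \<le> b + 1"
      from word_tape_pair_word(6)[OF this] c(2)[unfolded s0 e] show False by (rule notE[rotated])
    qed
    then show ?thesis using word_tape_pair_word(5)[of b u x] unfolding s0 e by (simp add: bit_symbol_def)
  qed
  have "tiling M off T w x pl tt"
    unfolding tiling_def using allowed hor ver cert tile_of_in_tiles[OF v] by (simp add: tt_def)
  then show ?thesis by (intro exI)
qed

lemma run_of_tiling:
  assumes "tiling M off T w x pl tt"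
  shows "\<exists>u. length u \<le> pl \<and> fst (last (snd (config u T))) 0 = 2"
proof -
  have tt: "tt i j \<in> tiles M" "allowed_tile (n_tapes M) off T w x pl i j (tt i j)" if "i \<le> T" "j < w" for i j
    using assms that unfolding tiling_def by simp_all
  have hor: "right_color (n_tapes M) (tt i j) = left_color (n_tapes M) (tt i (j + 1))" if "i \<le> T" "j + 1 < w" for i j
    using assms that unfolding tiling_def by simp
  have ver: "up_color M (n_tapes M) (tt i j) = down_color (n_tapes M) (tt (i + 1) j)" if "i < T" "j < w" for i j
    using assms that unfolding tiling_def by simp
  have cert: "sym (tt 0 j) 0 \<noteq> 0" if "in_certificate off x pl j" "sym (tt 0 (j + 1)) 0 \<noteq> 0" for j
    using assms that unfolding tiling_def by blast
  define cs where "cs b = sym (tt 0 (off + (2 * length x + 1) + b)) 0" for b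
  \<comment> \<open>The certificate ends at its first blank or else fills all \<open>pl\<close>
    columns.\<close>
  define l where "l = (LEAST b. b = pl \<or> cs b = 0)"
  have l: "l = pl \<or> cs l = 0" "l \<le> pl" "\<And>b. b < l \<Longrightarrow> cs b \<noteq> 0"
    unfolding l_def by (rule LeastI[of _ pl], simp, rule Least_le, simp, use not_less_Least in blast)
  have blank: "cs b = 0" if "l \<le> b" "b < pl" for b
    using that
  proof (induction b rule: dec_induct)
    case base
    then show ?case using l by auto
  next
    case (step b)
    have "in_certificate off x pl (off + (2 * length x + 1) + b)" using step.prems by (simp add: in_certificate_def)
    from cert[OF this] show ?case using step by (auto simp: cs_def)
  qed
  define u where "u = map (\<lambda>b. cs b = 2) [0..<l]"
  have len_u: "length u = l" by (simp add: u_def)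
  have init: "init_tile (n_tapes M) off x pl j (tt 0 j)" if "j < w" for j
    using tt(2)[of 0 j] that by (simp add: allowed_tile_def)
  have row0: "down_color (n_tapes M) (tt 0 j) = down_color (n_tapes M) (tile_of (config u 0) (int j - int off))"
    if j: "j < w" for j
  proof -
    note i = init[OF j, unfolded init_tile_def]
    let ?t = "tile_of (initial_config M (pair_word x u)) (int j - int off)"
    have "sym (tt 0 j) 0 = fst (word_tape (pair_word x u)) (int j - int off)"
    proof (cases rule: input_cases[where j = j and off = off and n = "length x" and pl = pl])
      case 1
      then have "sym (tt 0 j) 0 = 0" using i by blast
      then show ?thesis using word_tape_pair_word(1)[of "int j - int off" x u] 1 by simp
    next
      case (2 a)
      then have "sym (tt 0 j) 0 = 2" using i by blast
      moreover have "int j - int off = int (2 * a)" using 2 by simp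
      ultimately show ?thesis using word_tape_pair_word(2)[OF 2(1), of u] by simp
    next
      case (3 a)
      then have "sym (tt 0 j) 0 = bit_symbol (x ! a)" using i by blast
      moreover have "int j - int off = int (2 * a + 1)" using 3 by simp
      ultimately show ?thesis using word_tape_pair_word(3)[OF 3(1), of u] by simp
    next
      case 4
      then have "sym (tt 0 j) 0 = 1" using i by blast
      moreover have "int j - int off = int (2 * length x)" using 4 by simp
      ultimately show ?thesis using word_tape_pair_word(4)[of x u] by simp
    next
      case (5 b)
      have e: "int j - int off = int (2 * length x + 1 + b)" using 5 by simp
      have c: "sym (tt 0 j) 0 = cs b" using 5 by (simp add: cs_def)
      have "cs b \<le> 2" using i c by simp
      show ?thesis
      proof (cases "b < l")
        case True
        then have "cs b = bit_symbol (u ! b)" using l(3)[OF True] \<open>cs b \<le> 2\<close> by (auto simp: u_def bit_symbol_def)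
        then show ?thesis unfolding c e using word_tape_pair_word(5)[of b u x] True len_u by simp
      next
        case False
        then show ?thesis unfolding c e using word_tape_pair_word(6)[of u b x] blank[of b] 5 len_u by simp
      qed
    next
      case 6
      then have "sym (tt 0 j) 0 = 0" using i by blast
      moreover define b where "b = j - (off + (2 * length x + 1))"
      then have b: "j = off + (2 * length x + 1 + b)" "pl \<le> b" using 6 by simp_all
      then have "int j - int off = int (2 * length x + 1 + b)" by simp
      ultimately show ?thesis using word_tape_pair_word(6)[of u b x] b(2) len_u l(2) by simp
    qed
    moreover have "\<forall>l<n_tapes M. 0 < l \<longrightarrow> sym (tt 0 j) l = 0"
      by (rule i[THEN conjunct1, THEN conjunct2, THEN conjunct1])
    ultimately have "\<forall>l<n_tapes M. sym (tt 0 j) l = sym ?t l" by (simp add: tile_of_initial)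
    moreover have "\<forall>l<n_tapes M. flag_here (tt 0 j) l = flag_here ?t l"
      using i by (cases "j = off") (simp_all add: tile_of_initial)
    moreover have "fst (tt 0 j) = fst ?t" using i by (simp add: fst_tile_of) (simp add: initial_config_def)
    ultimately show ?thesis unfolding down_color_def by simp
  qed
  have v: "valid_config M (int i) (config u i)" for i by (rule valid_config_run[OF wf])
  \<comment> \<open>A row with the right down colours is right altogether. Its up colours then give
    the right down colours of the following row, which drives the induction below.\<close>
  have row: "tt i j = tile_of (config u i) (int j - int off)"
    if i: "i \<le> T" and d: "\<And>j. j < w \<Longrightarrow> down_color (n_tapes M) (tt i j) = down_color (n_tapes M) (tile_of (config u i) (int j - int off))"
      and j: "j < w" for i j
  proof (rule row_determined[OF v])
    show "int i \<le> int off" "int off + int i < int w" using i T_off off_w by simp_all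
    show "\<And>j. j < w \<Longrightarrow> tt i j \<in> tiles M" using tt(1) i by blast
    show "\<And>j. j + 1 < w \<Longrightarrow> right_color (n_tapes M) (tt i j) = left_color (n_tapes M) (tt i (j + 1))"
      using hor i by blast
    have "0 < w" using off_w by simp
    then show "\<And>l. l < n_tapes M \<Longrightarrow> \<not> flag_left (tt i 0) l" "\<And>l. l < n_tapes M \<Longrightarrow> \<not> flag_right (tt i (w - 1)) l"
      using tt(2)[OF i, of 0] tt(2)[OF i, of "w - 1"] by (simp_all add: allowed_tile_def)
  qed (use d j in auto)
  have all: "i \<le> T \<Longrightarrow> (\<forall>j<w. down_color (n_tapes M) (tt i j) = down_color (n_tapes M) (tile_of (config u i) (int j - int off)))" for i
  proof (induction i)
    case 0
    show ?case using row0 by simp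
  next
    case (Suc i)
    show ?case
    proof (intro allI impI)
      fix j assume j: "j < w"
      have "tt i j = tile_of (config u i) (int j - int off)" using row[of i j] Suc j by simp
      then show "down_color (n_tapes M) (tt (Suc i) j) = down_color (n_tapes M) (tile_of (config u (Suc i)) (int j - int off))"
        using ver[of i j] up_down_color_tile_of[OF wf v[of i], of "int j - int off"] Suc.prems j by simp
    qed
  qed
  have "off < w" using off_w by simp
  then have t: "tt T off = tile_of (config u T) 0" using row[of T off] all[of T] by simp
  have len: "length (snd (config u T)) = n_tapes M" using v[of T] by (simp add: valid_config_def)
  then have "snd (config u T) \<noteq> []" using tapes_pos by force
  then have "last (snd (config u T)) = snd (config u T) ! (n_tapes M - 1)" by (simp add: last_conv_nth len)
  moreover have "sym (tt T off) (n_tapes M - 1) = 2"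
    using tt(2)[of T off] \<open>off < w\<close> by (simp add: allowed_tile_def)
  moreover have "sym (tt T off) (n_tapes M - 1) = fst (snd (config u T) ! (n_tapes M - 1)) 0"
    unfolding t using tile_of_simps(1)[of "n_tapes M - 1" "snd (config u T)" "fst (config u T)" 0] len tapes_pos by simp
  ultimately show ?thesis using len_u l(2) by (intro exI[of _ u]) simp
qed

end

lemma halted_stable:
  assumes "(tm_step M ^^ t) c = (n_states M, tps)" "t \<le> T"
  shows "(tm_step M ^^ T) c = (n_states M, tps)"
proof -
  have "(tm_step M ^^ s) (n_states M, tps) = (n_states M, tps)" for s by (induction s) simp_all
  moreover have "(tm_step M ^^ T) c = (tm_step M ^^ (T - t)) ((tm_step M ^^ t) c)"
    using assms(2) by (metis funpow_add comp_apply le_add_diff_inverse2)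
  ultimately show ?thesis using assms(1) by simp
qed

lemma poly_nat_mono: "m \<le> n \<Longrightarrow> poly p m \<le> poly p (n :: nat)"
  by (induction p) (auto intro: add_mono mult_mono)

lemma class_NP_tiling:
  assumes "L \<in> class_NP"
  obtains M p q where "wf_tm M"
    "\<And>(x :: bool list) off T w pl. pl = poly p (length x) \<Longrightarrow> T = poly q (2 * length x + 1 + pl) \<Longrightarrow> off = T + 1 \<Longrightarrow>
      w = 2 * T + 3 + (2 * length x + 1) + pl \<Longrightarrow> x \<in> L \<longleftrightarrow> (\<exists>tt. tiling M off T w x pl tt)"
proof -
  obtain R p where R: "R \<in> class_P" "\<And>x. x \<in> L \<longleftrightarrow> (\<exists>u. length u \<le> poly p (length x) \<and> pair_word x u \<in> R)"
    using assms unfolding class_NP_def by blast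
  obtain M q where M: "wf_tm M" "computes_within M (\<lambda>x. [x \<in> R]) (poly q)"
    using R(1) unfolding class_P_def polytime_def by blast
  show ?thesis
  proof (rule that[OF M(1)])
    fix x :: "bool list" and off T w pl
    assume pl: "pl = poly p (length x)" and T: "T = poly q (2 * length x + 1 + pl)" and off: "off = T + 1"
      and w: "w = 2 * T + 3 + (2 * length x + 1) + pl"
    \<comment> \<open>The bound covers every word \<open>pair_word x u\<close> in question. At time
      \<open>T\<close> the machine has therefore halted and keeps showing its answer, and symbol 2
      in cell 0 of the last tape stands for \<open>True\<close>.\<close>
    have acc: "y \<in> R \<longleftrightarrow> fst (last (snd ((tm_step M ^^ T) (initial_config M y)))) 0 = 2"
      if "length y \<le> 2 * length x + 1 + pl" for y
    proof -
      obtain t tps where t: "t \<le> poly q (length y)" "(tm_step M ^^ t) (initial_config M y) = (n_states M, tps)"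
        "output_on_tape (last tps) [y \<in> R]"
        using M(2) unfolding computes_within_def by blast
      have "t \<le> T" unfolding T using le_trans[OF t(1) poly_nat_mono[OF that]] .
      from halted_stable[OF t(2) this] show ?thesis
        using t(3) by (auto simp: output_on_tape_def bit_symbol_def split: if_splits)
    qed
    have "x \<in> L \<longleftrightarrow> (\<exists>u. length u \<le> pl \<and> fst (last (snd ((tm_step M ^^ T) (initial_config M (pair_word x u))))) 0 = 2)"
      unfolding R(2) pl[symmetric] using acc by (intro arg_cong[of _ _ Ex] ext conj_cong refl) (simp add: length_pair_word)
    also have "\<dots> \<longleftrightarrow> (\<exists>tt. tiling M off T w x pl tt)"
      using tiling_of_run[OF M(1), of T off w x pl] run_of_tiling[OF M(1), of T off w x pl] off w by (intro iffI; elim exE conjE) simp_all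
    finally show "x \<in> L \<longleftrightarrow> (\<exists>tt. tiling M off T w x pl tt)" .
  qed
qed

section \<open>Ordered graphs as adjacency matrices\<close>

text \<open>Vertices are replaced by their ranks, since the encoding retains nothing else of
  them.\<close>

definition adj :: "'a::linorder ordered_graph \<Rightarrow> nat \<Rightarrow> nat \<Rightarrow> bool" where
  "adj G i j \<longleftrightarrow> {vertex_list G ! i, vertex_list G ! j} \<in> edges G"

definition encode_matrix :: "nat \<Rightarrow> (nat \<Rightarrow> nat \<Rightarrow> bool) \<Rightarrow> bool list" where
  "encode_matrix m A = replicate m True @ [False] @ concat (map (\<lambda>i. map (A i) [0..<m]) [0..<m])"

lemma vertex_list:
  assumes "finite (verts G)"
  shows "set (vertex_list G) = verts G" "length (vertex_list G) = card (verts G)"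
    "i < card (verts G) \<Longrightarrow> j < card (verts G) \<Longrightarrow> vertex_list G ! i < vertex_list G ! j \<longleftrightarrow> i < j"
    "i < card (verts G) \<Longrightarrow> j < card (verts G) \<Longrightarrow> vertex_list G ! i = vertex_list G ! j \<longleftrightarrow> i = j"
    "i < card (verts G) \<Longrightarrow> vertex_list G ! i \<in> verts G"
proof -
  show s: "set (vertex_list G) = verts G" "length (vertex_list G) = card (verts G)"
    using assms by (simp_all add: vertex_list_def)
  have lt: "vertex_list G ! i < vertex_list G ! j" if "i < j" "j < card (verts G)" for i j
    using strict_sorted_list_of_set[of "verts G"] that s(2)
    unfolding vertex_list_def[symmetric] by (simp add: sorted_wrt_iff_nth_less)
  show "i < card (verts G) \<Longrightarrow> j < card (verts G) \<Longrightarrow> vertex_list G ! i < vertex_list G ! j \<longleftrightarrow> i < j"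
    using lt[of i j] lt[of j i] by (cases i j rule: linorder_cases) auto
  show "i < card (verts G) \<Longrightarrow> j < card (verts G) \<Longrightarrow> vertex_list G ! i = vertex_list G ! j \<longleftrightarrow> i = j"
    using lt[of i j] lt[of j i] by (cases i j rule: linorder_cases) auto
  show "i < card (verts G) \<Longrightarrow> vertex_list G ! i \<in> verts G" using s nth_mem by metis
qed

lemma vertex_index:
  assumes "finite (verts G)" "v \<in> verts G"
  obtains i where "i < card (verts G)" "v = vertex_list G ! i"
  using assms vertex_list(1,2)[OF assms(1)] in_set_conv_nth[of v "vertex_list G"] by auto

lemma map_vertex_list:
  "finite (verts G) \<Longrightarrow> map f (vertex_list G) = map (\<lambda>i. f (vertex_list G ! i)) [0..<card (verts G)]"
  using vertex_list(2)[of G] by (intro nth_equalityI) auto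

lemma encode_graph_matrix: "encode_graph G = encode_matrix (card (verts G)) (adj G)"
proof (cases "finite (verts G)")
  case True
  show ?thesis
    unfolding encode_graph_def encode_matrix_def adj_def map_vertex_list[OF True] ..
qed (simp add: encode_graph_def encode_matrix_def vertex_list_def)

lemma length_concat_rows: "length (concat (map (\<lambda>i. map (A i) [0..<m]) [0..<n])) = n * m"
  by (induction n) auto

lemma nth_concat_rows:
  "i < n \<Longrightarrow> j < m \<Longrightarrow> concat (map (\<lambda>i. map (A i) [0..<m]) [0..<n]) ! (i * m + j) = A i j"
proof (induction n)
  case (Suc n)
  show ?case
  proof (cases "i < n")
    case True
    then have "Suc i * m \<le> n * m" by (intro mult_le_mono1) simp
    then have "i * m + j < n * m" using Suc.prems by simp
    then show ?thesis using Suc True by (simp add: nth_append length_concat_rows)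
  next
    case False
    then have "i = n" using Suc.prems by simp
    then show ?thesis using Suc.prems by (simp add: nth_append length_concat_rows)
  qed
qed simp

lemma length_encode_matrix: "length (encode_matrix m A) = m + 1 + m * m"
  by (simp add: encode_matrix_def length_concat_rows)

lemma nth_encode_matrix:
  "i < m \<Longrightarrow> encode_matrix m A ! i" "\<not> encode_matrix m A ! m"
  "i < m \<Longrightarrow> j < m \<Longrightarrow> encode_matrix m A ! (m + 1 + i * m + j) = A i j"
proof -
  show "i < m \<Longrightarrow> encode_matrix m A ! i" "\<not> encode_matrix m A ! m"
    by (simp_all add: encode_matrix_def nth_append)
  assume *: "i < m" "j < m"
  have "encode_matrix m A ! (m + (1 + (i * m + j))) = ([False] @ concat (map (\<lambda>i. map (A i) [0..<m]) [0..<m])) ! (1 + (i * m + j))"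
    unfolding encode_matrix_def by (subst nth_append) simp
  also have "\<dots> = A i j" using nth_concat_rows[OF *, of A] by simp
  finally show "encode_matrix m A ! (m + 1 + i * m + j) = A i j" by (simp add: add.assoc)
qed

lemma encode_matrix_cong:
  assumes "\<And>i j. i < m \<Longrightarrow> j < m \<Longrightarrow> A i j = B i j"
  shows "encode_matrix m A = encode_matrix m B"
  unfolding encode_matrix_def using assms by (intro arg_cong2[of _ _ _ _ append] arg_cong[of _ _ concat] map_cong refl) simp

text \<open>The first \<open>False\<close> reveals the size, and the size determines the position of
  every entry.\<close>

lemma encode_matrix_inject:
  assumes "encode_matrix m A = encode_matrix n B"
  shows "m = n" "i < m \<Longrightarrow> j < m \<Longrightarrow> A i j = B i j"
proof -
  show mn: "m = n"
  proof (cases m n rule: linorder_cases)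
    case less
    then show ?thesis using nth_encode_matrix(2)[of m A] nth_encode_matrix(1)[of m n B] assms by simp
  next
    case greater
    then show ?thesis using nth_encode_matrix(2)[of n B] nth_encode_matrix(1)[of n m A] assms by simp
  qed
  show "i < m \<Longrightarrow> j < m \<Longrightarrow> A i j = B i j"
    using nth_encode_matrix(3)[of i m j A] nth_encode_matrix(3)[of i n j B] assms mn by simp
qed

lemma encode_matrix_eqI:
  assumes len: "length w = m + 1 + m * m" and "\<And>i. i < m \<Longrightarrow> w ! i" and "\<not> w ! m"
    and "\<And>i j. i < m \<Longrightarrow> j < m \<Longrightarrow> w ! (m + 1 + i * m + j) = A i j"
  shows "w = encode_matrix m A"
proof (rule nth_equalityI)
  show "length w = length (encode_matrix m A)" by (simp add: len length_encode_matrix)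
  fix l assume l: "l < length w"
  consider "l < m" | "l = m" | "m + 1 \<le> l" by linarith
  then show "w ! l = encode_matrix m A ! l"
  proof cases
    case 3
    define r where "r = l - (m + 1)"
    have r: "l = m + 1 + r" "r < m * m" using 3 l len by (simp_all add: r_def)
    then have m: "0 < m" by (cases m) auto
    have "r div m < m" "r mod m < m" using r(2) m by (simp_all add: less_mult_imp_div_less)
    moreover have "l = m + 1 + r div m * m + r mod m" unfolding r(1) add.assoc by simp
    ultimately show ?thesis using assms(4)[of "r div m" "r mod m"] nth_encode_matrix(3)[of "r div m" m "r mod m" A] by simp
  qed (use assms nth_encode_matrix in auto)
qed

definition embeds :: "nat \<Rightarrow> (nat \<Rightarrow> nat \<Rightarrow> bool) \<Rightarrow> nat \<Rightarrow> (nat \<Rightarrow> nat \<Rightarrow> bool) \<Rightarrow> (nat \<Rightarrow> nat) \<Rightarrow> bool" where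
  "embeds k B m A h \<longleftrightarrow> (\<forall>i<k. h i < m) \<and> (\<forall>j<k. \<forall>i<j. h i < h j) \<and> (\<forall>i<k. \<forall>j<k. B i j = A (h i) (h j))"

lemma embeds_cong:
  assumes "\<And>i j. i < k \<Longrightarrow> j < k \<Longrightarrow> B i j = B' i j" "\<And>i j. i < m \<Longrightarrow> j < m \<Longrightarrow> A i j = A' i j" "embeds k B m A h"
  shows "embeds k B' m A' h"
  using assms unfolding embeds_def by simp

lemma ordered_induced_subgraph_adj:
  assumes "finite (verts N)" "finite (verts M)"
  shows "ordered_induced_subgraph N M \<longleftrightarrow> (\<exists>h. embeds (card (verts N)) (adj N) (card (verts M)) (adj M) h)"
proof
  assume "ordered_induced_subgraph N M"
  then obtain \<phi> where \<phi>: "\<phi> ` verts N \<subseteq> verts M"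
    "\<forall>u\<in>verts N. \<forall>v\<in>verts N. u < v \<longrightarrow> \<phi> u < \<phi> v"
    "\<forall>u\<in>verts N. \<forall>v\<in>verts N. {u, v} \<in> edges N \<longleftrightarrow> {\<phi> u, \<phi> v} \<in> edges M"
    unfolding ordered_induced_subgraph_def by (elim exE conjE)
  have "\<exists>a<card (verts M). \<phi> (vertex_list N ! i) = vertex_list M ! a" if i: "i < card (verts N)" for i
  proof -
    have "\<phi> (vertex_list N ! i) \<in> verts M" using \<phi>(1) vertex_list(5)[OF assms(1) i] by blast
    then show ?thesis using vertex_index[OF assms(2)] by metis
  qed
  then obtain h where h: "\<And>i. i < card (verts N) \<Longrightarrow> h i < card (verts M) \<and> \<phi> (vertex_list N ! i) = vertex_list M ! h i"
    by metis
  have "h i < h j" if "i < j" "j < card (verts N)" for i j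
  proof -
    have i: "i < card (verts N)" using that by simp
    have "vertex_list N ! i < vertex_list N ! j" using vertex_list(3)[OF assms(1) i that(2)] that(1) by simp
    then have "\<phi> (vertex_list N ! i) < \<phi> (vertex_list N ! j)"
      using \<phi>(2) vertex_list(5)[OF assms(1) i] vertex_list(5)[OF assms(1) that(2)] by blast
    then show ?thesis using h[OF i] h[OF that(2)] vertex_list(3)[OF assms(2)] by simp
  qed
  moreover have "adj N i j = adj M (h i) (h j)" if "i < card (verts N)" "j < card (verts N)" for i j
    using \<phi>(3) vertex_list(5)[OF assms(1) that(1)] vertex_list(5)[OF assms(1) that(2)] h[OF that(1)] h[OF that(2)]
    unfolding adj_def by simp
  ultimately have "embeds (card (verts N)) (adj N) (card (verts M)) (adj M) h"
    unfolding embeds_def using h by simp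
  then show "\<exists>h. embeds (card (verts N)) (adj N) (card (verts M)) (adj M) h" by (intro exI)
next
  assume "\<exists>h. embeds (card (verts N)) (adj N) (card (verts M)) (adj M) h"
  then obtain h where e: "embeds (card (verts N)) (adj N) (card (verts M)) (adj M) h" by blast
  have h: "\<And>i. i < card (verts N) \<Longrightarrow> h i < card (verts M)"
    "\<And>i j. i < j \<Longrightarrow> j < card (verts N) \<Longrightarrow> h i < h j"
    "\<And>i j. i < card (verts N) \<Longrightarrow> j < card (verts N) \<Longrightarrow> adj N i j = adj M (h i) (h j)"
    using e unfolding embeds_def by simp_all
  define idx where "idx v = (THE i. i < card (verts N) \<and> vertex_list N ! i = v)" for v
  have idx: "idx (vertex_list N ! i) = i" if "i < card (verts N)" for i
    unfolding idx_def using that vertex_list(4)[OF assms(1)] by (intro the_equality) auto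
  define \<phi> where "\<phi> v = vertex_list M ! h (idx v)" for v
  have \<phi>: "\<phi> (vertex_list N ! i) = vertex_list M ! h i" if "i < card (verts N)" for i
    using idx[OF that] by (simp add: \<phi>_def)
  have 1: "\<phi> ` verts N \<subseteq> verts M"
  proof
    fix w assume "w \<in> \<phi> ` verts N"
    then obtain v where "v \<in> verts N" "w = \<phi> v" by blast
    then obtain i where "i < card (verts N)" "w = \<phi> (vertex_list N ! i)" using vertex_index[OF assms(1)] by metis
    then show "w \<in> verts M" using \<phi> h(1) vertex_list(5)[OF assms(2)] by simp
  qed
  have 2: "\<phi> u < \<phi> v" if uv: "u \<in> verts N" "v \<in> verts N" "u < v" for u v
  proof -
    obtain i where i: "i < card (verts N)" "u = vertex_list N ! i"
      using vertex_index[OF assms(1) uv(1)] .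
    obtain j where j: "j < card (verts N)" "v = vertex_list N ! j"
      using vertex_index[OF assms(1) uv(2)] .
    then have "i < j" using i uv(3) vertex_list(3)[OF assms(1)] by simp
    then show ?thesis using i j \<phi> h(1,2) vertex_list(3)[OF assms(2)] by simp
  qed
  have 3: "inj_on \<phi> (verts N)"
  proof (rule inj_onI)
    fix u v assume "u \<in> verts N" "v \<in> verts N" "\<phi> u = \<phi> v"
    then show "u = v" using 2[of u v] 2[of v u] by (cases u v rule: linorder_cases) auto
  qed
  have 4: "{u, v} \<in> edges N \<longleftrightarrow> {\<phi> u, \<phi> v} \<in> edges M" if uv: "u \<in> verts N" "v \<in> verts N" for u v
  proof -
    obtain i where i: "i < card (verts N)" "u = vertex_list N ! i"
      using vertex_index[OF assms(1) uv(1)] .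
    obtain j where j: "j < card (verts N)" "v = vertex_list N ! j"
      using vertex_index[OF assms(1) uv(2)] .
    show ?thesis using h(3)[OF i(1) j(1)] \<phi>[OF i(1)] \<phi>[OF j(1)] unfolding adj_def i(2) j(2) by simp
  qed
  show "ordered_induced_subgraph N M"
    unfolding ordered_induced_subgraph_def by (rule exI[of _ \<phi>]) (intro conjI ballI impI 1 2 3 4)
qed

text \<open>Let \<open>w\<close> be the partner of \<open>u\<close> in \<open>N\<close>. Then
  \<open>{\<phi> u, \<phi> w}\<close> is the only edge of \<open>M\<close> at
  \<open>\<phi> u\<close>, so an edge \<open>{\<phi> u, \<phi> v}\<close> forces
  \<open>v = w\<close> by injectivity.\<close>

lemma ordered_subgraph_iff_induced:
  assumes "ordered_matching M" "ordered_matching N"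
  shows "ordered_subgraph N M \<longleftrightarrow> ordered_induced_subgraph N M"
proof
  assume "ordered_subgraph N M"
  then obtain \<phi> where \<phi>: "\<phi> ` verts N \<subseteq> verts M" "inj_on \<phi> (verts N)"
    "\<forall>u\<in>verts N. \<forall>v\<in>verts N. u < v \<longrightarrow> \<phi> u < \<phi> v"
    "\<forall>u\<in>verts N. \<forall>v\<in>verts N. {u, v} \<in> edges N \<longrightarrow> {\<phi> u, \<phi> v} \<in> edges M"
    unfolding ordered_subgraph_def by (elim exE conjE)
  have "{u, v} \<in> edges N" if uv: "u \<in> verts N" "v \<in> verts N" "{\<phi> u, \<phi> v} \<in> edges M" for u v
  proof -
    obtain e where e: "e \<in> edges N" "u \<in> e" using assms(2) uv(1) unfolding ordered_matching_def by blast
    have "card e = 2" "e \<subseteq> verts N" using assms(2) e(1) unfolding ordered_matching_def ordered_graph_def by auto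
    then obtain w where w: "e = {u, w}" "w \<in> verts N" using e(2) by (auto simp: card_2_iff)
    then have "{\<phi> u, \<phi> w} \<in> edges M" using \<phi>(4) uv(1) e(1) by blast
    moreover have "\<phi> u \<in> verts M" using \<phi>(1) uv(1) by blast
    ultimately have "{\<phi> u, \<phi> w} = {\<phi> u, \<phi> v}"
      using assms(1) uv(3) unfolding ordered_matching_def by blast
    then have "\<phi> w = \<phi> v" by (auto simp: doubleton_eq_iff)
    then have "w = v" using \<phi>(2) w(2) uv(2) by (auto dest: inj_onD)
    then show ?thesis using e(1) w(1) by simp
  qed
  then show "ordered_induced_subgraph N M"
    unfolding ordered_induced_subgraph_def using \<phi> by (intro exI[of _ \<phi>]) blast
next
  assume "ordered_induced_subgraph N M"
  then show "ordered_subgraph N M" unfolding ordered_induced_subgraph_def ordered_subgraph_def by blast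
qed

lemma languages_eq: "separated_matching_subgraph = separated_matching_induced_subgraph"
  unfolding separated_matching_subgraph_def separated_matching_induced_subgraph_def
  using ordered_subgraph_iff_induced by blast

section \<open>Adjacency matrices of separated matchings\<close>

definition separated_matrix :: "nat \<Rightarrow> (nat \<Rightarrow> nat \<Rightarrow> bool) \<Rightarrow> bool" where
  "separated_matrix m A \<longleftrightarrow> (\<forall>i<m. \<forall>j<m. A i j = A j i) \<and> (\<forall>i<m. \<not> A i i) \<and> (\<forall>i<m. \<exists>j<m. A i j) \<and>
     (\<forall>i<m. \<forall>j<m. \<forall>l<m. A i j \<and> A i l \<longrightarrow> j = l) \<and>
     (\<exists>c<m. 1 \<le> c \<and> (\<forall>i<m. \<forall>j<m. A i j \<longrightarrow> i < c \<longleftrightarrow> \<not> j < c))"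

lemma separated_matrixD:
  assumes "separated_matrix m A"
  shows "i < m \<Longrightarrow> j < m \<Longrightarrow> A i j = A j i" "i < m \<Longrightarrow> \<not> A i i" "i < m \<Longrightarrow> \<exists>j<m. A i j"
    "i < m \<Longrightarrow> j < m \<Longrightarrow> l < m \<Longrightarrow> A i j \<Longrightarrow> A i l \<Longrightarrow> j = l"
    "\<exists>c<m. 1 \<le> c \<and> (\<forall>i<m. \<forall>j<m. A i j \<longrightarrow> i < c \<longleftrightarrow> \<not> j < c)"
proof -
  note A = assms[unfolded separated_matrix_def]
  show "i < m \<Longrightarrow> j < m \<Longrightarrow> A i j = A j i" using A[THEN conjunct1] by simp
  show "i < m \<Longrightarrow> \<not> A i i" using A[THEN conjunct2, THEN conjunct1] by simp
  show "i < m \<Longrightarrow> \<exists>j<m. A i j" using A[THEN conjunct2, THEN conjunct2, THEN conjunct1] by simp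
  show "i < m \<Longrightarrow> j < m \<Longrightarrow> l < m \<Longrightarrow> A i j \<Longrightarrow> A i l \<Longrightarrow> j = l"
    using A[THEN conjunct2, THEN conjunct2, THEN conjunct2, THEN conjunct1] by blast
  show "\<exists>c<m. 1 \<le> c \<and> (\<forall>i<m. \<forall>j<m. A i j \<longrightarrow> i < c \<longleftrightarrow> \<not> j < c)"
    by (rule A[THEN conjunct2, THEN conjunct2, THEN conjunct2, THEN conjunct2])
qed

lemma separated_matrix_cong:
  assumes "\<And>i j. i < m \<Longrightarrow> j < m \<Longrightarrow> A i j = B i j" "separated_matrix m A"
  shows "separated_matrix m B"
proof -
  have "\<exists>j<m. B i j" if i: "i < m" for i
  proof -
    obtain j where "j < m" "A i j" using separated_matrixD(3)[OF assms(2) i] by blast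
    then show ?thesis using assms(1)[OF i] by auto
  qed
  then show ?thesis using assms(2) unfolding separated_matrix_def by (simp add: assms(1))
qed

lemma separated_matrix_adj:
  assumes "ordered_matching G" "separated G"
  shows "separated_matrix (card (verts G)) (adj G)"
proof -
  have fin: "finite (verts G)" and e: "\<And>e. e \<in> edges G \<Longrightarrow> e \<subseteq> verts G \<and> card e = 2"
    and uniq: "\<And>v. v \<in> verts G \<Longrightarrow> \<exists>!e. e \<in> edges G \<and> v \<in> e"
    using assms(1) unfolding ordered_matching_def ordered_graph_def by auto
  let ?m = "card (verts G)"
  have 1: "adj G i j = adj G j i" for i j by (simp add: adj_def insert_commute)
  have 2: "\<not> adj G i i" for i
  proof
    assume "adj G i i"
    then have "card {vertex_list G ! i} = 2" using e unfolding adj_def by fastforce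
    then show False by simp
  qed
  have 3: "\<exists>j<?m. adj G i j" if i: "i < ?m" for i
  proof -
    have v: "vertex_list G ! i \<in> verts G" using vertex_list(5)[OF fin i] .
    then obtain d where d: "d \<in> edges G" "vertex_list G ! i \<in> d" using uniq by blast
    then obtain w where w: "d = {vertex_list G ! i, w}" "w \<in> verts G" using e[OF d(1)] by (auto simp: card_2_iff)
    obtain j where "j < ?m" "w = vertex_list G ! j" using vertex_index[OF fin w(2)] .
    then show ?thesis using d(1) w(1) by (auto simp: adj_def)
  qed
  have 4: "j = l" if "i < ?m" "j < ?m" "l < ?m" "adj G i j" "adj G i l" for i j l
  proof -
    have "{vertex_list G ! i, vertex_list G ! j} = {vertex_list G ! i, vertex_list G ! l}"
      using uniq[OF vertex_list(5)[OF fin that(1)]] that(4,5) unfolding adj_def by blast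
    then have "vertex_list G ! j = vertex_list G ! l" by (auto simp: doubleton_eq_iff)
    then show ?thesis using vertex_list(4)[OF fin that(2,3)] by simp
  qed
  obtain c where c: "1 \<le> c" "c \<le> ?m - 1" "\<And>e. e \<in> edges G \<Longrightarrow> goes_across e (cut G c)"
    using assms(2) unfolding separated_def by auto
  have cm: "c < ?m" using c(1,2) by simp
  have take: "vertex_list G ! i \<in> set (take c (vertex_list G)) \<longleftrightarrow> i < c" if i: "i < ?m" for i
  proof
    assume "vertex_list G ! i \<in> set (take c (vertex_list G))"
    then obtain l where "l < c" "l < ?m" "vertex_list G ! l = vertex_list G ! i"
      using vertex_list(2)[OF fin] by (auto simp: in_set_conv_nth)
    then show "i < c" using vertex_list(4)[OF fin _ i, of l] by simp
  next
    assume "i < c"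
    then show "vertex_list G ! i \<in> set (take c (vertex_list G))"
      using i vertex_list(2)[OF fin] by (auto simp: in_set_conv_nth intro!: exI[of _ i])
  qed
  have drop: "vertex_list G ! i \<in> set (drop c (vertex_list G)) \<longleftrightarrow> \<not> i < c" if i: "i < ?m" for i
  proof -
    have "set (take c (vertex_list G)) \<union> set (drop c (vertex_list G)) = set (vertex_list G)"
      by (metis append_take_drop_id set_append)
    moreover have "set (take c (vertex_list G)) \<inter> set (drop c (vertex_list G)) = {}"
      by (rule set_take_disj_set_drop_if_distinct) (simp_all add: vertex_list_def)
    moreover have "vertex_list G ! i \<in> set (vertex_list G)" using i vertex_list(2)[OF fin] by simp
    ultimately show ?thesis using take[OF i] by blast
  qed
  have 5: "i < c \<longleftrightarrow> \<not> j < c" if ij: "i < ?m" "j < ?m" "adj G i j" for i j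
  proof -
    obtain u v where uv: "u \<in> set (take c (vertex_list G))" "v \<in> set (drop c (vertex_list G))"
      "{vertex_list G ! i, vertex_list G ! j} = {u, v}"
      using c(3) ij(3) unfolding adj_def goes_across_def cut_def by fastforce
    then show ?thesis using take[OF ij(1)] take[OF ij(2)] drop[OF ij(1)] drop[OF ij(2)] by (auto simp: doubleton_eq_iff)
  qed
  have "\<exists>c<?m. 1 \<le> c \<and> (\<forall>i<?m. \<forall>j<?m. adj G i j \<longrightarrow> i < c \<longleftrightarrow> \<not> j < c)"
    by (rule exI[of _ c]) (simp add: cm c(1)[simplified] 5)
  then show ?thesis unfolding separated_matrix_def using 1 2 3 4 by blast
qed

definition matrix_graph :: "nat \<Rightarrow> (nat \<Rightarrow> nat \<Rightarrow> bool) \<Rightarrow> nat ordered_graph" where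
  "matrix_graph m A = \<lparr>verts = {..<m}, edges = {{i, j} | i j. i < m \<and> j < m \<and> A i j}\<rparr>"

lemma matrix_graph_simps:
  "verts (matrix_graph m A) = {..<m}" "card (verts (matrix_graph m A)) = m"
  "vertex_list (matrix_graph m A) = [0..<m]"
  by (simp_all add: matrix_graph_def vertex_list_def lessThan_atLeast0)

lemma matrix_graph:
  assumes A: "separated_matrix m A"
  shows "i < m \<Longrightarrow> j < m \<Longrightarrow> adj (matrix_graph m A) i j = A i j"
    "ordered_matching (matrix_graph m A)" "separated (matrix_graph m A)"
proof -
  have sym: "A i j = A j i" if "i < m" "j < m" for i j using separated_matrixD(1)[OF A that] .
  have edge: "{i, j} \<in> edges (matrix_graph m A) \<longleftrightarrow> A i j" if "i < m" "j < m" for i j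
    using that sym by (auto simp: matrix_graph_def doubleton_eq_iff)
  show "i < m \<Longrightarrow> j < m \<Longrightarrow> adj (matrix_graph m A) i j = A i j"
    unfolding adj_def matrix_graph_simps by (simp add: edge)
  have graph: "ordered_graph (matrix_graph m A)"
    unfolding ordered_graph_def
  proof (intro conjI ballI)
    fix e assume "e \<in> edges (matrix_graph m A)"
    then obtain i j where e: "e = {i, j}" "i < m" "j < m" "A i j" by (auto simp: matrix_graph_def)
    then have "i \<noteq> j" using separated_matrixD(2)[OF A] by blast
    then show "e \<subseteq> verts (matrix_graph m A)" "card e = 2" using e by (simp_all add: matrix_graph_simps)
  qed (simp add: matrix_graph_simps)
  show "ordered_matching (matrix_graph m A)"
    unfolding ordered_matching_def
  proof (intro conjI ballI graph)
    fix v assume "v \<in> verts (matrix_graph m A)"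
    then have v: "v < m" by (simp add: matrix_graph_simps)
    then obtain j where j: "j < m" "A v j" using separated_matrixD(3)[OF A v] by blast
    show "\<exists>!e. e \<in> edges (matrix_graph m A) \<and> v \<in> e"
    proof (rule ex1I[of _ "{v, j}"])
      fix e assume "e \<in> edges (matrix_graph m A) \<and> v \<in> e"
      then obtain a b where e: "e = {a, b}" "a < m" "b < m" "A a b" "v = a \<or> v = b" by (auto simp: matrix_graph_def)
      then obtain l where l: "e = {v, l}" "l < m" "A v l" using sym[of a b] by (elim disjE) (auto simp: insert_commute)
      then have "l = j" using separated_matrixD(4)[OF A v _ j(1) _ j(2)] by blast
      then show "e = {v, j}" using l by simp
    qed (use edge[OF v j(1)] j in simp)
  qed
  obtain c where c: "c < m" "1 \<le> c" "\<And>i j. i < m \<Longrightarrow> j < m \<Longrightarrow> A i j \<Longrightarrow> i < c \<longleftrightarrow> \<not> j < c"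
    using separated_matrixD(5)[OF A] by blast
  have cut: "cut (matrix_graph m A) c = ({0..<c}, {c..<m})"
    unfolding cut_def matrix_graph_simps using c by (simp add: take_upt drop_upt)
  have "\<forall>e\<in>edges (matrix_graph m A). goes_across e (cut (matrix_graph m A) c)"
  proof
    fix e assume "e \<in> edges (matrix_graph m A)"
    then obtain i j where e: "e = {i, j}" "i < m" "j < m" "A i j" by (auto simp: matrix_graph_def)
    have "i < c \<longleftrightarrow> \<not> j < c" by (rule c(3)[OF e(2-4)])
    then show "goes_across e (cut (matrix_graph m A) c)"
      unfolding cut goes_across_def fst_conv snd_conv e(1) using e(2,3)
      by (cases "i < c") (auto simp: doubleton_eq_iff)
  qed
  then show "separated (matrix_graph m A)"
    unfolding separated_def matrix_graph_simps using c(1,2) by (intro bexI[of _ c]) auto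
qed

lemma in_language_iff:
  "x \<in> separated_matching_induced_subgraph \<longleftrightarrow>
    (\<exists>m A k B h. x = pair_word (encode_matrix m A) (encode_matrix k B) \<and>
       separated_matrix m A \<and> separated_matrix k B \<and> embeds k B m A h)"
proof
  assume "x \<in> separated_matching_induced_subgraph"
  then obtain M N :: "nat ordered_graph" where x: "x = pair_word (encode_graph M) (encode_graph N)"
    and M: "ordered_matching M" "separated M" and N: "ordered_matching N" "separated N"
    and sub: "ordered_induced_subgraph N M"
    unfolding separated_matching_induced_subgraph_def by blast
  have "finite (verts M)" "finite (verts N)" using M(1) N(1) by (simp_all add: ordered_matching_def ordered_graph_def)
  then obtain h where "embeds (card (verts N)) (adj N) (card (verts M)) (adj M) h"
    using sub ordered_induced_subgraph_adj by blast
  then show "\<exists>m A k B h. x = pair_word (encode_matrix m A) (encode_matrix k B) \<and>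
       separated_matrix m A \<and> separated_matrix k B \<and> embeds k B m A h"
    using x separated_matrix_adj[OF M] separated_matrix_adj[OF N] unfolding encode_graph_matrix by blast
next
  assume "\<exists>m A k B h. x = pair_word (encode_matrix m A) (encode_matrix k B) \<and>
       separated_matrix m A \<and> separated_matrix k B \<and> embeds k B m A h"
  then obtain m A k B h where x: "x = pair_word (encode_matrix m A) (encode_matrix k B)"
    and A: "separated_matrix m A" and B: "separated_matrix k B" and h: "embeds k B m A h" by blast
  have e: "encode_matrix m A = encode_graph (matrix_graph m A)" if "separated_matrix m A" for m A
    unfolding encode_graph_matrix matrix_graph_simps(2) using matrix_graph(1)[OF that] by (intro encode_matrix_cong) simp
  have "embeds k (adj (matrix_graph k B)) m (adj (matrix_graph m A)) h"
    by (rule embeds_cong[OF _ _ h]) (simp_all add: matrix_graph(1)[OF A] matrix_graph(1)[OF B])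
  then have "ordered_induced_subgraph (matrix_graph k B) (matrix_graph m A)"
    using ordered_induced_subgraph_adj[of "matrix_graph k B" "matrix_graph m A"] by (auto simp: matrix_graph_simps)
  then show "x \<in> separated_matching_induced_subgraph"
    unfolding separated_matching_induced_subgraph_def x e[OF A] e[OF B]
    using matrix_graph(2,3)[OF A] matrix_graph(2,3)[OF B] by blast
qed

text \<open>Membership may be witnessed by other graphs than \<open>M\<close> and \<open>N\<close>.
  Equal encodings have equal adjacency matrices, however, so the embedding carries over.\<close>

lemma pair_encode_in_language_iff:
  fixes M N :: "nat ordered_graph"
  assumes "ordered_matching M" "separated M" "ordered_matching N" "separated N"
  shows "pair_word (encode_graph M) (encode_graph N) \<in> separated_matching_induced_subgraph \<longleftrightarrow> ordered_induced_subgraph N M"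
proof
  assume "pair_word (encode_graph M) (encode_graph N) \<in> separated_matching_induced_subgraph"
  then obtain m A k B h where e: "encode_graph M = encode_matrix m A" "encode_graph N = encode_matrix k B"
    and h: "embeds k B m A h"
    unfolding in_language_iff pair_word_inject by blast
  have fin: "finite (verts M)" "finite (verts N)"
    using assms by (simp_all add: ordered_matching_def ordered_graph_def)
  note eM = encode_matrix_inject[OF e(1)[unfolded encode_graph_matrix]]
    and eN = encode_matrix_inject[OF e(2)[unfolded encode_graph_matrix]]
  have "embeds (card (verts N)) (adj N) (card (verts M)) (adj M) h"
    unfolding eM(1) eN(1) by (rule embeds_cong[OF _ _ h]) (use eM eN in simp_all)
  then show "ordered_induced_subgraph N M" using ordered_induced_subgraph_adj[OF fin(2,1)] by blast
next
  assume "ordered_induced_subgraph N M"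
  then show "pair_word (encode_graph M) (encode_graph N) \<in> separated_matching_induced_subgraph"
    unfolding separated_matching_induced_subgraph_def using assms by blast
qed

section \<open>Membership in NP\<close>

text \<open>
  An embedding is certified by the characteristic word of its image; the rank of a selected vertex
  among the selected ones is its preimage.
\<close>

definition selects :: "nat \<Rightarrow> (nat \<Rightarrow> nat \<Rightarrow> bool) \<Rightarrow> nat \<Rightarrow> (nat \<Rightarrow> nat \<Rightarrow> bool) \<Rightarrow> (nat \<Rightarrow> bool) \<Rightarrow> bool" where
  "selects k B m A U \<longleftrightarrow> (\<Sum>i<m. of_bool (U i)) = k \<and>
     (\<forall>i<m. \<forall>j<m. U i \<and> U j \<longrightarrow> A i j = B (\<Sum>l<i. of_bool (U l)) (\<Sum>l<j. of_bool (U l)))"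

lemma sum_of_bool_card:
  fixes m :: nat
  shows "(\<Sum>i<m. of_bool (U i) :: nat) = card {i. i < m \<and> U i}"
proof (induction m)
  case (Suc m)
  have "{i. i < Suc m \<and> U i} = (if U m then insert m {i. i < m \<and> U i} else {i. i < m \<and> U i})"
    by (auto simp: less_Suc_eq)
  then show ?case using Suc by simp
qed simp

lemma selects_of_embeds:
  assumes "embeds k B m A h"
  shows "selects k B m A (\<lambda>i. i \<in> h ` {..<k})"
proof -
  have h: "\<And>i. i < k \<Longrightarrow> h i < m" "\<And>i j. i < j \<Longrightarrow> j < k \<Longrightarrow> h i < h j"
    "\<And>i j. i < k \<Longrightarrow> j < k \<Longrightarrow> B i j = A (h i) (h j)"
    using assms unfolding embeds_def by simp_all
  have inj: "inj_on h {..<k}"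
  proof (rule inj_onI)
    fix i j assume "i \<in> {..<k}" "j \<in> {..<k}" "h i = h j"
    then show "i = j" using h(2)[of i j] h(2)[of j i] by (cases i j rule: linorder_cases) auto
  qed
  \<comment> \<open>The selected numbers below \<open>h i\<close> are the images of the
    \<open>i\<close> numbers below \<open>i\<close>.\<close>
  have rank: "(\<Sum>l<h i. of_bool (l \<in> h ` {..<k})) = i" if i: "i < k" for i
  proof -
    have "{l. l < h i \<and> l \<in> h ` {..<k}} = h ` {..<i}"
    proof (intro equalityI subsetI)
      fix l assume "l \<in> {l. l < h i \<and> l \<in> h ` {..<k}}"
      then obtain j where j: "l = h j" "j < k" "h j < h i" by auto
      have "j < i" using j(2,3) h(2)[of i j] by (cases i j rule: linorder_cases) auto
      then show "l \<in> h ` {..<i}" using j(1) by simp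
    next
      fix l assume "l \<in> h ` {..<i}"
      then show "l \<in> {l. l < h i \<and> l \<in> h ` {..<k}}" using h(2)[OF _ i] i by auto
    qed
    moreover have "inj_on h {..<i}" using inj by (rule inj_on_subset) (use i in auto)
    ultimately show ?thesis unfolding sum_of_bool_card by (simp add: card_image)
  qed
  have "{l. l < m \<and> l \<in> h ` {..<k}} = h ` {..<k}" using h(1) by auto
  then have "(\<Sum>i<m. of_bool (i \<in> h ` {..<k}) :: nat) = k"
    unfolding sum_of_bool_card using card_image[OF inj] by simp
  moreover have "A i j = B (\<Sum>l<i. of_bool (l \<in> h ` {..<k})) (\<Sum>l<j. of_bool (l \<in> h ` {..<k}))"
    if ij: "i \<in> h ` {..<k}" "j \<in> h ` {..<k}" for i j
  proof -
    obtain a where a: "i = h a" "a < k" using ij(1) by auto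
    obtain b where b: "j = h b" "b < k" using ij(2) by auto
    show ?thesis unfolding a(1) b(1) rank[OF a(2)] rank[OF b(2)] using h(3)[OF a(2) b(2)] by simp
  qed
  ultimately show ?thesis unfolding selects_def by blast
qed

text \<open>The rank is a strictly increasing bijection from the selected vertices onto
  \<open>{..<k}\<close>; its inverse is the embedding.\<close>

lemma embeds_of_selects:
  assumes "selects k B m A U"
  shows "\<exists>h. embeds k B m A h"
proof -
  define r where "r i = (\<Sum>l<i. of_bool (U l) :: nat)" for i
  define S where "S = {i. i < m \<and> U i}"
  have k: "card S = k" and A: "\<And>i j. i \<in> S \<Longrightarrow> j \<in> S \<Longrightarrow> A i j = B (r i) (r j)"
    using assms unfolding selects_def r_def S_def sum_of_bool_card by simp_all
  have mono: "r i < r j" if "i \<in> S" "i < j" for i j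
  proof -
    have "r (Suc i) \<le> r j" unfolding r_def by (rule sum_mono2) (use that in auto)
    moreover have "r (Suc i) = Suc (r i)" using that(1) by (simp add: r_def S_def)
    ultimately show ?thesis by simp
  qed
  have rk: "r i < k" if "i \<in> S" for i
    using mono[OF that, of m] that k unfolding r_def S_def sum_of_bool_card by simp
  have inj: "inj_on r S"
  proof (rule inj_onI)
    fix i j assume "i \<in> S" "j \<in> S" "r i = r j"
    then show "i = j" using mono[of i j] mono[of j i] by (cases i j rule: linorder_cases) auto
  qed
  have "r ` S = {..<k}"
  proof (rule card_subset_eq)
    show "r ` S \<subseteq> {..<k}" using rk by auto
    show "card (r ` S) = card {..<k}" using card_image[OF inj] k by simp
  qed simp
  then have h: "inv_into S r i \<in> S" "r (inv_into S r i) = i" if "i < k" for i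
    using that by (simp_all add: inv_into_into f_inv_into_f)
  have "inv_into S r i < inv_into S r j" if "i < j" "j < k" for i j
  proof (rule ccontr)
    assume "\<not> ?thesis"
    then consider "inv_into S r j < inv_into S r i" | "inv_into S r j = inv_into S r i" by linarith
    then have "j \<le> i"
    proof cases
      case 1
      then show ?thesis using mono[OF h(1)[OF that(2)] 1] h(2)[of i] h(2)[of j] that by simp
    next
      case 2
      then show ?thesis using h(2)[of i] h(2)[of j] that by simp
    qed
    then show False using that(1) by simp
  qed
  then have "embeds k B m A (inv_into S r)"
    unfolding embeds_def using h A by (simp add: S_def)
  then show ?thesis by (intro exI)
qed

lemma pair_word_decode:
  assumes len: "length z = 2 * lx + 1 + lu" and "\<And>i. i < lx \<Longrightarrow> z ! (2 * i)" and "\<not> z ! (2 * lx)"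
  shows "z = pair_word (map (\<lambda>i. z ! (2 * i + 1)) [0..<lx]) (map (\<lambda>i. z ! (2 * lx + 1 + i)) [0..<lu])"
    (is "z = pair_word ?x ?u")
proof (rule nth_equalityI)
  have lx: "length ?x = lx" and lu: "length ?u = lu" by simp_all
  show "length z = length (pair_word ?x ?u)" unfolding length_pair_word lx lu len ..
  fix i assume i: "i < length z"
  show "z ! i = pair_word ?x ?u ! i"
  proof (cases rule: input_cases[where j = i and off = 0 and n = lx and pl = lu])
    case (2 a)
    then have "i = 2 * a" by simp
    then show ?thesis using nth_pair_word(1)[of a ?x ?u] assms(2)[OF 2(1)] 2(1) by simp
  next
    case (3 a)
    then have e: "i = 2 * a + 1" by simp
    show ?thesis unfolding e using nth_pair_word(2)[of a ?x ?u] 3(1) by simp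
  next
    case 4
    then have "i = 2 * lx" by simp
    then show ?thesis using nth_pair_word(3)[of ?x ?u] assms(3) unfolding lx by simp
  next
    case (5 b)
    then have e: "i = 2 * lx + 1 + b" by simp
    show ?thesis unfolding e using nth_pair_word(4)[of ?x ?u b] 5(1) unfolding lx by simp
  qed (use i len in auto)
qed

section \<open>The verifier\<close>

definition word_bit :: "bool list \<Rightarrow> nat \<Rightarrow> bool" where
  "word_bit z i \<longleftrightarrow> i < length z \<and> z ! i"

definition code_length :: "nat \<Rightarrow> nat" where
  "code_length m = m + 1 + m * m"

definition pair_length :: "nat \<Rightarrow> nat \<Rightarrow> nat" where
  "pair_length m k = 2 * code_length m + 1 + code_length k"

text \<open>
  In a word \<open>pair_word (pair_word v w) u\<close>, bit \<open>i\<close> of \<open>v\<close> has position \<open>2 (2 i + 1) + 1\<close> and bit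
  \<open>i\<close> of \<open>w\<close> has position \<open>2 (2 |v| + 1 + i) + 1\<close>.
\<close>

definition host_bit where "host_bit z i \<longleftrightarrow> word_bit z (2 * (2 * i + 1) + 1)"
definition guest_bit where "guest_bit z m i \<longleftrightarrow> word_bit z (2 * (2 * code_length m + 1 + i) + 1)"
definition certificate_bit where "certificate_bit z m k i \<longleftrightarrow> word_bit z (2 * pair_length m k + 1 + i)"
definition host_entry where "host_entry z m i j \<longleftrightarrow> host_bit z (m + 1 + i * m + j)"
definition guest_entry where "guest_entry z m k i j \<longleftrightarrow> guest_bit z m (k + 1 + i * k + j)"

text \<open>The format is spelled out bit by bit, because a definable predicate sees the word only
  through its length and its bits. The certificate has exactly one bit for each vertex of the
  host.\<close>

definition verify :: "bool list \<Rightarrow> nat \<Rightarrow> nat \<Rightarrow> bool" where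
  "verify z m k \<longleftrightarrow> length z = 2 * pair_length m k + 1 + m \<and>
     (\<forall>i<pair_length m k. word_bit z (2 * i)) \<and> \<not> word_bit z (2 * pair_length m k) \<and>
     (\<forall>i<code_length m. word_bit z (2 * (2 * i) + 1)) \<and> \<not> word_bit z (2 * (2 * code_length m) + 1) \<and>
     (\<forall>i<m. host_bit z i) \<and> \<not> host_bit z m \<and> (\<forall>i<k. guest_bit z m i) \<and> \<not> guest_bit z m k \<and>
     separated_matrix m (host_entry z m) \<and> separated_matrix k (guest_entry z m k) \<and>
     selects k (guest_entry z m k) m (host_entry z m) (certificate_bit z m k)"

lemma word_bit_pair:
  assumes "z = pair_word (pair_word v w) u"
  shows "i < length v \<Longrightarrow> word_bit z (2 * (2 * i)+ 1)" "i < length v \<Longrightarrow> host_bit z i = v ! i"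
    "\<not> word_bit z (2 * (2 * length v) + 1)"
    "length v = code_length m \<Longrightarrow> i < length w \<Longrightarrow> guest_bit z m i = w ! i"
    "i < 2 * length v + 1 + length w \<Longrightarrow> word_bit z (2 * i)"
    "\<not> word_bit z (2 * (2 * length v + 1 + length w))"
    "i < length u \<Longrightarrow> word_bit z (2 * (2 * length v + 1 + length w) + 1 + i) = u ! i"
proof -
  let ?x = "pair_word v w"
  have lz: "length z = 2 * (2 * length v + 1 + length w) + 1 + length u" and lx: "length ?x = 2 * length v + 1 + length w"
    unfolding assms length_pair_word by simp_all
  have x: "word_bit z (2 * j + 1) = ?x ! j" if "j < length ?x" for j
    unfolding word_bit_def using nth_pair_word(2)[OF that, of u] that lz lx by (simp add: assms)
  show "i < length v \<Longrightarrow> word_bit z (2 * (2 * i)+ 1)" using x[of "2 * i"] nth_pair_word(1)[of i v w] lx by simp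
  show "i < length v \<Longrightarrow> host_bit z i = v ! i"
    unfolding host_bit_def using x[of "2 * i + 1"] nth_pair_word(2)[of i v w] lx by simp
  show "\<not> word_bit z (2 * (2 * length v) + 1)" using x[of "2 * length v"] nth_pair_word(3)[of v w] lx by simp
  show "length v = code_length m \<Longrightarrow> i < length w \<Longrightarrow> guest_bit z m i = w ! i"
    unfolding guest_bit_def using x[of "2 * length v + 1 + i"] nth_pair_word(4)[of v w i] lx by simp
  show "i < 2 * length v + 1 + length w \<Longrightarrow> word_bit z (2 * i)"
    unfolding word_bit_def using nth_pair_word(1)[of i ?x u] lz lx by (simp add: assms)
  show "\<not> word_bit z (2 * (2 * length v + 1 + length w))"
    unfolding word_bit_def using nth_pair_word(3)[of ?x u] lx by (simp add: assms)
  show "i < length u \<Longrightarrow> word_bit z (2 * (2 * length v + 1 + length w) + 1 + i) = u ! i"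
    unfolding word_bit_def using nth_pair_word(4)[of ?x u i] lz lx by (simp add: assms)
qed

lemma selects_cong:
  assumes "\<And>i. i < m \<Longrightarrow> U i = U' i" "\<And>i j. i < m \<Longrightarrow> j < m \<Longrightarrow> A i j = A' i j"
    "\<And>i j. i < k \<Longrightarrow> j < k \<Longrightarrow> B i j = B' i j" "selects k B m A U"
  shows "selects k B' m A' U'"
proof -
  have s: "(\<Sum>l<i. of_bool (U l) :: nat) = (\<Sum>l<i. of_bool (U' l))" if "i \<le> m" for i
    using assms(1) that by (intro sum.cong) auto
  have k: "(\<Sum>i<m. of_bool (U i)) = k" using assms(4) unfolding selects_def by (rule conjunct1)
  \<comment> \<open>Selected vertices have ranks below \<open>k\<close>, where the assumption on
    \<open>B\<close> applies.\<close>
  have rk: "(\<Sum>l<i. of_bool (U l)) < k" if "i < m" "U i" for i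
  proof -
    have "(\<Sum>l<Suc i. of_bool (U l) :: nat) \<le> (\<Sum>l<m. of_bool (U l))" by (rule sum_mono2) (use that in auto)
    then show ?thesis using k that(2) by simp
  qed
  have "A' i j = B' (\<Sum>l<i. of_bool (U' l)) (\<Sum>l<j. of_bool (U' l))" if ij: "i < m" "j < m" "U' i" "U' j" for i j
  proof -
    have u: "U i" "U j" using assms(1) ij by simp_all
    have "A i j = B (\<Sum>l<i. of_bool (U l)) (\<Sum>l<j. of_bool (U l))"
      using assms(4) ij(1,2) u unfolding selects_def by simp
    then show ?thesis
      using assms(2)[OF ij(1,2)] assms(3)[OF rk[OF ij(1) u(1)] rk[OF ij(2) u(2)]] s[of i] s[of j] ij(1,2) by simp
  qed
  then show ?thesis unfolding selects_def using k s[of m] by simp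
qed

lemma entry_index: "i < m \<Longrightarrow> j < m \<Longrightarrow> m + 1 + i * m + j < code_length m"
proof -
  assume "i < m" "j < m"
  then have "Suc i * m \<le> m * m" by (intro mult_le_mono1) simp
  then show ?thesis using \<open>j < m\<close> by (simp add: code_length_def)
qed

lemma verify_complete:
  assumes A: "separated_matrix m A" and B: "separated_matrix k B" and h: "embeds k B m A h"
    and x: "x = pair_word (encode_matrix m A) (encode_matrix k B)"
  shows "\<exists>u. length u = m \<and> verify (pair_word x u) m k"
proof -
  let ?v = "encode_matrix m A" let ?w = "encode_matrix k B"
  define U where "U i \<longleftrightarrow> i \<in> h ` {..<k}" for i
  define u where "u = map U [0..<m]"
  define z where "z = pair_word (pair_word ?v ?w) u"
  have lu: "length u = m" by (simp add: u_def)
  have lv: "length ?v = code_length m" and lw: "length ?w = code_length k"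
    by (simp_all add: length_encode_matrix code_length_def)
  note b = word_bit_pair[OF z_def, unfolded lv lw]
  have he: "host_entry z m i j = A i j" if "i < m" "j < m" for i j
    unfolding host_entry_def b(2)[OF entry_index[OF that]] by (rule nth_encode_matrix(3)[OF that])
  have ge: "guest_entry z m k i j = B i j" if "i < k" "j < k" for i j
    unfolding guest_entry_def b(4)[OF refl entry_index[OF that]] by (rule nth_encode_matrix(3)[OF that])
  have ce: "certificate_bit z m k i = U i" if "i < m" for i
    unfolding certificate_bit_def pair_length_def using b(7)[of i] that lu by (simp add: u_def)
  have "selects k B m A U" using selects_of_embeds[OF h] unfolding U_def .
  then have s: "selects k (guest_entry z m k) m (host_entry z m) (certificate_bit z m k)"
    by (rule selects_cong[rotated 3]) (simp_all add: he ge ce)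
  have sm: "separated_matrix m (host_entry z m)" by (rule separated_matrix_cong[OF _ A]) (simp add: he)
  have sk: "separated_matrix k (guest_entry z m k)" by (rule separated_matrix_cong[OF _ B]) (simp add: ge)
  have c: "i < code_length m" if "i \<le> m" for i m using that by (simp add: code_length_def)
  have "verify z m k"
    unfolding verify_def
  proof (intro conjI allI impI s sm sk)
    show "length z = 2 * pair_length m k + 1 + m"
      unfolding z_def length_pair_word lv lw lu pair_length_def ..
    show "\<And>i. i < pair_length m k \<Longrightarrow> word_bit z (2 * i)" "\<not> word_bit z (2 * pair_length m k)"
      unfolding pair_length_def by (rule b(5), assumption, rule b(6))
    show "\<And>i. i < code_length m \<Longrightarrow> word_bit z (2 * (2 * i) + 1)" by (rule b(1))
    show "\<not> word_bit z (2 * (2 * code_length m) + 1)" by (rule b(3))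
    show "\<And>i. i < m \<Longrightarrow> host_bit z i" using b(2)[OF c] nth_encode_matrix(1)[of _ m A] by simp
    show "\<not> host_bit z m" using b(2)[OF c] nth_encode_matrix(2)[of m A] by simp
    show "\<And>i. i < k \<Longrightarrow> guest_bit z m i" using b(4)[OF refl c] nth_encode_matrix(1)[of _ k B] by simp
    show "\<not> guest_bit z m k" using b(4)[OF refl c] nth_encode_matrix(2)[of k B] by simp
  qed
  then show ?thesis using lu unfolding z_def x by (intro exI[of _ u] conjI)
qed

lemma verify_sound:
  assumes "verify z m k"
  shows "\<exists>A B h u. z = pair_word (pair_word (encode_matrix m A) (encode_matrix k B)) u \<and>
    separated_matrix m A \<and> separated_matrix k B \<and> embeds k B m A h"
proof -
  let ?lx = "pair_length m k"
  have len: "length z = 2 * ?lx + 1 + m" and z1: "\<And>i. i < ?lx \<Longrightarrow> word_bit z (2 * i)" and z2: "\<not> word_bit z (2 * ?lx)"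
    and x1: "\<And>i. i < code_length m \<Longrightarrow> word_bit z (2 * (2 * i) + 1)" and x2: "\<not> word_bit z (2 * (2 * code_length m) + 1)"
    and v1: "\<And>i. i < m \<Longrightarrow> host_bit z i" and v2: "\<not> host_bit z m"
    and w1: "\<And>i. i < k \<Longrightarrow> guest_bit z m i" and w2: "\<not> guest_bit z m k"
    and A: "separated_matrix m (host_entry z m)" and B: "separated_matrix k (guest_entry z m k)"
    and s: "selects k (guest_entry z m k) m (host_entry z m) (certificate_bit z m k)"
    using assms unfolding verify_def by simp_all
  have bit: "word_bit z i = z ! i" if "i < length z" for i using that by (simp add: word_bit_def)
  define x where "x = map (\<lambda>i. z ! (2 * i + 1)) [0..<?lx]"
  define u where "u = map (\<lambda>i. z ! (2 * ?lx + 1 + i)) [0..<m]"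
  have z: "z = pair_word x u"
    unfolding x_def u_def
  proof (rule pair_word_decode[OF len])
    show "\<And>i. i < ?lx \<Longrightarrow> z ! (2 * i)" using z1 by (simp add: word_bit_def)
    show "\<not> z ! (2 * ?lx)" using z2 len by (simp add: word_bit_def)
  qed
  have lx: "length x = 2 * code_length m + 1 + code_length k" by (simp add: x_def pair_length_def)
  have x: "x ! i = word_bit z (2 * i + 1)" if "i < 2 * code_length m + 1 + code_length k" for i
    using that len by (simp add: x_def word_bit_def pair_length_def del: upt_Suc)
  define v where "v = map (\<lambda>i. x ! (2 * i + 1)) [0..<code_length m]"
  define w where "w = map (\<lambda>i. x ! (2 * code_length m + 1 + i)) [0..<code_length k]"
  have xd: "x = pair_word v w"
    unfolding v_def w_def
  proof (rule pair_word_decode[OF lx])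
    show "\<And>i. i < code_length m \<Longrightarrow> x ! (2 * i)" using x1 by (subst x) simp_all
    show "\<not> x ! (2 * code_length m)" using x2 by (subst x) simp_all
  qed
  have v: "v ! i = host_bit z i" if "i < code_length m" for i
    using x[of "2 * i + 1"] that by (simp add: v_def host_bit_def)
  have w: "w ! i = guest_bit z m i" if "i < code_length k" for i
    using x[of "2 * code_length m + 1 + i"] that by (simp add: w_def guest_bit_def)
  have c: "i < code_length m" if "i \<le> m" for i m using that by (simp add: code_length_def)
  have ve: "v = encode_matrix m (host_entry z m)"
  proof (rule encode_matrix_eqI)
    show "length v = m + 1 + m * m" by (simp add: v_def code_length_def)
    show "\<And>i. i < m \<Longrightarrow> v ! i" using v[OF c] v1 by simp
    show "\<not> v ! m" using v[OF c] v2 by simp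
    show "\<And>i j. i < m \<Longrightarrow> j < m \<Longrightarrow> v ! (m + 1 + i * m + j) = host_entry z m i j"
      using v[OF entry_index] unfolding host_entry_def by simp
  qed
  have we: "w = encode_matrix k (guest_entry z m k)"
  proof (rule encode_matrix_eqI)
    show "length w = k + 1 + k * k" by (simp add: w_def code_length_def)
    show "\<And>i. i < k \<Longrightarrow> w ! i" using w[OF c] w1 by simp
    show "\<not> w ! k" using w[OF c] w2 by simp
    show "\<And>i j. i < k \<Longrightarrow> j < k \<Longrightarrow> w ! (k + 1 + i * k + j) = guest_entry z m k i j"
      using w[OF entry_index] unfolding guest_entry_def by simp
  qed
  obtain h where "embeds k (guest_entry z m k) m (host_entry z m) h" using embeds_of_selects[OF s] by blast
  then show ?thesis
    using A B z[unfolded xd ve we] by blast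
qed

lemma DEFP_word_bit: "DEF A \<Longrightarrow> DEFP (\<lambda>x \<sigma>. word_bit x (A x \<sigma>))"
  unfolding word_bit_def by (rule DEFP_bit)

lemma DEFP_verify: "DEFP (\<lambda>x \<sigma>. \<exists>m<Suc (length x). \<exists>k<Suc (length x). verify x m k)"
proof -
  have cl0: "DEF (\<lambda>x \<sigma>. code_length (\<sigma> 0))" unfolding code_length_def by (intro def_intros)
  note cl = DEF_comp1[of "\<lambda>x. code_length", OF cl0]
  have pl0: "DEF (\<lambda>x \<sigma>. pair_length (\<sigma> 0) (\<sigma> 1))" unfolding pair_length_def by (intro cl def_intros)
  note pl = DEF_comp2[of "\<lambda>x. pair_length", OF pl0]
  show ?thesis
    unfolding verify_def separated_matrix_def selects_def host_entry_def guest_entry_def host_bit_def guest_bit_def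
      certificate_bit_def
    by (intro DEFP_word_bit cl pl def_intros)
qed

lemma language_in_NP: "separated_matching_induced_subgraph \<in> class_NP"
proof -
  \<comment> \<open>The two sizes are found by exhaustive search below the length of the word. The
    certificate has \<open>m\<close> bits, and \<open>m \<le> length x\<close> allows the identity
    polynomial as its length bound.\<close>
  let ?R = "{z. \<exists>m<Suc (length z). \<exists>k<Suc (length z). verify z m k}"
  have R: "?R \<in> class_P" by (rule class_P_DEFP[OF DEFP_verify])
  have "x \<in> separated_matching_induced_subgraph \<longleftrightarrow>
      (\<exists>u. length u \<le> poly [:0, 1:] (length x) \<and> pair_word x u \<in> ?R)" for x
  proof
    assume "x \<in> separated_matching_induced_subgraph"
    then obtain m A k B h where x: "x = pair_word (encode_matrix m A) (encode_matrix k B)"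
      and *: "separated_matrix m A" "separated_matrix k B" "embeds k B m A h"
      unfolding in_language_iff by blast
    obtain u where u: "length u = m" "verify (pair_word x u) m k" using verify_complete[OF * x] by blast
    have "m \<le> length x" "k \<le> length x" unfolding x length_pair_word length_encode_matrix by simp_all
    moreover have "length x \<le> length (pair_word x u)" unfolding length_pair_word by simp
    ultimately have "m < Suc (length (pair_word x u))" "k < Suc (length (pair_word x u))" by simp_all
    then have "pair_word x u \<in> ?R" using u(2) by blast
    then show "\<exists>u. length u \<le> poly [:0, 1:] (length x) \<and> pair_word x u \<in> ?R"
      using u(1) \<open>m \<le> length x\<close> by (intro exI[of _ u]) simp
  next
    assume "\<exists>u. length u \<le> poly [:0, 1:] (length x) \<and> pair_word x u \<in> ?R"
    then obtain u m k where "verify (pair_word x u) m k" by blast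
    then obtain A B h u' where "pair_word x u = pair_word (pair_word (encode_matrix m A) (encode_matrix k B)) u'"
      and *: "separated_matrix m A" "separated_matrix k B" "embeds k B m A h"
      using verify_sound by blast
    then have "x = pair_word (encode_matrix m A) (encode_matrix k B)" unfolding pair_word_inject by blast
    then show "x \<in> separated_matching_induced_subgraph" unfolding in_language_iff using * by blast
  qed
  then show ?thesis unfolding class_NP_def using R by blast
qed

section \<open>Tilings as instances of the constraint problem\<close>

text \<open>
  Cell \<open>\<tau> = row * w + column\<close> of the grid is variable \<open>\<tau>\<close>. Its five constraints are: the horizontal
  and the vertical colour equations, each as two inequalities, and the monotonicity of \<open>nb\<close>.
\<close>

definition grid_cell :: "nat \<Rightarrow> nat \<Rightarrow> nat" where
  "grid_cell n e = (e - n) div 5"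

definition grid_var :: "nat \<Rightarrow> nat \<Rightarrow> nat \<Rightarrow> nat" where
  "grid_var n w z = (if z div 2 < n then z div 2 else grid_cell n (z div 2) +
     (if z mod 2 = 0 then 0 else if (z div 2 - n) mod 5 = 2 \<or> (z div 2 - n) mod 5 = 3 then w else 1))"

text \<open>Constraints that would cross the border of the grid or concern columns outside the
  certificate leave an empty strip. Nothing is renumbered, so the cell and the kind of a constraint
  remain a quotient and a remainder by 5.\<close>

definition grid_strip :: "nat \<Rightarrow> nat \<Rightarrow> nat \<Rightarrow> (nat \<Rightarrow> bool) \<Rightarrow> nat \<Rightarrow> bool" where
  "grid_strip n w R cert e \<longleftrightarrow> e < n \<or>
     (if (e - n) mod 5 < 2 then grid_cell n e mod w + 1 < w
      else if (e - n) mod 5 < 4 then grid_cell n e div w + 1 < R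
      else grid_cell n e + 1 < w \<and> cert (grid_cell n e))"

definition grid_val :: "nat \<Rightarrow> nat \<Rightarrow> (nat \<Rightarrow> nat \<Rightarrow> nat \<Rightarrow> nat) \<Rightarrow> nat \<Rightarrow> nat \<Rightarrow> nat" where
  "grid_val n D tab z t = (if z div 2 < n then D - 1 - t else tab ((z div 2 - n) mod 5) (z mod 2) t)"

text \<open>Only \<open>\<le>\<close> can be imposed. Kinds 0 and 1, and likewise 2 and 3, compare
  two colours and their complements to \<open>b\<close>, which together is an equation; kind 4 uses
  complements to reverse the inequality for \<open>nb\<close>.\<close>

definition color_table ::
  "nat \<Rightarrow> (nat \<Rightarrow> nat) \<Rightarrow> (nat \<Rightarrow> nat) \<Rightarrow> (nat \<Rightarrow> nat) \<Rightarrow> (nat \<Rightarrow> nat) \<Rightarrow> (nat \<Rightarrow> nat) \<Rightarrow> nat \<Rightarrow> nat \<Rightarrow> nat \<Rightarrow> nat" where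
  "color_table b cr cl cu cd nb ty j t =
     (if ty = 0 then (if j = 0 then cr t else cl t)
      else if ty = 1 then (if j = 0 then b - cr t else b - cl t)
      else if ty = 2 then (if j = 0 then cu t else cd t)
      else if ty = 3 then (if j = 0 then b - cu t else b - cd t)
      else b - nb t)"

definition grid_solution where
  "grid_solution R w D al cert cr cl cu cd nb s \<longleftrightarrow>
     (\<forall>v<R * w. s v < D \<and> al v (s v)) \<and>
     (\<forall>v<R * w. v mod w + 1 < w \<longrightarrow> cr (s v) = cl (s (v + 1))) \<and>
     (\<forall>v<R * w. v div w + 1 < R \<longrightarrow> cu (s v) = cd (s (v + w))) \<and>
     (\<forall>v. v + 1 < w \<and> cert v \<longrightarrow> nb (s (v + 1)) \<le> (nb (s v) :: nat))"

text \<open>With \<open>n = R * w\<close> cells there are \<open>n\<close> synchronising strips and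
  \<open>5 * n\<close> constraint strips, hence the factor 6. \<open>L\<close> exceeds the possible
  number of the other points by one, and \<open>C\<close> is above both kinds of values:
  \<open>D - 1 - t\<close> and numbers up to \<open>b\<close>.\<close>

locale grid =
  fixes R w D b L C :: nat and cert :: "nat \<Rightarrow> bool" and al :: "nat \<Rightarrow> nat \<Rightarrow> bool" and cr cl cu cd nb :: "nat \<Rightarrow> nat"
  assumes R_pos: "0 < R" and w_pos: "0 < w" and D_pos: "0 < D"
    and bounds: "\<And>t. cr t \<le> b" "\<And>t. cl t \<le> b" "\<And>t. cu t \<le> b" "\<And>t. cd t \<le> b" "\<And>t. nb t \<le> b"
    and L_gt: "L = 2 * (6 * (R * w)) * D + R * w + 6 * (R * w) + 1"
    and C: "C = D + b + 1"
begin

abbreviation "n \<equiv> R * w"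
abbreviation "E \<equiv> 6 * n"
abbreviation "xs \<equiv> grid_var n w"
abbreviation "vs \<equiv> grid_strip n w R cert"
abbreviation "val \<equiv> grid_val n D (color_table b cr cl cu cd nb)"

lemma n_pos: "0 < n" using R_pos w_pos by simp

lemma step_right: "v < n \<Longrightarrow> v mod w + 1 < w \<Longrightarrow> v + 1 < n"
proof -
  assume v: "v < n" "v mod w + 1 < w"
  have "v div w < R" using v(1) by (simp add: less_mult_imp_div_less)
  then have "Suc (v div w) * w \<le> R * w" by (intro mult_le_mono1) simp
  moreover have "v + 1 < v div w * w + w" using v(2) div_mult_mod_eq[of v w] by linarith
  ultimately show ?thesis by simp
qed

lemma step_up: "v < n \<Longrightarrow> v div w + 1 < R \<Longrightarrow> v + w < n"
proof -
  assume v: "v < n" "v div w + 1 < R"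
  have "(v div w + 1 + 1) * w \<le> R * w" by (intro mult_le_mono1) (use v(2) in simp)
  moreover have "v < v div w * w + w" using div_mult_mod_eq[of v w] mod_less_divisor[OF w_pos, of v] by linarith
  ultimately show ?thesis by simp
qed

lemma constraint_strip:
  assumes "ty < 5"
  shows "xs (2 * (n + (5 * v + ty))) = v" "xs (2 * (n + (5 * v + ty)) + 1) = v + (if ty = 2 \<or> ty = 3 then w else 1)"
    "vs (n + (5 * v + ty)) \<longleftrightarrow> (if ty < 2 then v mod w + 1 < w else if ty < 4 then v div w + 1 < R else v + 1 < w \<and> cert v)"
    "val (2 * (n + (5 * v + ty))) t = color_table b cr cl cu cd nb ty 0 t"
    "val (2 * (n + (5 * v + ty)) + 1) t = color_table b cr cl cu cd nb ty 1 t"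
proof -
  have d: "(n + (5 * v + ty) - n) div 5 = v" "(n + (5 * v + ty) - n) mod 5 = ty" using assms by simp_all
  have z: "2 * e div 2 = e" "(2 * e + 1) div 2 = e" "2 * e mod 2 = 0" "(2 * e + 1) mod 2 = 1" for e :: nat by simp_all
  have nn: "\<not> n + (5 * v + ty) < n" by simp
  show "xs (2 * (n + (5 * v + ty))) = v" "xs (2 * (n + (5 * v + ty)) + 1) = v + (if ty = 2 \<or> ty = 3 then w else 1)"
    unfolding grid_var_def grid_cell_def z d by simp_all
  show "vs (n + (5 * v + ty)) \<longleftrightarrow> (if ty < 2 then v mod w + 1 < w else if ty < 4 then v div w + 1 < R else v + 1 < w \<and> cert v)"
    unfolding grid_strip_def grid_cell_def d by simp
  show "val (2 * (n + (5 * v + ty))) t = color_table b cr cl cu cd nb ty 0 t"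
    "val (2 * (n + (5 * v + ty)) + 1) t = color_table b cr cl cu cd nb ty 1 t"
    unfolding grid_val_def z d by simp_all
qed

lemma strip_cases:
  assumes "n \<le> e" "e < E"
  obtains v ty where "v < n" "ty < 5" "e = n + (5 * v + ty)"
proof (rule that)
  show "(e - n) div 5 < n" using assms by (simp add: div_less_iff_less_mult)
  show "(e - n) mod 5 < 5" by simp
  show "e = n + (5 * ((e - n) div 5) + (e - n) mod 5)" using assms by simp
qed

lemma color_table_le: "color_table b cr cl cu cd nb ty j t \<le> b"
  unfolding color_table_def using bounds by simp

lemma val_less: "t < D \<Longrightarrow> val z t < C"
  unfolding grid_val_def C using color_table_le[of "(z div 2 - n) mod 5" "z mod 2" t]
  by auto

sublocale strips n E D C L xs vs
proof
  show "0 < n" by (rule n_pos)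
  show "n \<le> E" by simp
  show "0 < D" by (rule D_pos)
  show "D \<le> C" unfolding C by simp
  show "2 * E * D + n + E < L" unfolding L_gt by simp
  show "e < n \<Longrightarrow> vs e" for e by (simp add: grid_strip_def)
  show "e < n \<Longrightarrow> xs (2 * e) = e \<and> xs (2 * e + 1) = e" for e by (simp add: grid_var_def)
  show "xs (2 * e) \<noteq> xs (2 * e + 1)" if e: "n \<le> e" "e < E" "vs e" for e
  proof -
    obtain v ty where v: "v < n" "ty < 5" "e = n + (5 * v + ty)" using strip_cases[OF e(1,2)] .
    show ?thesis unfolding v(3) constraint_strip[OF v(2)] using w_pos by simp
  qed
  show "xs z < n" if z: "z < 2 * E" "vs (z div 2)" for z
  proof (cases "z div 2 < n")
    case True
    then show ?thesis by (simp add: grid_var_def)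
  next
    case False
    define e where "e = z div 2"
    have e: "n \<le> e" "e < E" "vs e" using False z by (simp_all add: e_def)
    obtain v ty where v: "v < n" "ty < 5" "e = n + (5 * v + ty)" using strip_cases[OF e(1,2)] .
    \<comment> \<open>A present strip comes with the border condition that keeps the neighbouring
      cell inside the grid.\<close>
    have vv: "v + (if ty = 2 \<or> ty = 3 then w else 1) < n"
    proof -
      consider "ty < 2" | "ty = 2 \<or> ty = 3" | "ty = 4" using v(2) by linarith
      then show ?thesis
      proof cases
        case 1
        then show ?thesis using e(3) step_right[OF v(1)] unfolding v(3) constraint_strip(3)[OF v(2)] by auto
      next
        case 2
        then show ?thesis using e(3) step_up[OF v(1)] unfolding v(3) constraint_strip(3)[OF v(2)] by auto
      next
        case 3
        then have "v + 1 < w" using e(3) unfolding v(3) constraint_strip(3)[OF v(2)] by simp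
        then have "v + 1 < n" using R_pos by (cases R) simp_all
        then show ?thesis using 3 by simp
      qed
    qed
    have "z = 2 * e \<or> z = 2 * e + 1" unfolding e_def by presburger
    then show ?thesis using v(1) vv unfolding v(3) by (elim disjE) (simp_all only: constraint_strip[OF v(2)])
  qed
qed

lemma val_sync: "e < n \<Longrightarrow> val (2 * e) t = D - 1 - t \<and> val (2 * e + 1) t = D - 1 - t"
  by (simp add: grid_val_def)

lemma complement_eq: "x \<le> b \<Longrightarrow> y \<le> b \<Longrightarrow> x \<le> y \<and> b - x \<le> b - y \<longleftrightarrow> x = (y :: nat)"
  by auto

lemma constraint_iff:
  assumes "v < n"
  shows "(\<forall>ty<5. vs (n + (5 * v + ty)) \<longrightarrow>
      val (2 * (n + (5 * v + ty))) (s (xs (2 * (n + (5 * v + ty))))) \<le>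
      val (2 * (n + (5 * v + ty)) + 1) (s (xs (2 * (n + (5 * v + ty)) + 1)))) \<longleftrightarrow>
    (v mod w + 1 < w \<longrightarrow> cr (s v) = cl (s (v + 1))) \<and> (v div w + 1 < R \<longrightarrow> cu (s v) = cd (s (v + w))) \<and>
    (v + 1 < w \<and> cert v \<longrightarrow> nb (s (v + 1)) \<le> nb (s v))" (is "?l \<longleftrightarrow> ?r")
proof -
  define Q where "Q ty \<longleftrightarrow> (vs (n + (5 * v + ty)) \<longrightarrow>
      val (2 * (n + (5 * v + ty))) (s (xs (2 * (n + (5 * v + ty))))) \<le>
      val (2 * (n + (5 * v + ty)) + 1) (s (xs (2 * (n + (5 * v + ty)) + 1))))" for ty
  have q: "Q ty \<longleftrightarrow> ((if ty < 2 then v mod w + 1 < w else if ty < 4 then v div w + 1 < R else v + 1 < w \<and> cert v) \<longrightarrow>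
      color_table b cr cl cu cd nb ty 0 (s v) \<le> color_table b cr cl cu cd nb ty 1 (s (v + (if ty = 2 \<or> ty = 3 then w else 1))))"
    if "ty < 5" for ty
    unfolding Q_def constraint_strip[OF that] ..
  have five: "(\<forall>ty<5. P ty) \<longleftrightarrow> P 0 \<and> P 1 \<and> P 2 \<and> P 3 \<and> P (4 :: nat)" for P
    by (simp add: numeral_eq_Suc All_less_Suc conj_ac)
  have q0: "Q 0 \<longleftrightarrow> (v mod w + 1 < w \<longrightarrow> cr (s v) \<le> cl (s (v + 1)))" using q[of 0] by (simp add: color_table_def)
  have q1: "Q 1 \<longleftrightarrow> (v mod w + 1 < w \<longrightarrow> b - cr (s v) \<le> b - cl (s (v + 1)))" using q[of 1] by (simp add: color_table_def)
  have q2: "Q 2 \<longleftrightarrow> (v div w + 1 < R \<longrightarrow> cu (s v) \<le> cd (s (v + w)))" using q[of 2] by (simp add: color_table_def)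
  have q3: "Q 3 \<longleftrightarrow> (v div w + 1 < R \<longrightarrow> b - cu (s v) \<le> b - cd (s (v + w)))" using q[of 3] by (simp add: color_table_def)
  have "b - nb (s v) \<le> b - nb (s (v + 1)) \<longleftrightarrow> nb (s (v + 1)) \<le> nb (s v)"
    using bounds(5)[of "s v"] bounds(5)[of "s (v + 1)"] by linarith
  then have q4: "Q 4 \<longleftrightarrow> (v + 1 < w \<and> cert v \<longrightarrow> nb (s (v + 1)) \<le> nb (s v))" using q[of 4] by (simp add: color_table_def)
  have "?l \<longleftrightarrow> (\<forall>ty<5. Q ty)" unfolding Q_def ..
  also have "\<dots> \<longleftrightarrow> ?r"
    unfolding five q0 q1 q2 q3 q4
    using complement_eq[OF bounds(1) bounds(2), of "s v" "s (v + 1)"] complement_eq[OF bounds(3) bounds(4), of "s v" "s (v + w)"]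
    by blast
  finally show ?thesis .
qed

lemma solution_iff: "solution val al s \<longleftrightarrow> grid_solution R w D al cert cr cl cu cd nb s"
proof -
  \<comment> \<open>The certificate conditions lie in row 0, so restricting them to
    \<open>v < n\<close> loses nothing.\<close>
  have n_w: "v < n" if "v + 1 < w" for v using that R_pos by (cases R) simp_all
  have "(\<forall>e. n \<le> e \<and> e < E \<and> vs e \<longrightarrow> val (2 * e) (s (xs (2 * e))) \<le> val (2 * e + 1) (s (xs (2 * e + 1)))) \<longleftrightarrow>
    (\<forall>v<n. \<forall>ty<5. vs (n + (5 * v + ty)) \<longrightarrow>
      val (2 * (n + (5 * v + ty))) (s (xs (2 * (n + (5 * v + ty))))) \<le>
      val (2 * (n + (5 * v + ty)) + 1) (s (xs (2 * (n + (5 * v + ty)) + 1))))" (is "?l \<longleftrightarrow> ?r")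
  proof
    assume l: ?l
    show ?r
    proof (intro allI impI)
      fix v ty :: nat assume a: "v < n" "ty < 5" "vs (n + (5 * v + ty))"
      have "n \<le> n + (5 * v + ty) \<and> n + (5 * v + ty) < E \<and> vs (n + (5 * v + ty))" using a by simp
      then show "val (2 * (n + (5 * v + ty))) (s (xs (2 * (n + (5 * v + ty))))) \<le>
        val (2 * (n + (5 * v + ty)) + 1) (s (xs (2 * (n + (5 * v + ty)) + 1)))" by (rule l[rule_format])
    qed
  next
    assume r: ?r
    show ?l
    proof (intro allI impI)
      fix e assume e: "n \<le> e \<and> e < E \<and> vs e"
      obtain v ty where v: "v < n" "ty < 5" "e = n + (5 * v + ty)"
        using strip_cases[OF e[THEN conjunct1] e[THEN conjunct2, THEN conjunct1]] .
      show "val (2 * e) (s (xs (2 * e))) \<le> val (2 * e + 1) (s (xs (2 * e + 1)))"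
        unfolding v(3) by (rule r[rule_format, OF v(1,2)]) (use e v(3) in simp)
    qed
  qed
  also have "\<dots> \<longleftrightarrow> (\<forall>v<n. (v mod w + 1 < w \<longrightarrow> cr (s v) = cl (s (v + 1))) \<and> (v div w + 1 < R \<longrightarrow> cu (s v) = cd (s (v + w))) \<and>
    (v + 1 < w \<and> cert v \<longrightarrow> nb (s (v + 1)) \<le> nb (s v)))"
    using constraint_iff by (intro all_cong) blast
  finally have c: "?l \<longleftrightarrow> (\<forall>v<n. (v mod w + 1 < w \<longrightarrow> cr (s v) = cl (s (v + 1))) \<and>
    (v div w + 1 < R \<longrightarrow> cu (s v) = cd (s (v + w))) \<and> (v + 1 < w \<and> cert v \<longrightarrow> nb (s (v + 1)) \<le> nb (s v)))" .
  have d: "(\<forall>v<n. P v \<and> Q v \<and> S v) \<longleftrightarrow> (\<forall>v<n. P v) \<and> (\<forall>v<n. Q v) \<and> (\<forall>v<n. S v)" for P Q S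
    by blast
  have "(\<forall>v<n. v + 1 < w \<and> cert v \<longrightarrow> nb (s (v + 1)) \<le> nb (s v)) \<longleftrightarrow>
    (\<forall>v. v + 1 < w \<and> cert v \<longrightarrow> nb (s (v + 1)) \<le> nb (s v))"
    using n_w by blast
  moreover have "solution val al s \<longleftrightarrow> (\<forall>i<n. s i < D \<and> al i (s i)) \<and> ?l"
    by (rule solution_def[OF val_less val_sync])
  ultimately show ?thesis unfolding grid_solution_def c d by (simp only:)
qed

lemma pair_in_language_iff:
  "pair_word (point_encoding n E D C L xs val (text_slot al)) (point_encoding n E D C L xs zero_val pattern_slot)
     \<in> separated_matching_induced_subgraph \<longleftrightarrow> (\<exists>s. grid_solution R w D al cert cr cl cu cd nb s)"
proof -
  have t: "text_slot al z t \<Longrightarrow> vs (z div 2)" and p: "pattern_slot z t \<Longrightarrow> vs (z div 2)" for z t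
    by (simp_all add: text_slot_def pattern_slot_def)
  have vt: "t < D \<Longrightarrow> text_slot al z t \<Longrightarrow> val z t < C" for z t by (rule val_less)
  have vp: "t < D \<Longrightarrow> pattern_slot z t \<Longrightarrow> zero_val z t < C" for z t unfolding C by simp
  note M = point_graph_matching[of "text_slot al" val, OF t vt] and N = point_graph_matching[of pattern_slot zero_val, OF p vp]
  have eM: "point_encoding n E D C L xs val (text_slot al) = encode_graph (point_graph n E D C L xs val (text_slot al))"
    by (rule encode_point_graph[OF t vt, symmetric])
  have eN: "point_encoding n E D C L xs zero_val pattern_slot = encode_graph (point_graph n E D C L xs zero_val pattern_slot)"
    by (rule encode_point_graph[OF p vp, symmetric])
  have "(\<exists>s. solution val al s) \<longleftrightarrow> (\<exists>s. grid_solution R w D al cert cr cl cu cd nb s)"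
    by (rule arg_cong[of _ _ Ex], rule ext, rule solution_iff)
  moreover have "ordered_subgraph (point_graph n E D C L xs zero_val pattern_slot) (point_graph n E D C L xs val (text_slot al)) \<longleftrightarrow>
      (\<exists>s. solution val al s)"
    by (rule ordered_subgraph_iff_solution[OF val_less val_sync])
  moreover have "ordered_subgraph (point_graph n E D C L xs zero_val pattern_slot) (point_graph n E D C L xs val (text_slot al)) \<longleftrightarrow>
      ordered_induced_subgraph (point_graph n E D C L xs zero_val pattern_slot) (point_graph n E D C L xs val (text_slot al))"
    by (rule ordered_subgraph_iff_induced[OF M(1) N(1)])
  moreover have "pair_word (encode_graph (point_graph n E D C L xs val (text_slot al)))
      (encode_graph (point_graph n E D C L xs zero_val pattern_slot)) \<in> separated_matching_induced_subgraph \<longleftrightarrow>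
      ordered_induced_subgraph (point_graph n E D C L xs zero_val pattern_slot) (point_graph n E D C L xs val (text_slot al))"
    by (rule pair_encode_in_language_iff[OF M N])
  ultimately show ?thesis unfolding eM eN by simp
qed

lemma pair_of_slots_in_language_iff:
  "pair_word (point_encoding n E D C L xs val (\<lambda>z t. vs (z div 2) \<and> al (xs z) t))
      (point_encoding n E D C L xs (\<lambda>z t. 0) (\<lambda>z t. vs (z div 2) \<and> t = 0))
     \<in> separated_matching_induced_subgraph \<longleftrightarrow> (\<exists>s. grid_solution R w D al cert cr cl cu cd nb s)"
proof -
  have "text_slot al = (\<lambda>z t. vs (z div 2) \<and> al (xs z) t)" by (intro ext) (rule text_slot_def)
  moreover have "pattern_slot = (\<lambda>z t. vs (z div 2) \<and> t = 0)" by (intro ext) (rule pattern_slot_def)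
  ultimately show ?thesis using pair_in_language_iff by (simp only:)
qed

end

section \<open>NP-hardness\<close>

definition tile_pred :: "nat \<Rightarrow> (nat \<Rightarrow> tile) \<Rightarrow> (tile \<Rightarrow> bool) \<Rightarrow> nat \<Rightarrow> bool" where
  "tile_pred D ts Q t \<longleftrightarrow> t < D \<and> Q (ts t)"

lemma DEFP_tile_pred: "DEF A \<Longrightarrow> DEFP (\<lambda>x \<sigma>. tile_pred D ts Q (A x \<sigma>))"
  unfolding tile_pred_def by (rule DEFP_table)

definition tile_number :: "nat \<Rightarrow> (nat \<Rightarrow> tile) \<Rightarrow> (tile \<Rightarrow> nat) \<Rightarrow> nat \<Rightarrow> nat" where
  "tile_number D ts F t = (if t < D then F (ts t) else 0)"

lemma DEF_tile_number: "DEF A \<Longrightarrow> DEF (\<lambda>x \<sigma>. tile_number D ts F (A x \<sigma>))"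
  unfolding tile_number_def by (rule DEF_table)

text \<open>The condition \<open>allowed_tile\<close> on numbers of tiles, in a form that is visibly definable.\<close>

definition init_number where
  "init_number k D ts off x pl j t \<longleftrightarrow>
     tile_pred D ts (\<lambda>t. fst t = 0 \<and> (\<forall>i<k. 0 < i \<longrightarrow> sym t i = 0) \<and> sym t 0 \<le> 2) t \<and>
     (j = off \<longrightarrow> tile_pred D ts (\<lambda>t. \<forall>i<k. flag_here t i) t) \<and>
     (j \<noteq> off \<longrightarrow> tile_pred D ts (\<lambda>t. \<forall>i<k. \<not> flag_here t i) t) \<and>
     (j < off \<or> off + (2 * length x + 1) + pl \<le> j \<longrightarrow> tile_pred D ts (\<lambda>t. sym t 0 = 0) t) \<and>
     (\<forall>a<length x. j = off + 2 * a \<longrightarrow> tile_pred D ts (\<lambda>t. sym t 0 = 2) t) \<and>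
     (\<forall>a<length x. j = off + (2 * a + 1) \<longrightarrow>
        (if word_bit x a then tile_pred D ts (\<lambda>t. sym t 0 = 2) t else tile_pred D ts (\<lambda>t. sym t 0 = 1) t)) \<and>
     (j = off + 2 * length x \<longrightarrow> tile_pred D ts (\<lambda>t. sym t 0 = 1) t)"

definition allowed_number where
  "allowed_number k D ts off T w x pl i j t \<longleftrightarrow> tile_pred D ts (\<lambda>t. True) t \<and>
     (j = 0 \<longrightarrow> tile_pred D ts (\<lambda>t. \<forall>i<k. \<not> flag_left t i) t) \<and>
     (j = w - 1 \<longrightarrow> tile_pred D ts (\<lambda>t. \<forall>i<k. \<not> flag_right t i) t) \<and>
     (i = 0 \<longrightarrow> init_number k D ts off x pl j t) \<and>
     (i = T \<and> j = off \<longrightarrow> tile_pred D ts (\<lambda>t. sym t (k - 1) = 2) t)"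

lemma allowed_number_iff:
  "allowed_number k D ts off T w x pl i j t \<longleftrightarrow> t < D \<and> allowed_tile k off T w x pl i j (ts t)"
proof (cases "t < D")
  case True
  \<comment> \<open>A table cannot depend on \<open>x\<close>. The comparison with
    \<open>bit_symbol (x ! a)\<close> is therefore split into two fixed predicates, selected by the
    input bit.\<close>
  have b: "(if word_bit x a then y = 2 else y = 1) \<longleftrightarrow> y = bit_symbol (x ! a)" if "a < length x" for a and y :: nat
    using that by (simp add: word_bit_def bit_symbol_def)
  have "(\<forall>a<length x. j = off + (2 * a + 1) \<longrightarrow> (if word_bit x a then sym (ts t) 0 = 2 else sym (ts t) 0 = 1)) \<longleftrightarrow>
      (\<forall>a<length x. j = off + (2 * a + 1) \<longrightarrow> sym (ts t) 0 = bit_symbol (x ! a))"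
    using b by blast
  then show ?thesis
    unfolding allowed_number_def allowed_tile_def init_number_def init_tile_def tile_pred_def
    by (simp only: True simp_thms)
qed (simp add: allowed_number_def tile_pred_def)

text \<open>Cell \<open>v\<close> is in row \<open>v div w\<close> and column
  \<open>v mod w\<close>. Tiles are replaced by their numbers under \<open>ts\<close> and colours by
  their codes; \<open>to_nat\<close> is injective, so colour equations are preserved. As
  \<open>nb\<close> is 0 or 1, its monotonicity says that no nonblank symbol follows a blank
  one.\<close>

lemma tiling_iff_grid_solution:
  fixes cr cl cu cd nb :: "nat \<Rightarrow> nat"
  assumes ts: "bij_betw ts {..<D} (tiles M)" and w: "0 < w" and cert_w: "off + (2 * length x + 1) + pl < w"
    and cr: "\<And>t. t < D \<Longrightarrow> cr t = to_nat (right_color (n_tapes M) (ts t))"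
    and cl: "\<And>t. t < D \<Longrightarrow> cl t = to_nat (left_color (n_tapes M) (ts t))"
    and cu: "\<And>t. t < D \<Longrightarrow> cu t = to_nat (up_color M (n_tapes M) (ts t))"
    and cd: "\<And>t. t < D \<Longrightarrow> cd t = to_nat (down_color (n_tapes M) (ts t))"
    and nb: "\<And>t. t < D \<Longrightarrow> nb t = of_bool (sym (ts t) 0 \<noteq> 0)"
  shows "(\<exists>tt. tiling M off T w x pl tt) \<longleftrightarrow>
    (\<exists>s. grid_solution (T + 1) w D (\<lambda>v t. allowed_number (n_tapes M) D ts off T w x pl (v div w) (v mod w) t)
      (in_certificate off x pl) cr cl cu cd nb s)"
proof
  let ?k = "n_tapes M"
  assume "\<exists>tt. tiling M off T w x pl tt"
  then obtain tt where tt: "tiling M off T w x pl tt" by blast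
  have t1: "tt i j \<in> tiles M \<and> allowed_tile ?k off T w x pl i j (tt i j)" if "i \<le> T" "j < w" for i j
    using tt that unfolding tiling_def by simp
  have t2: "right_color ?k (tt i j) = left_color ?k (tt i (j + 1))" if "i \<le> T" "j + 1 < w" for i j
    using tt that unfolding tiling_def by simp
  have t3: "up_color M ?k (tt i j) = down_color ?k (tt (i + 1) j)" if "i < T" "j < w" for i j
    using tt that unfolding tiling_def by simp
  have t4: "sym (tt 0 j) 0 \<noteq> 0" if "in_certificate off x pl j" "sym (tt 0 (j + 1)) 0 \<noteq> 0" for j
    using tt that unfolding tiling_def by blast
  define s where "s v = inv_into {..<D} ts (tt (v div w) (v mod w))" for v
  have rc: "v div w \<le> T" "v mod w < w" if "v < (T + 1) * w" for v
    using that w by (simp_all add: less_mult_imp_div_less less_Suc_eq_le[symmetric])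
  have s: "s v < D" "ts (s v) = tt (v div w) (v mod w)" if "v < (T + 1) * w" for v
  proof -
    have "tt (v div w) (v mod w) \<in> ts ` {..<D}" using t1[OF rc[OF that]] ts by (simp add: bij_betw_def)
    from inv_into_into[OF this] f_inv_into_f[OF this] show "s v < D" "ts (s v) = tt (v div w) (v mod w)"
      unfolding s_def by simp_all
  qed
  have "grid_solution (T + 1) w D (\<lambda>v t. allowed_number ?k D ts off T w x pl (v div w) (v mod w) t)
      (in_certificate off x pl) cr cl cu cd nb s"
    unfolding grid_solution_def
  proof (intro conjI allI impI)
    fix v assume v: "v < (T + 1) * w"
    show "s v < D" by (rule s(1)[OF v])
    show "allowed_number ?k D ts off T w x pl (v div w) (v mod w) (s v)"
      unfolding allowed_number_iff using s[OF v] t1[OF rc[OF v]] by simp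
  next
    fix v assume v: "v < (T + 1) * w" and m: "v mod w + 1 < w"
    have e: "(v + 1) div w = v div w" "(v + 1) mod w = v mod w + 1"
      using m by (simp_all add: div_Suc mod_Suc)
    have "v < v + 1" by simp
    have v1: "v + 1 < (T + 1) * w"
    proof -
      have "(v div w + 1) * w \<le> (T + 1) * w" using rc(1)[OF v] by (intro mult_le_mono1) simp
      moreover have "v + 1 < v div w * w + w" using m div_mult_mod_eq[of v w] by linarith
      ultimately show ?thesis unfolding add_mult_distrib mult_1 by linarith
    qed
    show "cr (s v) = cl (s (v + 1))"
      unfolding cr[OF s(1)[OF v]] cl[OF s(1)[OF v1]] s(2)[OF v] s(2)[OF v1] e using t2[OF rc(1)[OF v] m] by simp
  next
    fix v assume v: "v < (T + 1) * w" and m: "v div w + 1 < T + 1"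
    have e: "(v + w) div w = v div w + 1" "(v + w) mod w = v mod w" using w by simp_all
    have v1: "v + w < (T + 1) * w"
    proof -
      have "(v div w + 1 + 1) * w \<le> (T + 1) * w" by (intro mult_le_mono1) (use m in simp)
      moreover have "v < v div w * w + w" using div_mult_mod_eq[of v w] mod_less_divisor[OF w, of v] by linarith
      ultimately show ?thesis unfolding add_mult_distrib mult_1 by linarith
    qed
    show "cu (s v) = cd (s (v + w))"
      unfolding cu[OF s(1)[OF v]] cd[OF s(1)[OF v1]] s(2)[OF v] s(2)[OF v1] e using t3[OF _ rc(2)[OF v]] m by simp
  next
    fix v assume v: "v + 1 < w \<and> in_certificate off x pl v"
    have v0: "v < (T + 1) * w" "v + 1 < (T + 1) * w" using v by simp_all
    have e: "v div w = 0" "v mod w = v" "(v + 1) div w = 0" "(v + 1) mod w = v + 1" using v by simp_all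
    show "nb (s (v + 1)) \<le> nb (s v)"
      unfolding nb[OF s(1)[OF v0(1)]] nb[OF s(1)[OF v0(2)]] s(2)[OF v0(1)] s(2)[OF v0(2)] e using t4[of v] v by auto
  qed
  then show "\<exists>s. grid_solution (T + 1) w D (\<lambda>v t. allowed_number ?k D ts off T w x pl (v div w) (v mod w) t)
      (in_certificate off x pl) cr cl cu cd nb s" by (intro exI)
next
  let ?k = "n_tapes M"
  assume "\<exists>s. grid_solution (T + 1) w D (\<lambda>v t. allowed_number ?k D ts off T w x pl (v div w) (v mod w) t)
      (in_certificate off x pl) cr cl cu cd nb s"
  then obtain s where s: "grid_solution (T + 1) w D (\<lambda>v t. allowed_number ?k D ts off T w x pl (v div w) (v mod w) t)
      (in_certificate off x pl) cr cl cu cd nb s" by blast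
  have s1: "s v < D \<and> allowed_tile ?k off T w x pl (v div w) (v mod w) (ts (s v))" if "v < (T + 1) * w" for v
    using s that unfolding grid_solution_def allowed_number_iff by simp
  have s2: "cr (s v) = cl (s (v + 1))" if "v < (T + 1) * w" "v mod w + 1 < w" for v
    using s that unfolding grid_solution_def by blast
  have s3: "cu (s v) = cd (s (v + w))" if "v < (T + 1) * w" "v div w + 1 < T + 1" for v
    using s that unfolding grid_solution_def by blast
  have s4: "nb (s (v + 1)) \<le> nb (s v)" if "v + 1 < w" "in_certificate off x pl v" for v
    using s that unfolding grid_solution_def by blast
  define tt where "tt i j = ts (s (i * w + j))" for i j
  have v: "i * w + j < (T + 1) * w" "(i * w + j) div w = i" "(i * w + j) mod w = j" if "i \<le> T" "j < w" for i j
  proof -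
    have "(i + 1) * w \<le> (T + 1) * w" by (intro mult_le_mono1) (use that in simp)
    then show "i * w + j < (T + 1) * w" using that(2) unfolding add_mult_distrib mult_1 by linarith
    show "(i * w + j) div w = i" "(i * w + j) mod w = j" using that(2) by simp_all
  qed
  have "tiling M off T w x pl tt"
    unfolding tiling_def
  proof (intro conjI allI impI)
    fix i j assume ij: "i \<le> T" "j < w"
    note sv = s1[OF v(1)[OF ij], unfolded v(2,3)[OF ij]]
    show "tt i j \<in> tiles M" unfolding tt_def using sv bij_betw_apply[OF ts, of "s (i * w + j)"] by simp
    show "allowed_tile ?k off T w x pl i j (tt i j)" unfolding tt_def using sv by simp
  next
    fix i j assume ij: "i \<le> T" "j + 1 < w"
    have j: "j < w" using ij by simp
    have "cr (s (i * w + j)) = cl (s (i * w + j + 1))"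
      by (rule s2[OF v(1)[OF ij(1) j]]) (use ij(2) v(3)[OF ij(1) j] in simp)
    then show "right_color ?k (tt i j) = left_color ?k (tt i (j + 1))"
      unfolding tt_def using s1[OF v(1)[OF ij(1) j]] s1[OF v(1)[OF ij]] cr cl by (simp add: add.assoc)
  next
    fix i j assume ij: "i < T" "j < w"
    have i: "i \<le> T" "i + 1 \<le> T" using ij by simp_all
    have "cu (s (i * w + j)) = cd (s (i * w + j + w))"
      by (rule s3[OF v(1)[OF i(1) ij(2)]]) (use ij(1) v(2)[OF i(1) ij(2)] in simp)
    moreover have e: "i * w + j + w = (i + 1) * w + j" by simp
    ultimately show "up_color M ?k (tt i j) = down_color ?k (tt (i + 1) j)"
      unfolding tt_def e using s1[OF v(1)[OF i(1) ij(2)]] s1[OF v(1)[OF i(2) ij(2)]] cu cd by simp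
  next
    fix j assume c: "in_certificate off x pl j" and z: "sym (tt 0 (j + 1)) 0 \<noteq> 0"
    have j: "j + 1 < w" "j < w" using c cert_w by (simp_all add: in_certificate_def)
    have "s j < D" "s (j + 1) < D" using s1[OF v(1)[of 0 j]] s1[OF v(1)[of 0 "j + 1"]] j by simp_all
    then show "sym (tt 0 j) 0 \<noteq> 0"
      using s4[OF j(1) c] z nb unfolding tt_def by (auto split: if_splits)
  qed
  then show "\<exists>tt. tiling M off T w x pl tt" by (intro exI)
qed

lemma language_NP_hard: "NP_hard separated_matching_induced_subgraph"
  unfolding NP_hard_def
proof
  fix L :: language assume "L \<in> class_NP"
  then obtain M p q where wf: "wf_tm M" and tiling: "\<And>x off T w pl. pl = poly p (length x) \<Longrightarrow>
      T = poly q (2 * length x + 1 + pl) \<Longrightarrow> off = T + 1 \<Longrightarrow>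
      w = 2 * T + 3 + (2 * length x + 1) + pl \<Longrightarrow> x \<in> L \<longleftrightarrow> (\<exists>tt. tiling M off T w x pl tt)"
    using class_NP_tiling by metis
  \<comment> \<open>\<open>M\<close>, \<open>p\<close> and \<open>q\<close> are fixed by
    \<open>L\<close>. Hence \<open>k\<close>, \<open>D\<close>, \<open>ts\<close>, the colour codes
    and \<open>b\<close> do not depend on \<open>x\<close> and enter the reduction as constants and
    tables.\<close>
  define k where "k = n_tapes M"
  define D where "D = card (tiles M)"
  have "tile_of ((tm_step M ^^ 0) (initial_config M [])) 0 \<in> tiles M"
    by (rule tile_of_in_tiles[OF valid_config_run[OF wf]])
  then have D_pos: "0 < D" unfolding D_def using finite_tiles[of M] by (auto simp: card_gt_0_iff)
  obtain ts where ts: "bij_betw ts {..<D} (tiles M)"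
    using ex_bij_betw_nat_finite[OF finite_tiles[of M]] unfolding D_def lessThan_atLeast0 by blast
  define cr where "cr = tile_number D ts (\<lambda>t. to_nat (right_color k t))"
  define cl where "cl = tile_number D ts (\<lambda>t. to_nat (left_color k t))"
  define cu where "cu = tile_number D ts (\<lambda>t. to_nat (up_color M k t))"
  define cd where "cd = tile_number D ts (\<lambda>t. to_nat (down_color k t))"
  define nb where "nb = tile_number D ts (\<lambda>t. of_bool (sym t 0 \<noteq> 0))"
  \<comment> \<open>A table has at most \<open>D\<close> nonzero values, so the sum of its values is
    a bound for all arguments.\<close>
  have "\<exists>b. \<forall>t. tile_number D ts F t \<le> b" for F
  proof (intro exI allI)
    show "tile_number D ts F t \<le> (\<Sum>t<D. F (ts t))" for t
      unfolding tile_number_def by (auto intro: member_le_sum)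
  qed
  then obtain b1 b2 b3 b4 b5 where b: "\<And>t. cr t \<le> b1" "\<And>t. cl t \<le> b2" "\<And>t. cu t \<le> b3" "\<And>t. cd t \<le> b4" "\<And>t. nb t \<le> b5"
    unfolding cr_def cl_def cu_def cd_def nb_def by metis
  define b where "b = b1 + b2 + b3 + b4 + b5"
  have bb: "cr t \<le> b" "cl t \<le> b" "cu t \<le> b" "cd t \<le> b" "nb t \<le> b" for t
    using b(1)[of t] b(2)[of t] b(3)[of t] b(4)[of t] b(5)[of t] by (simp_all add: b_def)
  define C where "C = D + b + 1"
  define pl where "pl x = poly p (length x)" for x :: "bool list"
  define T where "T x = poly q (2 * length x + 1 + pl x)" for x :: "bool list"
  define off where "off x = T x + 1" for x
  define w where "w x = 2 * T x + 3 + (2 * length x + 1) + pl x" for x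
  define n where "n x = (T x + 1) * w x" for x
  define S where "S x = 2 * (6 * n x) * D + n x + 6 * n x + 1" for x
  define al where "al x v t \<longleftrightarrow> allowed_number k D ts (off x) (T x) (w x) x (pl x) (v div w x) (v mod w x) t" for x v t
  define cert where "cert x = in_certificate (off x) x (pl x)" for x
  define vs where "vs x z \<longleftrightarrow> grid_strip (n x) (w x) (T x + 1) (cert x) (z div 2)" for x z
  define tab where "tab = color_table b cr cl cu cd nb"
  define F where "F x = pair_word
      (point_encoding (n x) (6 * n x) D C (S x) (grid_var (n x) (w x)) (grid_val (n x) D tab)
        (\<lambda>z t. vs x z \<and> al x (grid_var (n x) (w x) z) t))
      (point_encoding (n x) (6 * n x) D C (S x) (grid_var (n x) (w x)) (\<lambda>z t. 0) (\<lambda>z t. vs x z \<and> t = 0))" for x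
  have red: "x \<in> L \<longleftrightarrow> F x \<in> separated_matching_induced_subgraph" for x
  proof -
    interpret grid "T x + 1" "w x" D b "S x" C "cert x" "al x" cr cl cu cd nb
    proof
      show "0 < w x" by (simp add: w_def)
      show "S x = 2 * (6 * ((T x + 1) * w x)) * D + (T x + 1) * w x + 6 * ((T x + 1) * w x) + 1"
        by (simp add: S_def n_def)
    qed (simp_all add: D_pos bb C_def)
    have "x \<in> L \<longleftrightarrow> (\<exists>tt. tiling M (off x) (T x) (w x) x (pl x) tt)"
      by (rule tiling) (simp_all add: pl_def T_def off_def w_def)
    also have "\<dots> \<longleftrightarrow> (\<exists>s. grid_solution (T x + 1) (w x) D (\<lambda>v t. allowed_number (n_tapes M) D ts (off x) (T x) (w x) x (pl x) (v div w x) (v mod w x) t)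
      (in_certificate (off x) x (pl x)) cr cl cu cd nb s)"
      by (rule tiling_iff_grid_solution[OF ts])
        (simp_all add: w_def off_def cr_def cl_def cu_def cd_def nb_def tile_number_def k_def)
    also have "\<dots> \<longleftrightarrow> (\<exists>s. grid_solution (T x + 1) (w x) D (al x) (cert x) cr cl cu cd nb s)"
      unfolding al_def cert_def k_def ..
    also have "\<dots> \<longleftrightarrow> F x \<in> separated_matching_induced_subgraph"
      unfolding F_def vs_def tab_def n_def by (rule pair_of_slots_in_language_iff[symmetric])
    finally show ?thesis .
  qed
  have pl: "DEF (\<lambda>x \<sigma>. pl x)" unfolding pl_def by (intro def_intros)
  have T: "DEF (\<lambda>x \<sigma>. T x)" unfolding T_def by (intro pl def_intros)
  have off: "DEF (\<lambda>x \<sigma>. off x)" unfolding off_def by (intro T def_intros)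
  have w: "DEF (\<lambda>x \<sigma>. w x)" unfolding w_def by (intro T pl def_intros)
  have n: "DEF (\<lambda>x \<sigma>. n x)" unfolding n_def by (intro T w def_intros)
  have E: "DEF (\<lambda>x \<sigma>. 6 * n x)" by (intro n def_intros)
  have S: "DEF (\<lambda>x \<sigma>. S x)" unfolding S_def by (intro n def_intros)
  have xs: "DEF (\<lambda>x \<sigma>. grid_var (n x) (w x) (\<sigma> 0))"
    unfolding grid_var_def grid_cell_def by (intro n w def_intros)
  have val: "DEF (\<lambda>x \<sigma>. grid_val (n x) D tab (\<sigma> 0) (\<sigma> 1))"
    unfolding grid_val_def tab_def color_table_def cr_def cl_def cu_def cd_def nb_def
    by (intro n DEF_tile_number def_intros)
  have vs: "DEFP (\<lambda>x \<sigma>. vs x (\<sigma> 0))"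
    unfolding vs_def grid_strip_def grid_cell_def cert_def in_certificate_def by (intro n w T off pl def_intros)
  have "DEFP (\<lambda>x \<sigma>. al x (\<sigma> 0) (\<sigma> 1))"
    unfolding al_def allowed_number_def init_number_def
    by (intro w T off pl DEFP_tile_pred DEFP_word_bit def_intros)
  note al = DEFP_comp2[of al, OF this]
  have okT: "DEFP (\<lambda>x \<sigma>. vs x (\<sigma> 0) \<and> al x (grid_var (n x) (w x) (\<sigma> 0)) (\<sigma> 1))"
    by (intro DEFP_conj vs al xs DEF.var)
  have okP: "DEFP (\<lambda>x \<sigma>. vs x (\<sigma> 0) \<and> \<sigma> 1 = 0)"
    by (intro DEFP_conj vs DEFP_eq DEF.var DEF_const)
  have "GEN (\<lambda>x \<sigma>. F x)"
    unfolding F_def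
    by (intro GEN_pair_word GEN_point_encoding n E S xs val okT okP DEF_const)
  then show "polytime_reducible L separated_matching_induced_subgraph"
    by (rule polytime_reducible_GEN) (rule red)
qed

theorem theorem1:
  "NP_complete separated_matching_subgraph \<and> NP_complete separated_matching_induced_subgraph"
  unfolding languages_eq NP_complete_def using language_in_NP language_NP_hard by simp

end
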